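(* Let $\theta>0$ and let $\alpha=\frac{s}{t}$ be a rational number in reduced form ($t\ge1$). For $\sigma\in\mathfrak{S}_n$ drawn from the Ewens measure with parameter $\theta$, let $$\mathfrak{E}_n^\alpha:=\sum_{j=1}^nC_j^{(n)}\sum_{i\in\mathbb{Z}}\delta_{n(i/j-\alpha)},$$ where $C_j^{(n)}$ is the number of cycles of $\sigma$ of length $j$. Let $(L_1,L_2,\dots)$ be $PD(\theta)$-distributed, let $U_1,U_2,\dots$ be i.i.d. random variables distributed uniformly on the set $\{1/t,2/t,\dots,(t-1)/t,1\}$ and independent of $(L_1,L_2,\dots)$, and define $$\mathfrak{E}_\infty^t:=\sum_{i=1}^\infty\sum_{q\in\mathbb{Z}}\delta_{(U_i+q)/L_i}.$$ Then $\mathfrak{E}_n^\alpha\to\mathfrak{E}_\infty^t$ weakly as $n\to\infty$ in the sense that $\int f\,d\mathfrak{E}_n^\alpha\to\int f\,d\mathfrak{E}_\infty^t$ in distribution, as $\overline{\mathbb{R}}$-valued random variables, for all continuous, compactly supported functions $f:\mathbb{R}\to\mathbb{R}$.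
   Context: The Ewens measure with parameter $\theta>0$ on $\mathfrak{S}_n$ is $\nu_{n,\theta}(\sigma)=\theta^{K(\sigma)}/\big(\theta(\theta+1)\cdots(\theta+n-1)\big)$, where $K(\sigma)$ is the number of cycles of $\sigma$. $PD(\theta)$: let $W_1,W_2,\dots$ be i.i.d. with density $\theta(1-x)^{\theta-1}$ on $[0,1]$ and $V_j=W_j\prod_{i<j}(1-W_i)$; $PD(\theta)$ is the law of the decreasing order statistics of $(V_1,V_2,\dots)$. $\overline{\mathbb{R}}=\mathbb{R}\cup\{\pm\infty\}$ denotes the extended real numbers. The process $\mathfrak{E}_\infty^t$ has an infinite Dirac mass at $0$ almost surely, so $\int f\,d\mathfrak{E}_\infty^t$ may take infinite values; if $f(0)=0$ the atom at $0$ contributes $0$. $\delta_x$ is the Dirac mass at $x$. *)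

theory Defs
  imports "HOL-Probability.Probability" "HOL-Combinatorics.Orbits"
begin

text \<open>The symmetric group of degree \<open>n\<close> is the set of \<open>\<sigma>\<close> with \<open>\<sigma> permutes {1..n}\<close>; a cycle of \<open>\<sigma>\<close> is
  identified with its underlying set, and fixed points are cycles of length 1.\<close>

definition perm_cycles :: "nat \<Rightarrow> (nat \<Rightarrow> nat) \<Rightarrow> nat set set" where
  "perm_cycles n \<sigma> = orbit \<sigma> ` {1..n}"

definition num_cycles_of_length :: "nat \<Rightarrow> nat \<Rightarrow> (nat \<Rightarrow> nat) \<Rightarrow> nat" where
  "num_cycles_of_length n j \<sigma> = card {c \<in> perm_cycles n \<sigma>. card c = j}"

definition ewens :: "real \<Rightarrow> nat \<Rightarrow> (nat \<Rightarrow> nat) measure" where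
  "ewens \<theta> n = point_measure {\<sigma>. \<sigma> permutes {1..n}}
     (\<lambda>\<sigma>. ennreal (\<theta> ^ card (perm_cycles n \<sigma>) / pochhammer \<theta> n))"

text \<open>The decreasing order statistics of a sequence: \<open>ranked v k\<close> is the \<open>k\<close>-th largest value of \<open>v\<close>,
  counted with multiplicity and starting from \<open>k = 0\<close>.  Lemma \<open>ranked_rearrangement\<close> below shows
  that a positive null sequence is rearranged into decreasing order.\<close>

definition ranked :: "(nat \<Rightarrow> real) \<Rightarrow> nat \<Rightarrow> real" where
  "ranked v k = (SUP S\<in>{S. card S = Suc k}. Min (v ` S))"

definition stick_breaking :: "(nat \<Rightarrow> real) \<Rightarrow> nat \<Rightarrow> real" where
  "stick_breaking W j = W j * (\<Prod>i<j. 1 - W i)"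

definition stick_measure :: "real \<Rightarrow> real measure" where
  "stick_measure \<theta> =
     density lborel (\<lambda>x. ennreal (\<theta> * (1 - x) powr (\<theta> - 1) * indicator {0..1} x))"

definition poisson_dirichlet :: "real \<Rightarrow> (nat \<Rightarrow> real) measure" where
  "poisson_dirichlet \<theta> =
     distr (\<Pi>\<^sub>M j\<in>UNIV. stick_measure \<theta>) (\<Pi>\<^sub>M j\<in>UNIV. borel) (\<lambda>W. ranked (stick_breaking W))"

text \<open>The measure with mass \<open>w k\<close> at \<open>x k\<close> for every \<open>k \<in> I\<close>; masses at coinciding points add up
  (see \<open>emeasure_dirac_sum\<close>).\<close>

definition dirac_sum :: "'i set \<Rightarrow> ('i \<Rightarrow> ennreal) \<Rightarrow> ('i \<Rightarrow> real) \<Rightarrow> real measure" where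
  "dirac_sum I w x = distr (point_measure I w) borel x"

definition finite_process :: "nat \<Rightarrow> real \<Rightarrow> (nat \<Rightarrow> nat) \<Rightarrow> real measure" where
  "finite_process n \<alpha> \<sigma> =
     dirac_sum ({1..n} \<times> (UNIV :: int set))
       (\<lambda>(j, i). of_nat (num_cycles_of_length n j \<sigma>))
       (\<lambda>(j, i). real n * (real_of_int i / real j - \<alpha>))"

definition limit_process :: "(nat \<Rightarrow> real) \<Rightarrow> (nat \<Rightarrow> real) \<Rightarrow> real measure" where
  "limit_process l u =
     dirac_sum (UNIV :: (nat \<times> int) set) (\<lambda>_. 1) (\<lambda>(i, q). (u i + real_of_int q) / l i)"

text \<open>The integral with values in the extended reals, as the difference of the integrals of the
  positive and the negative part (\<open>ennreal\<close> truncates negative numbers to \<open>0\<close>).  It is meaningful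
  when at most one of the two is infinite; otherwise it has the junk value \<open>\<infinity>\<close>.\<close>

definition ext_integral :: "real measure \<Rightarrow> (real \<Rightarrow> real) \<Rightarrow> ereal" where
  "ext_integral \<mu> f =
     enn2ereal (\<integral>\<^sup>+x. ennreal (f x) \<partial>\<mu>) - enn2ereal (\<integral>\<^sup>+x. ennreal (- f x) \<partial>\<mu>)"

text \<open>Convergence in distribution of random variables that may live on different probability
  spaces.\<close>

definition converges_in_distribution ::
    "(nat \<Rightarrow> 'b measure) \<Rightarrow> (nat \<Rightarrow> 'b \<Rightarrow> 'c::topological_space) \<Rightarrow> 'a measure \<Rightarrow> ('a \<Rightarrow> 'c) \<Rightarrow> bool" where
  "converges_in_distribution M X N Y \<longleftrightarrow>
     (\<forall>n. X n \<in> borel_measurable (M n)) \<and> Y \<in> borel_measurable N \<and>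
     (\<forall>g :: 'c \<Rightarrow> real. continuous_on UNIV g \<longrightarrow> bounded (range g) \<longrightarrow>
        (\<lambda>n. \<integral>\<omega>. g (X n \<omega>) \<partial>M n) \<longlonglongrightarrow> (\<integral>\<omega>. g (Y \<omega>) \<partial>N))"

lemma sets_dirac_sum [simp, measurable_cong]: "sets (dirac_sum I w x) = sets borel"
  by (simp add: dirac_sum_def)

lemma emeasure_dirac_sum:
  assumes "A \<in> sets borel"
  shows "emeasure (dirac_sum I w x) A = (\<integral>\<^sup>+k. w k * emeasure (return borel (x k)) A \<partial>count_space I)"
proof -
  have "emeasure (dirac_sum I w x) A = emeasure (density (count_space I) w) (x -` A \<inter> I)"
    using assms by (simp add: dirac_sum_def point_measure_def emeasure_distr)
  also have "\<dots> = (\<integral>\<^sup>+k. w k * indicator (x -` A \<inter> I) k \<partial>count_space I)"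
    by (subst emeasure_density) auto
  also have "\<dots> = (\<integral>\<^sup>+k. w k * emeasure (return borel (x k)) A \<partial>count_space I)"
    using assms by (intro nn_integral_cong) (auto simp: indicator_def)
  finally show ?thesis .
qed

lemma nn_integral_dirac_sum:
  assumes [measurable]: "f \<in> borel_measurable borel"
  shows "(\<integral>\<^sup>+y. f y \<partial>dirac_sum I w x) = (\<integral>\<^sup>+k. w k * f (x k) \<partial>count_space I)"
  unfolding dirac_sum_def point_measure_def
  by (subst nn_integral_distr) (auto simp: nn_integral_density)

lemma measurable_ranked [measurable]:
  "ranked \<in> (\<Pi>\<^sub>M j\<in>UNIV. borel) \<rightarrow>\<^sub>M (\<Pi>\<^sub>M j\<in>UNIV. borel)"
proof (rule measurable_PiM_single')
  fix k :: nat
  let ?F = "{S :: nat set. card S = Suc k}"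
  let ?e = "\<lambda>v :: nat \<Rightarrow> real. SUP S\<in>?F. ereal (Min (v ` S))"
  have fin: "finite S" if "S \<in> ?F" for S
    using that by (auto intro: card_ge_0_finite)
  have cnt: "countable ?F"
    by (rule countable_subset[OF _ countable_Collect_finite]) (use fin in auto)
  have mem: "{..k} \<in> ?F"
    by auto
  have [measurable]: "(\<lambda>v. Min (v ` S)) \<in> borel_measurable (\<Pi>\<^sub>M j\<in>UNIV. borel :: real measure)"
    if "S \<in> ?F" for S
  proof -
    have "(\<lambda>v. Min ((\<lambda>i. v i) ` S)) \<in> borel_measurable (\<Pi>\<^sub>M j\<in>UNIV. borel :: real measure)"
      by (rule borel_measurable_Min) (use fin[OF that] in auto)
    then show ?thesis by simp
  qed
  have e [measurable]: "?e \<in> borel_measurable (\<Pi>\<^sub>M j\<in>UNIV. borel)"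
    by (rule borel_measurable_SUP[OF cnt]) auto
  have "ranked v k = (if ?e v = \<infinity> then (LEAST z :: real. False) else real_of_ereal (?e v))" for v
  proof (cases "bdd_above ((\<lambda>S. Min (v ` S)) ` ?F)")
    case True
    then obtain b where b: "\<And>S. S \<in> ?F \<Longrightarrow> Min (v ` S) \<le> b"
      by (auto simp: bdd_above_def)
    have "?e v \<le> ereal b"
      by (rule SUP_least) (simp add: b)
    moreover have "ereal (Min (v ` {..k})) \<le> ?e v"
      by (rule SUP_upper[OF mem])
    ultimately have "\<bar>?e v\<bar> \<noteq> \<infinity>"
      by (cases "?e v") auto
    then have "ereal (ranked v k) = ?e v"
      unfolding ranked_def using ereal_Sup[of "(\<lambda>S. Min (v ` S)) ` ?F"]
      by (simp add: image_comp)
    then show ?thesis by (metis PInfty_neq_ereal(1) real_of_ereal.simps(1))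
  next
    case False
    have "\<exists>S\<in>?F. b < Min (v ` S)" for b
      using False by (auto simp: bdd_above_def not_le)
    then have "?e v = \<infinity>"
      by (intro SUP_PInfty) (meson ereal_less_eq(3) less_imp_le)
    moreover have "\<not> (\<forall>x\<in>(\<lambda>S. Min (v ` S)) ` ?F. x \<le> z)" for z
      using False by (auto simp: bdd_above_def)
    then have "ranked v k = (LEAST z :: real. False)"
      by (simp only: ranked_def Sup_real_def)
    ultimately show ?thesis by simp
  qed
  then show "(\<lambda>v. ranked v k) \<in> borel_measurable (\<Pi>\<^sub>M j\<in>UNIV. borel)"
    by simp
qed auto

lemma ranked_rearrangement:
  assumes pos: "\<And>j. v j > 0" and lim: "v \<longlonglongrightarrow> 0"
  shows "decseq (ranked v)" and "\<exists>\<pi>. bij \<pi> \<and> ranked v = v \<circ> \<pi>"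
proof -
  define P where "P j = {i. v i > v j \<or> v i = v j \<and> i < j}" for j
  define r where "r j = card (P j)" for j
  have fin: "finite {i. v i \<ge> v j}" for j
  proof -
    have "eventually (\<lambda>i. v i < v j) sequentially"
      using lim pos[of j] by (rule order_tendstoD(2))
    then have "finite {i. \<not> v i < v j}"
      by (metis eventually_cofinite cofinite_eq_sequentially)
    then show ?thesis by (simp add: not_less)
  qed
  have finP: "finite (P j)" for j
    by (rule finite_subset[OF _ fin[of j]]) (auto simp: P_def)
  have less: "r i < r j" if "i \<in> P j" for i j
    unfolding r_def
    by (rule psubset_card_mono[OF finP]) (use that in \<open>auto simp: P_def\<close>)
  have tot: "i = j \<or> i \<in> P j \<or> j \<in> P i" for i j
    by (auto simp: P_def)
  have inj: "inj r"
    by (rule injI) (metis less tot less_irrefl)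
  have "\<exists>j. r j = k" for k
  proof -
    have "infinite (range r)"
      using inj finite_imageD by blast
    then obtain j where j: "k \<le> r j"
      by (metis (no_types, lifting) finite_nat_set_iff_bounded linorder_not_le rangeE imageE)
    have "r ` insert j (P j) \<subseteq> {..r j}"
      using less by (auto intro: less_imp_le)
    moreover have "card (r ` insert j (P j)) = card {..r j}"
    proof -
      have "card (r ` insert j (P j)) = card (insert j (P j))"
        by (rule card_image[OF inj_on_subset[OF inj]]) simp
      also have "\<dots> = Suc (r j)"
        using finP[of j] by (simp add: r_def) (simp add: P_def)
      finally show ?thesis by simp
    qed
    ultimately have "r ` insert j (P j) = {..r j}"
      by (intro card_subset_eq) auto
    then show ?thesis using j by (metis atMost_iff imageE)
  qed
  then have bij: "bij r"
    using inj by (auto simp: bij_def surj_def) metis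
  define \<pi> where "\<pi> = inv r"
  have r\<pi>: "r (\<pi> k) = k" for k
    unfolding \<pi>_def using bij by (simp add: bij_is_surj surj_f_inv_f)
  have bij\<pi>: "bij \<pi>"
    unfolding \<pi>_def by (rule bij_imp_bij_inv[OF bij])
  have dec: "v (\<pi> n) \<le> v (\<pi> m)" if "m \<le> n" for m n
  proof (rule ccontr)
    assume "\<not> v (\<pi> n) \<le> v (\<pi> m)"
    then have "\<pi> n \<in> P (\<pi> m)" by (auto simp: P_def)
    from less[OF this] show False using that by (simp add: r\<pi>)
  qed
  have eq: "ranked v k = v (\<pi> k)" for k
    unfolding ranked_def
  proof (rule cSup_eq_maximum)
    have "card (\<pi> ` {..k}) = Suc k"
      using bij\<pi> by (subst card_image) (auto simp: bij_def intro: inj_on_subset)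
    moreover have "Min (v ` \<pi> ` {..k}) = v (\<pi> k)"
      by (rule Min_eqI) (auto intro: dec)
    ultimately show "v (\<pi> k) \<in> (\<lambda>S. Min (v ` S)) ` {S. card S = Suc k}"
      by (metis (mono_tags, lifting) imageI mem_Collect_eq)
  next
    fix y assume "y \<in> (\<lambda>S. Min (v ` S)) ` {S. card S = Suc k}"
    then obtain S where S: "card S = Suc k" "y = Min (v ` S)" by auto
    have finS: "finite S" using S(1) by (auto intro: card_ge_0_finite)
    have "\<not> r ` S \<subseteq> {..<k}"
    proof
      assume "r ` S \<subseteq> {..<k}"
      from card_mono[OF _ this] show False
        using S(1) by (simp add: card_image inj_on_subset[OF inj])
    qed
    then obtain i where i: "i \<in> S" "k \<le> r i" by force
    have "\<pi> (r i) = i" unfolding \<pi>_def using inj by simp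
    then have "v i \<le> v (\<pi> k)" using dec[OF i(2)] by simp
    moreover have "y \<le> v i" using S(2) finS i(1) by simp
    ultimately show "y \<le> v (\<pi> k)" by simp
  qed
  show "decseq (ranked v)"
    unfolding decseq_def eq using dec by blast
  show "\<exists>\<pi>. bij \<pi> \<and> ranked v = v \<circ> \<pi>"
    using bij\<pi> eq by (intro exI[of _ \<pi>]) auto
qed

lemma sets_stick_measure [simp, measurable_cong]: "sets (stick_measure \<theta>) = sets borel"
  by (simp add: stick_measure_def)

lemma prob_space_stick_measure:
  assumes "\<theta> > 0"
  shows "prob_space (stick_measure \<theta>)"
proof
  have "((\<lambda>x. x powr (1 - 1) * (1 - x) powr (\<theta> - 1)) has_integral Beta 1 \<theta>) {0..1}"
    by (rule has_integral_Beta_real) (use assms in auto)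
  moreover have "Beta 1 \<theta> = 1 / \<theta>"
    using assms by (simp add: Beta_def Gamma_plus1[of \<theta>] add.commute[of 1] nonpos_Ints_def Gamma_eq_zero_iff)
  ultimately have "((\<lambda>x. \<theta> * (x powr (1 - 1) * (1 - x) powr (\<theta> - 1))) has_integral \<theta> * (1 / \<theta>)) {0..1}"
    by (intro has_integral_mult_right) simp
  then have "((\<lambda>x. \<theta> * (x powr (1 - 1) * (1 - x) powr (\<theta> - 1))) has_integral 1) {0..1}"
    using assms by simp
  then have "((\<lambda>x. \<theta> * (1 - x) powr (\<theta> - 1)) has_integral 1) {0..1}"
    by (rule has_integral_spike_finite[of "{0}", rotated 2]) (use assms in auto)
  then have *: "((\<lambda>x. \<theta> * (1 - x) powr (\<theta> - 1) * indicator {0..1} x) has_integral 1) UNIV"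
    by (subst (asm) has_integral_restrict_UNIV[symmetric])
       (auto elim!: has_integral_eq[rotated] simp: indicator_def)
  show "emeasure (stick_measure \<theta>) (space (stick_measure \<theta>)) = 1"
    unfolding stick_measure_def
    by (simp add: emeasure_density)
       (subst nn_integral_has_integral_lborel[OF _ _ *]; use assms in auto)
qed

lemma measurable_stick_breaking [measurable]:
  "stick_breaking \<in> (\<Pi>\<^sub>M j\<in>UNIV. borel) \<rightarrow>\<^sub>M (\<Pi>\<^sub>M j\<in>UNIV. borel)"
  by (rule measurable_PiM_single') (auto simp: stick_breaking_def)

lemma prob_space_poisson_dirichlet:
  assumes "\<theta> > 0"
  shows "prob_space (poisson_dirichlet \<theta>)"
proof -
  interpret product_prob_space "\<lambda>_. stick_measure \<theta>" UNIV
    using prob_space_stick_measure[OF assms]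
    by (simp add: product_prob_space_def product_prob_space_axioms_def product_sigma_finite_def
        prob_space_imp_sigma_finite)
  have "sets (\<Pi>\<^sub>M j\<in>(UNIV :: nat set). stick_measure \<theta>) = sets (\<Pi>\<^sub>M j\<in>UNIV. borel)"
    by (rule sets_PiM_cong) auto
  then have "(\<lambda>W. ranked (stick_breaking W)) \<in> (\<Pi>\<^sub>M j\<in>UNIV. stick_measure \<theta>) \<rightarrow>\<^sub>M (\<Pi>\<^sub>M j\<in>UNIV. borel)"
    by (subst measurable_cong_sets[OF _ refl]) measurable
  then show ?thesis
    unfolding poisson_dirichlet_def by (intro prob_space.prob_space_distr prob_space_PiM prob_space_stick_measure assms)
qed

end

theory Submission
  imports Defs
begin

text \<open>Apart from its atom at \<open>0\<close>, the finite process only sees the pairs \<open>(j/n, j mod t)\<close> of cycles of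
  length \<open>j\<close> at least of order \<open>n\<close>.  The cycle through a given point of an Ewens permutation of \<open>m\<close>
  points has a length \<open>J\<close> for which \<open>J/m\<close> is asymptotically Beta distributed with density
  \<open>\<theta> (1 - x)\<^sup>\<theta>\<^sup>-\<^sup>1\<close> and, because the probabilities of the single lengths are monotone and uniformly small,
  \<open>J mod t\<close> is asymptotically uniform and independent of it; what remains is an Ewens permutation of
  \<open>m - J\<close> points.  Hence the expectation of a product over all cycles satisfies a recursion that
  converges to the one given by stick breaking with independent uniform marks.  As marks that are
  i.i.d. and independent of the lengths do not notice the order of the lengths, one may pass to the
  decreasing rearrangement.

  If \<open>f 0 = 0\<close>, this applies to the characteristic function of the integral of \<open>f\<close>, and Levy's
  theorem gives the convergence.  If \<open>f 0 \<noteq> 0\<close>, the number of cycles whose length is divisible by \<open>t\<close>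
  tends to infinity in probability while the other points contribute a bounded amount, so both
  sides become infinite with the sign of \<open>f 0\<close>.\<close>

section \<open>Cycle weights of random permutations\<close>

text \<open>Two obstacles shape the argument. The recursion for the means passes from
  \<open>m\<close> points to \<open>m - J\<close> while the scale \<open>n\<close> of the test
  function stays fixed, so its limit has to be uniform in \<open>m \<le> n\<close>: this is why the
  limiting recursion carries the length \<open>y = m / n\<close> of the remaining stick and why the
  threshold in the first-cycle asymptotics is independent of the integrated function. Moreover
  \<open>m\<close> may be too small for any asymptotics. This is harmless because marks are
  multiples of \<open>1 / t\<close>: a point \<open>(u + q) / x\<close> other than \<open>0\<close>
  has modulus at least \<open>1 / (t x)\<close>, so for support in \<open>[-R, R]\<close> a cycle of
  relative length below \<open>1 / (t R)\<close> contributes nothing but the atom at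
  \<open>0\<close>. If \<open>f 0 \<noteq> 0\<close>, the growth of the number of cycles at
  \<open>0\<close> is read off from the mean of \<open>2\<close> to the power of minus that number:
  it is multiplicative over the cycles, obeys the same recursion, and controls the probability of
  few such cycles by Markov's inequality.\<close>

context
  fixes S :: "'a set" and q :: "'a \<Rightarrow> 'a" and a b :: 'a
  assumes fin: "finite S" and q: "q permutes S" and a: "a \<notin> S" and b: "b \<in> S"
begin

lemma transpose_comp_permutes: "(Transposition.transpose a b \<circ> q) permutes (insert a S)"
  by (rule permutes_compose[OF permutes_subset[OF q] permutes_swap_id]) (use b in auto)

text \<open>Composing with the transposition splices \<open>a\<close> into the cycle of
  \<open>q\<close> through \<open>b\<close>, immediately before \<open>b\<close>: the preimage of
  \<open>b\<close> is now sent to \<open>a\<close>, and \<open>a\<close> to \<open>b\<close>. Both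
  inclusions follow by induction along the orbit.\<close>

lemma orbit_transpose_comp_new: "orbit (Transposition.transpose a b \<circ> q) a = insert a (orbit q b)"
proof (intro equalityI subsetI)
  have qa: "q a = a" using q a by (simp add: permutes_not_in)
  have sub: "orbit q b \<subseteq> S" by (rule permutes_orbit_subset[OF q b])
  have self: "b \<in> orbit q b"
    using q fin by (intro permutation_self_in_orbit) (auto simp: permutation_permutes)
  fix x
  {
    assume "x \<in> orbit (Transposition.transpose a b \<circ> q) a"
    then show "x \<in> insert a (orbit q b)"
    proof induction
      case base
      then show ?case using self by (simp add: qa)
    next
      case (step y)
      then show ?case
      proof (cases "y = a")
        case False
        then have "q y \<in> orbit q b" using step by (auto intro: orbit.step)
        then show ?thesis using sub a by (cases "q y = b") (auto simp: Transposition.transpose_def)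
      qed (use self qa in simp)
    qed
  }
  assume x: "x \<in> insert a (orbit q b)"
  have ao: "a \<in> orbit (Transposition.transpose a b \<circ> q) a"
    using transpose_comp_permutes fin
    by (intro permutation_self_in_orbit) (auto simp: permutation_permutes intro: exI[of _ "insert a S"])
  have bo: "b \<in> orbit (Transposition.transpose a b \<circ> q) a"
    using orbit.base[of "Transposition.transpose a b \<circ> q" a] by (simp add: qa)
  \<comment> \<open>On \<open>S\<close> the new orbit is closed under the old \<open>q\<close>: the
    only rerouted value is \<open>b\<close>, which lies in the orbit anyway.\<close>
  have step: "q y \<in> orbit (Transposition.transpose a b \<circ> q) a" if "y \<in> orbit (Transposition.transpose a b \<circ> q) a" "y \<in> S" for y
  proof (cases "q y = b")
    case False
    moreover have "q y \<noteq> a" using that q a permutes_in_image by metis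
    ultimately show ?thesis using orbit.step[OF that(1)] by (simp add: Transposition.transpose_def)
  qed (use bo in simp)
  have "x \<in> orbit (Transposition.transpose a b \<circ> q) a" if "x \<in> orbit q b"
    using that
  proof induction
    case base
    then show ?case using step[OF bo b] .
  next
    case (step y)
    then show ?case using sub \<open>\<And>y. y \<in> orbit _ a \<Longrightarrow> y \<in> S \<Longrightarrow> _\<close> by blast
  qed
  then show "x \<in> orbit (Transposition.transpose a b \<circ> q) a" using x ao by auto
qed

lemma orbit_transpose_comp_old:
  assumes x: "x \<in> S" "x \<notin> orbit q b"
  shows "orbit (Transposition.transpose a b \<circ> q) x = orbit q x"
proof (rule orbit_cong)
  show self: "x \<in> orbit q x"
    using q fin by (intro permutation_self_in_orbit) (auto simp: permutation_permutes)
  fix s assume s: "s \<in> orbit q x"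
  have "q s \<in> orbit q x" using s by (rule orbit.step)
  moreover have "b \<notin> orbit q x" using orbit_swap[OF self] x(2) by blast
  moreover have "a \<notin> orbit q x" using permutes_orbit_subset[OF q x(1)] a by auto
  ultimately have "q s \<noteq> a" "q s \<noteq> b" by auto
  then show "(Transposition.transpose a b \<circ> q) s = q s" by simp
qed

text \<open>Consequently the splice changes a product over all cycles only in the factor of the
  cycle of \<open>b\<close>.\<close>

lemma orbits_transpose_comp_diff:
  "orbit (Transposition.transpose a b \<circ> q) ` insert a S - {orbit (Transposition.transpose a b \<circ> q) a} = orbit q ` S - {orbit q b}"
proof (intro equalityI subsetI)
  let ?p = "Transposition.transpose a b \<circ> q"
  have cyc: "cyclic_on ?p (orbit ?p a)"
    using transpose_comp_permutes fin by (intro cyclic_on_orbit[of _ "insert a S"]) auto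
  have cycq: "cyclic_on q (orbit q x)" for x
    using q fin by (rule cyclic_on_orbit)
  have selfq: "x \<in> orbit q x" for x
    using q fin by (intro permutation_self_in_orbit) (auto simp: permutation_permutes)
  fix c
  {
    assume "c \<in> orbit ?p ` insert a S - {orbit ?p a}"
    then obtain x where x: "x \<in> S" "c = orbit ?p x" "orbit ?p x \<noteq> orbit ?p a" by auto
    have nx: "x \<notin> orbit q b"
      using orbit_cyclic_eq3[OF cyc, of x] x orbit_transpose_comp_new by auto
    then have "orbit q x \<noteq> orbit q b" using selfq by metis
    then show "c \<in> orbit q ` S - {orbit q b}"
      using x nx orbit_transpose_comp_old by auto
  }
  assume "c \<in> orbit q ` S - {orbit q b}"
  then obtain x where x: "x \<in> S" "c = orbit q x" "orbit q x \<noteq> orbit q b" by auto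
  have nx: "x \<notin> orbit q b" using orbit_cyclic_eq3[OF cycq] x by blast
  have "c = orbit ?p x" using x nx orbit_transpose_comp_old by auto
  moreover have "a \<notin> orbit q x" using permutes_orbit_subset[OF q x(1)] a by auto
  ultimately show "c \<in> orbit ?p ` insert a S - {orbit ?p a}"
    using x orbit_transpose_comp_new by auto
qed

end

text \<open>Up to the factor \<open>1 / (card S)!\<close> this is the cycle index polynomial of the
  symmetric group, evaluated at \<open>u\<close>.\<close>

definition cycle_weight_sum :: "(nat \<Rightarrow> 'b::comm_ring_1) \<Rightarrow> 'a set \<Rightarrow> 'b" where
  "cycle_weight_sum u S = (\<Sum>p | p permutes S. \<Prod>c\<in>orbit p ` S. u (card c))"

text \<open>The cycle through \<open>a\<close> is treated as if it had \<open>k\<close> additional elements, so that removing a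
  point of that cycle can be compensated by increasing \<open>k\<close>.\<close>

definition marked_weight_sum :: "(nat \<Rightarrow> 'b::comm_ring_1) \<Rightarrow> nat \<Rightarrow> 'a \<Rightarrow> 'a set \<Rightarrow> 'b" where
  "marked_weight_sum u k a S =
     (\<Sum>p | p permutes S. u (card (orbit p a) + k) * (\<Prod>c\<in>orbit p ` S - {orbit p a}. u (card c)))"

lemma cycle_weight_sum_marked:
  assumes "finite S" "a \<in> S"
  shows "cycle_weight_sum u S = marked_weight_sum u 0 a S"
  unfolding cycle_weight_sum_def marked_weight_sum_def
proof (intro sum.cong refl)
  fix p
  show "(\<Prod>c\<in>orbit p ` S. u (card c)) =
      u (card (orbit p a) + 0) * (\<Prod>c\<in>orbit p ` S - {orbit p a}. u (card c))"
    using prod.remove[of "orbit p ` S" "orbit p a" "\<lambda>c. u (card c)"] assms by simp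
qed

text \<open>Permutations of \<open>insert a S\<close> correspond to pairs \<open>(b, q)\<close>
  through \<open>transpose a b \<circ> q\<close>. For \<open>b = a\<close> the new point is fixed
  and its cycle has weight \<open>u (Suc k)\<close>; for \<open>b \<in> S\<close> it joins the cycle
  of \<open>b\<close>, so the mark moves to \<open>b\<close> and the additional point is counted by
  \<open>Suc k\<close>.\<close>

lemma marked_weight_sum_insert:
  assumes fin: "finite S" and a: "a \<notin> S"
  shows "marked_weight_sum u k a (insert a S) =
    u (Suc k) * cycle_weight_sum u S + (\<Sum>b\<in>S. marked_weight_sum u (Suc k) b S)"
proof -
  let ?W = "\<lambda>p. u (card (orbit p a) + k) * (\<Prod>c\<in>orbit p ` insert a S - {orbit p a}. u (card c))"
  have "marked_weight_sum u k a (insert a S) =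
      (\<Sum>b\<in>insert a S. \<Sum>q | q permutes S. ?W (Transposition.transpose a b \<circ> q))"
    unfolding marked_weight_sum_def by (rule sum_over_permutations_insert[OF fin a])
  also have "\<dots> = (\<Sum>q | q permutes S. ?W q) + (\<Sum>b\<in>S. \<Sum>q | q permutes S. ?W (Transposition.transpose a b \<circ> q))"
    using fin a by simp
  also have "(\<Sum>q | q permutes S. ?W q) = u (Suc k) * cycle_weight_sum u S"
    unfolding cycle_weight_sum_def sum_distrib_left
  proof (intro sum.cong refl)
    fix q assume "q \<in> {q. q permutes S}"
    then have q: "q permutes S" by simp
    have "q a = a" using q a by (simp add: permutes_not_in)
    then have o: "orbit q a = {a}" by (simp add: orbit_eq_singleton_iff)
    have "{a} \<noteq> orbit q x" if "x \<in> S" for x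
      using permutes_orbit_subset[OF q that] a by auto
    then have "orbit q ` insert a S - {orbit q a} = orbit q ` S" using o by auto
    then show "?W q = u (Suc k) * (\<Prod>c\<in>orbit q ` S. u (card c))" by (simp add: o)
  qed
  also have "(\<Sum>b\<in>S. \<Sum>q | q permutes S. ?W (Transposition.transpose a b \<circ> q)) = (\<Sum>b\<in>S. marked_weight_sum u (Suc k) b S)"
    unfolding marked_weight_sum_def
  proof (intro sum.cong refl)
    fix b q assume b: "b \<in> S" and "q \<in> {q. q permutes S}"
    then have q: "q permutes S" by simp
    have "finite (orbit q b)" "a \<notin> orbit q b"
      using permutes_orbit_subset[OF q b] a fin by (auto intro: finite_subset)
    then show "?W (Transposition.transpose a b \<circ> q) =
        u (card (orbit q b) + Suc k) * (\<Prod>c\<in>orbit q ` S - {orbit q b}. u (card c))"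
      by (simp only: orbits_transpose_comp_diff[OF fin q a b])
         (simp add: orbit_transpose_comp_new[OF fin q a b])
  qed
  finally show ?thesis .
qed

text \<open>\<open>pick \<theta> m j\<close> is the probability that the cycle through a given point has length \<open>j + 1\<close> in an
  Ewens permutation of \<open>m + 1\<close> points.\<close>

fun pick :: "real \<Rightarrow> nat \<Rightarrow> nat \<Rightarrow> real" where
  "pick \<theta> m 0 = \<theta> / (real m + \<theta>)"
| "pick \<theta> 0 (Suc j) = 0"
| "pick \<theta> (Suc m) (Suc j) = real (Suc m) / (real (Suc m) + \<theta>) * pick \<theta> m j"

text \<open>The expectation of the product of \<open>w\<close> over all cycle lengths, obtained by
  conditioning on the cycle through one point: its length is \<open>Suc j\<close>, and an Ewens
  permutation of \<open>m - j\<close> points is left.\<close>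

fun ewens_mean :: "real \<Rightarrow> (nat \<Rightarrow> 'b::real_normed_field) \<Rightarrow> nat \<Rightarrow> 'b" where
  "ewens_mean \<theta> w 0 = 1"
| "ewens_mean \<theta> w (Suc m) = (\<Sum>j\<le>m. of_real (pick \<theta> m j) * w (Suc j) * ewens_mean \<theta> w (m - j))"

text \<open>The two claims need each other: inserting a point produces a full weight sum (the point
  is fixed) and marked sums with a larger \<open>k\<close>, while a full sum is a marked sum with
  \<open>k = 0\<close>. Hence the simultaneous induction with \<open>k\<close> arbitrary.\<close>

lemma weight_sums_eq_ewens_mean:
  fixes w :: "nat \<Rightarrow> 'b::real_normed_field"
  assumes \<theta>: "\<theta> > 0"
  defines "u \<equiv> \<lambda>j. of_real \<theta> * w j"
  shows "finite S \<Longrightarrow> card S = Suc m \<Longrightarrow> a \<in> S \<Longrightarrow> marked_weight_sum u k a S =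
      of_real (pochhammer \<theta> (Suc m)) *
        (\<Sum>j\<le>m. of_real (pick \<theta> m j) * w (Suc j + k) * ewens_mean \<theta> w (m - j))"
    and "finite S \<Longrightarrow> card S = m \<Longrightarrow>
      cycle_weight_sum u S = of_real (pochhammer \<theta> m) * ewens_mean \<theta> w m"
proof (induction m arbitrary: S a k)
  case 0
  {
    case 2
    then show ?case by (simp add: cycle_weight_sum_def)
  }
  case 1
  then have "S = {a}" by (auto simp: card_Suc_eq)
  then show ?case
    using marked_weight_sum_insert[of "{}" a u k] \<theta> by (simp add: u_def cycle_weight_sum_def)
next
  case (Suc m)
  {
    case 2
    then obtain a where "a \<in> S" by (auto simp: card_Suc_eq)
    then show ?case
      using cycle_weight_sum_marked[OF 2(1), of a u] Suc.IH(1)[OF 2(1,2), of a 0] by simp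
  } note cyc = this
  case 1
  define T where "T = S - {a}"
  have T: "finite T" "a \<notin> T" "S = insert a T" "card T = Suc m"
    using 1 by (auto simp: T_def)
  let ?P = "of_real (pochhammer \<theta> (Suc m)) :: 'b"
  let ?f = "\<lambda>j. w (Suc j + k) * ewens_mean \<theta> w (Suc m - j)"
  let ?s = "\<Sum>j\<le>m. of_real (pick \<theta> m j) * w (Suc j + Suc k) * ewens_mean \<theta> w (m - j)"
  have "marked_weight_sum u k a S = u (Suc k) * (?P * ewens_mean \<theta> w (Suc m)) + of_nat (Suc m) * (?P * ?s)"
    unfolding T(3) marked_weight_sum_insert[OF T(1,2)] using cyc[OF T(1,4)] Suc.IH(1)[OF T(1,4)]
    by (simp add: T(4))
  also have "\<dots> = ?P * (of_real \<theta> * ?f 0 + of_nat (Suc m) * ?s)"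
    by (simp add: u_def algebra_simps del: ewens_mean.simps of_nat_Suc)
  also have "?s = (\<Sum>j\<le>m. of_real (pick \<theta> m j) * ?f (Suc j))"
    by (simp add: mult.assoc)
  \<comment> \<open>Pulling out \<open>\<theta> + Suc m\<close>, the next factor of the Pochhammer
    symbol, leaves the probability \<open>\<theta> / (\<theta> + Suc m)\<close> of closing the cycle
    and its complement, as in the recursion of \<open>pick\<close>.\<close>
  also have "of_real \<theta> * ?f 0 + of_nat (Suc m) * \<dots> =
      of_real (\<theta> + Suc m) * (\<Sum>j\<le>Suc m. of_real (pick \<theta> (Suc m) j) * ?f j)"
  proof -
    have ne: "\<theta> + Suc m \<noteq> 0" using \<theta> by simp
    have p0: "of_real (\<theta> + Suc m) * (of_real (pick \<theta> (Suc m) 0) * x) = of_real \<theta> * x" for x :: 'b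
      unfolding mult.assoc[symmetric] of_real_mult[symmetric] using ne by (simp add: add.commute)
    have "(\<theta> + Suc m) * pick \<theta> (Suc m) (Suc j) = Suc m * pick \<theta> m j" for j
      using ne by (simp add: add.commute)
    then have p1: "of_real (\<theta> + Suc m) * (of_real (pick \<theta> (Suc m) (Suc j)) * x) =
        of_nat (Suc m) * (of_real (pick \<theta> m j) * x)" for x :: 'b and j
      unfolding mult.assoc[symmetric] of_real_mult[symmetric]
      by (metis of_real_mult of_real_of_nat_eq)
    show ?thesis
      unfolding sum.atMost_Suc_shift sum_distrib_left distrib_left p0 p1 ..
  qed
  also have "?P * \<dots> = of_real (pochhammer \<theta> (Suc (Suc m))) * (\<Sum>j\<le>Suc m. of_real (pick \<theta> (Suc m) j) * ?f j)"
    unfolding pochhammer_Suc[of \<theta> "Suc m"] of_real_mult mult.assoc ..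
  finally show ?case by (simp only: mult.assoc)
qed

lemma sum_ewens_cycle_prod:
  fixes w :: "nat \<Rightarrow> 'b::real_normed_field"
  assumes \<theta>: "\<theta> > 0"
  shows "(\<Sum>\<sigma> | \<sigma> permutes {1..n}. of_real (\<theta> ^ card (perm_cycles n \<sigma>) / pochhammer \<theta> n) *
    (\<Prod>c\<in>perm_cycles n \<sigma>. w (card c))) = ewens_mean \<theta> w n"
proof -
  have "pochhammer \<theta> n > 0" using \<theta> by (rule pochhammer_pos)
  moreover have "(\<Sum>\<sigma> | \<sigma> permutes {1..n}. of_real (\<theta> ^ card (perm_cycles n \<sigma>) / pochhammer \<theta> n) *
    (\<Prod>c\<in>perm_cycles n \<sigma>. w (card c))) = cycle_weight_sum (\<lambda>j. of_real \<theta> * w j) {1..n} / of_real (pochhammer \<theta> n)"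
    unfolding cycle_weight_sum_def sum_divide_distrib
    by (intro sum.cong refl) (simp add: perm_cycles_def prod.distrib)
  ultimately show ?thesis
    using weight_sums_eq_ewens_mean(2)[OF \<theta>, of "{1..n}" n w] by simp
qed

section \<open>The length of the cycle through a given point\<close>

text \<open>The probability that the cycle through a given one of \<open>m + 1\<close> points is
  longer than \<open>k\<close>. As in the Feller coupling, factor \<open>i\<close> is the
  probability that the cycle does not close when it has \<open>i + 1\<close> points.\<close>

definition pick_tail :: "real \<Rightarrow> nat \<Rightarrow> nat \<Rightarrow> real" where
  "pick_tail \<theta> m k = (\<Prod>i<k. (real m - real i) / (real m - real i + \<theta>))"

lemma pick_tail_0 [simp]: "pick_tail \<theta> m 0 = 1"
  by (simp add: pick_tail_def)

lemma pick_tail_Suc: "pick_tail \<theta> m (Suc k) = pick_tail \<theta> m k * ((real m - real k) / (real m - real k + \<theta>))"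
  by (simp add: pick_tail_def)

lemma pick_tail_Suc_Suc:
  "pick_tail \<theta> (Suc m) (Suc k) = real (Suc m) / (real (Suc m) + \<theta>) * pick_tail \<theta> m k"
  unfolding pick_tail_def by (subst prod.lessThan_Suc_shift) simp

lemma pick_tail_eq_0 [simp]: "pick_tail \<theta> m (Suc m) = 0"
  by (simp add: pick_tail_Suc)

lemma pick_nonneg: "\<theta> > 0 \<Longrightarrow> pick \<theta> m j \<ge> 0"
  by (induction \<theta> m j rule: pick.induct) auto

lemma pick_eq_tail:
  "j \<le> m \<Longrightarrow> pick \<theta> m j = pick_tail \<theta> m j * (\<theta> / (real m - real j + \<theta>))"
  by (induction \<theta> m j rule: pick.induct) (auto simp: pick_tail_Suc_Suc)

lemma pick_eq_tail_diff:
  assumes "\<theta> > 0" "j \<le> m"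
  shows "pick \<theta> m j = pick_tail \<theta> m j - pick_tail \<theta> m (Suc j)"
proof -
  have "real m - real j + \<theta> \<noteq> 0" using assms by auto
  then have "\<theta> / (real m - real j + \<theta>) = 1 - (real m - real j) / (real m - real j + \<theta>)"
    by (simp add: field_simps)
  then show ?thesis
    unfolding pick_eq_tail[OF assms(2)] pick_tail_Suc by (simp only: right_diff_distrib mult_1_right)
qed

lemma sum_pick:
  assumes "\<theta> > 0" "a \<le> b" "b \<le> Suc m"
  shows "(\<Sum>j=a..<b. pick \<theta> m j) = pick_tail \<theta> m a - pick_tail \<theta> m b"
proof -
  have "(\<Sum>j=a..<b. pick \<theta> m j) = - (\<Sum>j=a..<b. pick_tail \<theta> m (Suc j) - pick_tail \<theta> m j)"
    unfolding sum_negf[symmetric] using assms by (intro sum.cong) (auto simp: pick_eq_tail_diff)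
  then show ?thesis using sum_Suc_diff'[OF assms(2), of "pick_tail \<theta> m"] by simp
qed

lemma sum_pick_eq_1:
  assumes "\<theta> > 0"
  shows "(\<Sum>j\<le>m. pick \<theta> m j) = 1"
  using sum_pick[OF assms, of 0 "Suc m" m] by (simp add: atLeast0LessThan lessThan_Suc_atMost)

text \<open>Probabilistically, two given points lie in different cycles with probability
  \<open>\<theta> / (1 + \<theta>)\<close>, and this is summed over the \<open>m\<close> other
  points. The proof is an induction along the recursion of \<open>pick\<close>. The factor is the
  contraction rate of the truncation error.\<close>

lemma sum_pick_remainder:
  assumes "\<theta> > 0"
  shows "(\<Sum>j\<le>m. pick \<theta> m j * real (m - j)) = real m * \<theta> / (1 + \<theta>)"
proof (induction m)
  case (Suc m)
  have "(\<Sum>j\<le>Suc m. pick \<theta> (Suc m) j * real (Suc m - j)) =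
      pick \<theta> (Suc m) 0 * real (Suc m) +
      real (Suc m) / (real (Suc m) + \<theta>) * (\<Sum>j\<le>m. pick \<theta> m j * real (m - j))"
    unfolding sum.atMost_Suc_shift sum_distrib_left by (simp add: mult.assoc del: of_nat_Suc)
  also have "\<dots> = real (Suc m) * (\<theta> / (real (Suc m) + \<theta>)) * (1 + real m / (1 + \<theta>))"
    unfolding Suc.IH pick.simps by (simp add: divide_inverse algebra_simps del: of_nat_Suc)
  also have "1 + real m / (1 + \<theta>) = (real (Suc m) + \<theta>) / (1 + \<theta>)"
    using assms by (simp add: field_simps)
  finally show ?case using assms by simp
qed simp

lemma pick_Suc_right:
  assumes "\<theta> > 0" "j < m"
  shows "pick \<theta> m (Suc j) = pick \<theta> m j * ((real m - real j) / (real m - real j - 1 + \<theta>))"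
proof -
  have "real j + 1 \<le> real m" using assms(2) by (metis Suc_eq_plus1 Suc_leI of_nat_1 of_nat_add of_nat_le_iff)
  then have "real m - real j + \<theta> \<noteq> 0" "real m - real j - 1 + \<theta> \<noteq> 0" using assms(1) by linarith+
  then show ?thesis using assms
    by (simp add: pick_eq_tail pick_tail_Suc diff_diff_eq add.commute[of 1])
qed

text \<open>The point probabilities are monotone in \<open>j\<close> (increasing for \<open>\<theta> \<le> 1\<close>, decreasing for
  \<open>\<theta> \<ge> 1\<close>), so their total variation is controlled by the two extreme values.\<close>

lemma sum_pick_variation:
  assumes \<theta>: "\<theta> > 0"
  shows "(\<Sum>j<m. \<bar>pick \<theta> m (Suc j) - pick \<theta> m j\<bar>) \<le> pick \<theta> m 0 + pick \<theta> m m"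
proof -
  have tele: "(\<Sum>j<m. pick \<theta> m (Suc j) - pick \<theta> m j) = pick \<theta> m m - pick \<theta> m 0"
    by (rule sum_lessThan_telescope)
  have frac: "real m - real j - 1 + \<theta> > 0" if "j < m" for j
    using that \<theta> by linarith
  show ?thesis
  proof (cases "\<theta> \<le> 1")
    case True
    have "pick \<theta> m (Suc j) \<ge> pick \<theta> m j" if "j < m" for j
    proof -
      have "(real m - real j) / (real m - real j - 1 + \<theta>) \<ge> 1"
        using frac[OF that] True by (simp add: field_simps)
      then show ?thesis
        unfolding pick_Suc_right[OF \<theta> that] using mult_left_mono[OF _ pick_nonneg[OF \<theta>, of m j]] by fastforce
    qed
    then have "(\<Sum>j<m. \<bar>pick \<theta> m (Suc j) - pick \<theta> m j\<bar>) = (\<Sum>j<m. pick \<theta> m (Suc j) - pick \<theta> m j)"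
      by (intro sum.cong) auto
    then show ?thesis using tele pick_nonneg[OF \<theta>, of m 0] by simp
  next
    case False
    have "pick \<theta> m (Suc j) \<le> pick \<theta> m j" if "j < m" for j
    proof -
      have "(real m - real j) / (real m - real j - 1 + \<theta>) \<le> 1"
        using frac[OF that] False by (simp add: field_simps)
      then show ?thesis
        unfolding pick_Suc_right[OF \<theta> that] using mult_left_mono[OF _ pick_nonneg[OF \<theta>, of m j]] by fastforce
    qed
    then have "(\<Sum>j<m. \<bar>pick \<theta> m (Suc j) - pick \<theta> m j\<bar>) = (\<Sum>j<m. - (pick \<theta> m (Suc j) - pick \<theta> m j))"
      by (intro sum.cong) auto
    then show ?thesis using tele pick_nonneg[OF \<theta>, of m m] unfolding sum_negf by simp
  qed
qed

text \<open>For \<open>i > 0\<close> this is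
  \<open>Gamma (i + \<theta>) / (Gamma \<theta> * Gamma i)\<close>, asymptotically
  \<open>i powr \<theta> / Gamma \<theta>\<close>. It is introduced because \<open>pick_tail\<close>
  telescopes into a quotient of two of its values.\<close>

definition ewens_scale :: "real \<Rightarrow> nat \<Rightarrow> real" where
  "ewens_scale \<theta> i = pochhammer \<theta> i / fact (i - 1)"

lemma ewens_scale_pos: "\<theta> > 0 \<Longrightarrow> ewens_scale \<theta> i > 0"
  by (simp add: ewens_scale_def pochhammer_pos)

lemma ewens_scale_Suc:
  assumes "i > 0"
  shows "ewens_scale \<theta> (Suc i) = ewens_scale \<theta> i * ((real i + \<theta>) / real i)"
  using assms by (cases i) (auto simp: ewens_scale_def pochhammer_Suc fact_Suc field_simps)

lemma pick_tail_eq_scale: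
  assumes \<theta>: "\<theta> > 0" and "k \<le> m"
  shows "pick_tail \<theta> m k = ewens_scale \<theta> (Suc m - k) / ewens_scale \<theta> (Suc m)"
  using assms(2)
proof (induction k)
  case 0
  then show ?case using ewens_scale_pos[OF \<theta>, of "Suc m"] by simp
next
  case (Suc k)
  have "ewens_scale \<theta> (Suc m - k) = ewens_scale \<theta> (Suc m - Suc k) * ((real (m - k) + \<theta>) / real (m - k))"
    using ewens_scale_Suc[of "m - k" \<theta>] Suc.prems by (simp add: Suc_diff_le)
  moreover have "real (m - k) > 0" "real (m - k) + \<theta> > 0" "real (m - k) = real m - real k"
    using Suc.prems \<theta> by auto
  ultimately show ?case
    using Suc by (simp add: pick_tail_Suc)
qed

lemma ewens_scale_Gamma:
  assumes "i > 0" "\<theta> > 0"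
  shows "ewens_scale \<theta> i = real i powr \<theta> / Gamma_series' \<theta> i"
  using assms by (simp add: ewens_scale_def Gamma_series'_def powr_def)

lemma inverse_ewens_scale_tendsto:
  assumes "\<theta> > 0"
  shows "(\<lambda>i. 1 / ewens_scale \<theta> i) \<longlonglongrightarrow> 0"
proof -
  have "(\<lambda>i. real i powr - \<theta> * Gamma_series' \<theta> i) \<longlonglongrightarrow> 0 * Gamma \<theta>"
    using assms by (intro tendsto_mult Gamma_series'_LIMSEQ tendsto_neg_powr filterlim_real_sequentially) auto
  then have "(\<lambda>i. real i powr - \<theta> * Gamma_series' \<theta> i) \<longlonglongrightarrow> 0" by simp
  then show ?thesis
  proof (rule Lim_transform_eventually)
    show "\<forall>\<^sub>F i in sequentially. real i powr - \<theta> * Gamma_series' \<theta> i = 1 / ewens_scale \<theta> i"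
      using eventually_gt_at_top[of 0]
      by eventually_elim (auto simp: ewens_scale_Gamma assms powr_minus field_simps)
  qed
qed

text \<open>For \<open>M \<le> Suc m\<close> this is the probability that the first cycle leaves
  fewer than \<open>M\<close> points; for fixed \<open>M\<close> it decays like
  \<open>1 / ewens_scale \<theta> (Suc m)\<close>.\<close>

lemma pick_tail_end_tendsto:
  assumes \<theta>: "\<theta> > 0"
  shows "(\<lambda>m. pick_tail \<theta> m (Suc m - M)) \<longlonglongrightarrow> 0"
proof (cases "M = 0")
  case False
  have "(\<lambda>m. ewens_scale \<theta> M * (1 / ewens_scale \<theta> (Suc m))) \<longlonglongrightarrow> ewens_scale \<theta> M * 0"
    by (intro tendsto_intros LIMSEQ_Suc inverse_ewens_scale_tendsto \<theta>)
  then have "(\<lambda>m. ewens_scale \<theta> M * (1 / ewens_scale \<theta> (Suc m))) \<longlonglongrightarrow> 0" by simp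
  then show ?thesis
  proof (rule Lim_transform_eventually)
    show "\<forall>\<^sub>F m in sequentially. ewens_scale \<theta> M * (1 / ewens_scale \<theta> (Suc m)) = pick_tail \<theta> m (Suc m - M)"
      using eventually_ge_at_top[of M]
      by eventually_elim (use False in \<open>auto simp: pick_tail_eq_scale \<theta>\<close>)
  qed
qed simp

lemma pick_max_tendsto:
  assumes \<theta>: "\<theta> > 0"
  shows "(\<lambda>m. pick \<theta> m 0 + pick \<theta> m m) \<longlonglongrightarrow> 0"
proof -
  have "(\<lambda>m. \<theta> / (real m + \<theta>)) \<longlonglongrightarrow> 0"
    by real_asymp
  moreover have "(\<lambda>m. pick \<theta> m m) \<longlonglongrightarrow> 0"
    using pick_tail_end_tendsto[OF \<theta>, of 1] \<theta> by (simp add: pick_eq_tail)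
  ultimately show ?thesis using tendsto_add by fastforce
qed

text \<open>The limit is the tail of the Beta law at \<open>k / K\<close>. With \<open>M m\<close>
  the number of points left, the quotient of the two \<open>ewens_scale\<close> values is
  \<open>(M m / Suc m) powr \<theta>\<close> times a quotient of two Gamma series, both with limit
  \<open>Gamma \<theta>\<close>. The case \<open>k = K\<close>, where no points are left, is
  separate.\<close>

lemma pick_tail_tendsto:
  assumes \<theta>: "\<theta> > 0" and k: "k \<le> K" and K: "K > 0"
  shows "(\<lambda>m. pick_tail \<theta> m (Suc m * k div K)) \<longlonglongrightarrow> (1 - real k / real K) powr \<theta>"
proof (cases "k = K")
  case False
  with k have kK: "k < K" by simp
  define x where "x = real k / real K"
  have x: "0 \<le> x" "x < 1" using kK K by (auto simp: x_def)
  define a where "a m = Suc m * k div K" for m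
  define M where "M m = Suc m - a m" for m
  have a_le: "a m \<le> m" for m
  proof -
    have "a m < Suc m" unfolding a_def using kK by (intro less_mult_imp_div_less mult_strict_left_mono) auto
    then show ?thesis by simp
  qed
  have a_bounds: "real (Suc m) * x - 1 \<le> real (a m)" "real (a m) \<le> real (Suc m) * x" for m
  proof -
    have "real (a m) = of_int \<lfloor>real (Suc m * k) / real K\<rfloor>"
      unfolding a_def by (simp only: floor_divide_of_nat_eq of_int_of_nat_eq)
    moreover have "real (Suc m * k) / real K = real (Suc m) * x" by (simp add: x_def algebra_simps)
    ultimately show "real (Suc m) * x - 1 \<le> real (a m)" "real (a m) \<le> real (Suc m) * x"
      by linarith+
  qed
  have rat: "(\<lambda>m. real (M m) / real (Suc m)) \<longlonglongrightarrow> 1 - x"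
  proof (rule tendsto_sandwich)
    show "\<forall>\<^sub>F m in sequentially. 1 - x \<le> real (M m) / real (Suc m)"
      using a_bounds a_le by (intro always_eventually allI)
        (simp add: M_def of_nat_diff le_SucI field_simps)
    show "\<forall>\<^sub>F m in sequentially. real (M m) / real (Suc m) \<le> 1 - x + 1 / real (Suc m)"
    proof (intro always_eventually allI)
      fix m
      have "real (M m) \<le> (1 - x) * real (Suc m) + 1"
        using a_bounds[of m] a_le[of m] by (simp add: M_def of_nat_diff le_SucI algebra_simps)
      then show "real (M m) / real (Suc m) \<le> 1 - x + 1 / real (Suc m)"
        by (simp add: pos_divide_le_eq distrib_right del: of_nat_Suc)
    qed
    show "(\<lambda>m. 1 - x + 1 / real (Suc m)) \<longlonglongrightarrow> 1 - x" by real_asymp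
  qed simp
  have "filterlim (\<lambda>m. (real (M m) / real (Suc m)) * real (Suc m)) at_top sequentially"
  proof (rule filterlim_tendsto_pos_mult_at_top[OF rat])
    show "filterlim (\<lambda>m. real (Suc m)) at_top sequentially" by real_asymp
  qed (use x in simp)
  then have rlim: "filterlim (\<lambda>m. real (M m)) at_top sequentially" by simp
  have Mlim: "filterlim M at_top sequentially"
    unfolding filterlim_at_top
  proof
    fix Z
    have "\<forall>\<^sub>F m in sequentially. real Z \<le> real (M m)"
      using rlim unfolding filterlim_at_top by blast
    then show "\<forall>\<^sub>F m in sequentially. Z \<le> M m" by simp
  qed
  have G: "Gamma \<theta> > 0" using \<theta> by (rule Gamma_real_pos)
  have "(\<lambda>m. (real (M m) / real (Suc m)) powr \<theta> * (Gamma_series' \<theta> (Suc m) / Gamma_series' \<theta> (M m)))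
      \<longlonglongrightarrow> (1 - x) powr \<theta> * (Gamma \<theta> / Gamma \<theta>)"
    by (intro tendsto_mult tendsto_powr rat tendsto_divide tendsto_const
          LIMSEQ_Suc Gamma_series'_LIMSEQ filterlim_compose[OF Gamma_series'_LIMSEQ Mlim])
       (use x G in auto)
  moreover have "pick_tail \<theta> m (a m) =
      (real (M m) / real (Suc m)) powr \<theta> * (Gamma_series' \<theta> (Suc m) / Gamma_series' \<theta> (M m))" for m
  proof -
    have "M m > 0" using a_le[of m] by (simp add: M_def)
    then show ?thesis
      unfolding pick_tail_eq_scale[OF \<theta> a_le] M_def[symmetric]
      by (simp add: ewens_scale_Gamma \<theta> powr_divide del: of_nat_Suc)
  qed
  ultimately show ?thesis using G by (simp add: x_def a_def)
qed (use K in simp)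

section \<open>Asymptotic distribution of the first cycle length and its residue\<close>

lemma emeasure_stick_measure_Ioc:
  assumes \<theta>: "\<theta> > 0" and ab: "0 \<le> a" "a \<le> b" "b \<le> 1"
  shows "emeasure (stick_measure \<theta>) {a<..b} = ennreal ((1 - a) powr \<theta> - (1 - b) powr \<theta>)"
proof -
  have "((\<lambda>x. \<theta> * (1 - x) powr (\<theta> - 1)) has_integral (- ((1 - b) powr \<theta>) - (- ((1 - a) powr \<theta>)))) {a..b}"
  \<comment> \<open>For \<open>\<theta> < 1\<close> the antiderivative is not differentiable at
    \<open>1\<close>; the interior version asks only for continuity there.\<close>
  proof (rule fundamental_theorem_of_calculus_interior[OF ab(2)])
    show "continuous_on {a..b} (\<lambda>x. - ((1 - x) powr \<theta>))"
      using ab \<theta> by (intro continuous_intros continuous_on_powr') auto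
    show "((\<lambda>x. - ((1 - x) powr \<theta>)) has_vector_derivative \<theta> * (1 - x) powr (\<theta> - 1)) (at x)"
      if "x \<in> {a<..<b}" for x
      unfolding has_real_derivative_iff_has_vector_derivative[symmetric]
      using that ab by (auto intro!: derivative_eq_intros simp: powr_diff)
  qed
  then have "((\<lambda>x. if x \<in> {a..b} then \<theta> * (1 - x) powr (\<theta> - 1) else 0) has_integral
      (1 - a) powr \<theta> - (1 - b) powr \<theta>) UNIV"
    by (simp only: has_integral_restrict_UNIV minus_diff_minus minus_minus diff_minus_eq_add) (simp only: add.commute[of "- _"] add_uminus_conv_diff)
  then have *: "((\<lambda>x. \<theta> * (1 - x) powr (\<theta> - 1) * indicator {0..1} x * indicator {a<..b} x) has_integral
      (1 - a) powr \<theta> - (1 - b) powr \<theta>) UNIV"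
    by (rule has_integral_spike_finite[of "{a}", rotated 2]) (use ab in \<open>auto simp: indicator_def\<close>)
  have "emeasure (stick_measure \<theta>) {a<..b} =
      (\<integral>\<^sup>+x. ennreal (\<theta> * (1 - x) powr (\<theta> - 1) * indicator {0..1} x * indicator {a<..b} x) \<partial>lborel)"
    unfolding stick_measure_def
    by (subst emeasure_density) (auto intro!: nn_integral_cong split: split_indicator)
  also have "\<dots> = ennreal ((1 - a) powr \<theta> - (1 - b) powr \<theta>)"
    by (rule nn_integral_has_integral_lborel[OF _ _ *]) (use \<theta> in auto)
  finally show ?thesis .
qed

lemma measure_stick_measure_Ioc:
  assumes \<theta>: "\<theta> > 0" and ab: "0 \<le> a" "a \<le> b" "b \<le> 1"
  shows "measure (stick_measure \<theta>) {a<..b} = (1 - a) powr \<theta> - (1 - b) powr \<theta>"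
proof -
  have "(1 - b) powr \<theta> \<le> (1 - a) powr \<theta>"
    using ab \<theta> by (intro powr_mono2) auto
  then show ?thesis by (simp add: measure_def emeasure_stick_measure_Ioc[OF assms])
qed

lemma AE_stick_measure:
  assumes "\<theta> > 0"
  shows "AE x in stick_measure \<theta>. 0 < x \<and> x < 1"
proof -
  have ne: "AE x in lborel. (x::real) \<noteq> 0 \<and> x \<noteq> 1"
    using AE_lborel_singleton[of "0::real"] AE_lborel_singleton[of "1::real"] by eventually_elim simp
  then show ?thesis
    unfolding stick_measure_def
  proof (subst AE_density)
    show "AE x in lborel. 0 < ennreal (\<theta> * (1 - x) powr (\<theta> - 1) * indicator {0..1} x) \<longrightarrow> 0 < x \<and> x < 1"
      using ne by eventually_elim (auto split: split_indicator_asm)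
  qed simp
qed

section \<open>Comparison of sums over the cycle length with integrals, on a common grid\<close>

lemma sum_block_decomposition:
  fixes g :: "nat \<Rightarrow> 'b::comm_monoid_add" and a :: "nat \<Rightarrow> nat"
  assumes "mono a"
  shows "(\<Sum>k<K. \<Sum>j=a k..<a (Suc k). g j) = (\<Sum>j=a 0..<a K. g j)"
proof (induction K)
  case (Suc K)
  show ?case
    unfolding sum.lessThan_Suc Suc
    by (rule sum.atLeastLessThan_concat) (auto intro: monoD[OF assms])
qed simp

lemma mono_block_bound: "mono (\<lambda>k. Suc m * k div K)"
  by (intro monoI div_le_mono mult_le_mono2)

text \<open>Index \<open>j\<close> belongs to block \<open>k\<close> exactly when
  \<open>Suc j / Suc m\<close> lies in the half-open interval from \<open>k / K\<close> (excluded)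
  to \<open>Suc k / K\<close> (included). Replacing \<open>H\<close> by its value at
  \<open>k / K\<close> costs at most \<open>\<eta>\<close>, because the probabilities sum to
  \<open>1\<close>.\<close>

lemma pick_step_sum:
  fixes H :: "real \<Rightarrow> complex" and m K :: nat
  assumes \<theta>: "\<theta> > 0" and K: "K > 0"
    and H: "\<And>x y. x \<in> {0..1} \<Longrightarrow> y \<in> {0..1} \<Longrightarrow> \<bar>x - y\<bar> \<le> 1 / real K \<Longrightarrow> norm (H x - H y) \<le> \<eta>"
  defines "a \<equiv> \<lambda>k. Suc m * k div K"
  shows "norm ((\<Sum>j\<le>m. pick \<theta> m j * H (real (Suc j) / real (Suc m))) -
    (\<Sum>k<K. (pick_tail \<theta> m (a k) - pick_tail \<theta> m (a (Suc k))) * H (real k / real K))) \<le> \<eta>"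
proof -
  have mono: "mono a" unfolding a_def by (rule mono_block_bound)
  have aK: "a K = Suc m" "a 0 = 0" using K by (auto simp: a_def simp del: mult_Suc)
  have block: "(\<Sum>j\<le>m. g j) = (\<Sum>k<K. \<Sum>j=a k..<a (Suc k). g j)" for g :: "nat \<Rightarrow> 'x::comm_monoid_add"
    unfolding sum_block_decomposition[OF mono] aK by (simp add: atLeast0LessThan lessThan_Suc_atMost)
  have a_le: "a k \<le> Suc m" if "k \<le> K" for k
    using monoD[OF mono that] aK by simp
  have pt: "pick_tail \<theta> m (a k) - pick_tail \<theta> m (a (Suc k)) = (\<Sum>j=a k..<a (Suc k). pick \<theta> m j)" if "k < K" for k
    using that by (intro sum_pick[OF \<theta>, symmetric] monoD[OF mono] a_le) auto
  have near: "norm (H (real (Suc j) / real (Suc m)) - H (real k / real K)) \<le> \<eta>"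
    if k: "k < K" and j: "j \<in> {a k..<a (Suc k)}" for k j
  proof (rule H)
    have jm: "Suc j \<le> Suc m" using j a_le[of "Suc k"] k by auto
    then show "real (Suc j) / real (Suc m) \<in> {0..1}" by auto
    show "real k / real K \<in> {0..1}" using k by auto
    have "Suc m * k < Suc j * K"
      using j K unfolding a_def by (simp only: less_Suc_eq_le div_less_iff_less_mult[symmetric] atLeastLessThan_iff)
    then have 1: "real (Suc m) * real k < real (Suc j) * real K"
      by (metis of_nat_less_iff of_nat_mult)
    have "Suc j * K \<le> Suc m * Suc k"
      using j K unfolding a_def by (simp only: Suc_le_eq less_eq_div_iff_mult_less_eq[symmetric] atLeastLessThan_iff)
    then have 2: "real (Suc j) * real K \<le> real (Suc m) * real (Suc k)"
      by (metis of_nat_le_iff of_nat_mult)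
    have "real (Suc j) / real (Suc m) - real k / real K = (real (Suc j) * real K - real (Suc m) * real k) / (real (Suc m) * real K)"
      using K by (simp add: field_simps)
    moreover have "\<dots> \<le> real (Suc m) / (real (Suc m) * real K)"
      using 2 K by (intro divide_right_mono) (auto simp: algebra_simps)
    moreover have "0 \<le> (real (Suc j) * real K - real (Suc m) * real k) / (real (Suc m) * real K)"
      using 1 by (intro divide_nonneg_nonneg) auto
    ultimately show "\<bar>real (Suc j) / real (Suc m) - real k / real K\<bar> \<le> 1 / real K"
      by simp
  qed
  have "(\<Sum>j\<le>m. pick \<theta> m j * H (real (Suc j) / real (Suc m))) -
      (\<Sum>k<K. (pick_tail \<theta> m (a k) - pick_tail \<theta> m (a (Suc k))) * H (real k / real K)) =
      (\<Sum>k<K. \<Sum>j=a k..<a (Suc k). pick \<theta> m j * (H (real (Suc j) / real (Suc m)) - H (real k / real K)))"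
  proof -
    have "(\<Sum>k<K. (pick_tail \<theta> m (a k) - pick_tail \<theta> m (a (Suc k))) * H (real k / real K)) =
        (\<Sum>k<K. \<Sum>j=a k..<a (Suc k). pick \<theta> m j * H (real k / real K))"
      by (intro sum.cong refl) (simp add: pt sum_distrib_right flip: of_real_diff)
    then show ?thesis
      unfolding block by (simp add: sum_subtractf right_diff_distrib)
  qed
  also have "norm \<dots> \<le> (\<Sum>k<K. \<Sum>j=a k..<a (Suc k). pick \<theta> m j * \<eta>)"
  proof (intro sum_norm_le)
    fix k j assume "k \<in> {..<K}" "j \<in> {a k..<a (Suc k)}"
    then have "norm (H (real (Suc j) / real (Suc m)) - H (real k / real K)) \<le> \<eta>"
      using near by simp
    then show "norm (pick \<theta> m j * (H (real (Suc j) / real (Suc m)) - H (real k / real K))) \<le> pick \<theta> m j * \<eta>"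
      unfolding norm_mult norm_of_real abs_of_nonneg[OF pick_nonneg[OF \<theta>]]
      by (intro mult_left_mono pick_nonneg \<theta>)
  qed
  also have "\<dots> = \<eta>"
    unfolding block[symmetric] sum_distrib_right[symmetric] sum_pick_eq_1[OF \<theta>] by simp
  finally show ?thesis .
qed

text \<open>The continuous counterpart of \<open>pick_step_sum\<close>, with the same intervals and
  the same values of \<open>H\<close>, so that the two step sums differ only in their
  coefficients.\<close>

lemma integral_step_sum:
  fixes H :: "real \<Rightarrow> complex"
  assumes \<theta>: "\<theta> > 0" and K: "K > 0" and [measurable]: "H \<in> borel_measurable borel"
    and bnd: "\<And>x. norm (H x) \<le> 1"
    and H: "\<And>x y. x \<in> {0..1} \<Longrightarrow> y \<in> {0..1} \<Longrightarrow> \<bar>x - y\<bar> \<le> 1 / real K \<Longrightarrow> norm (H x - H y) \<le> \<eta>"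
  shows "norm ((\<integral>x. H x \<partial>stick_measure \<theta>) -
    (\<Sum>k<K. ((1 - real k / real K) powr \<theta> - (1 - real (Suc k) / real K) powr \<theta>) * H (real k / real K))) \<le> \<eta>"
proof -
  interpret prob_space "stick_measure \<theta>" using \<theta> by (rule prob_space_stick_measure)
  define I where "I k = {real k / real K<..real (Suc k) / real K}" for k
  have [measurable]: "I k \<in> sets borel" for k by (simp add: I_def)
  define s where "s x = (\<Sum>k<K. indicat_real (I k) x *\<^sub>R H (real k / real K))" for x
  have intI: "integrable (stick_measure \<theta>) (\<lambda>x. indicat_real (I k) x *\<^sub>R H (real k / real K))" for k
    by (intro integrable_scaleR_left integrable_real_indicator) (auto simp: less_top[symmetric])
  have "(\<integral>x. s x \<partial>stick_measure \<theta>) = (\<Sum>k<K. \<integral>x. indicat_real (I k) x *\<^sub>R H (real k / real K) \<partial>stick_measure \<theta>)"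
    unfolding s_def by (intro Bochner_Integration.integral_sum intI)
  also have "\<dots> = (\<Sum>k<K. measure (stick_measure \<theta>) (I k) * H (real k / real K))"
    by (intro sum.cong refl) (simp add: scaleR_conv_of_real)
  also have "\<dots> = (\<Sum>k<K. ((1 - real k / real K) powr \<theta> - (1 - real (Suc k) / real K) powr \<theta>) * H (real k / real K))"
  proof (intro sum.cong refl)
    fix k assume "k \<in> {..<K}"
    then have "real (Suc k) \<le> real K" by auto
    then have "measure (stick_measure \<theta>) (I k) = (1 - real k / real K) powr \<theta> - (1 - real (Suc k) / real K) powr \<theta>"
      unfolding I_def using K by (intro measure_stick_measure_Ioc \<theta>) (auto simp: field_simps)
    then show "measure (stick_measure \<theta>) (I k) * H (real k / real K) =
        ((1 - real k / real K) powr \<theta> - (1 - real (Suc k) / real K) powr \<theta>) * H (real k / real K)"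
      by simp
  qed
  finally have s: "(\<integral>x. s x \<partial>stick_measure \<theta>) = \<dots>" .
  have ints: "integrable (stick_measure \<theta>) s"
    unfolding s_def[abs_def] by (intro Bochner_Integration.integrable_sum intI)
  have intH: "integrable (stick_measure \<theta>) H"
    by (rule integrable_const_bound[of _ 1]) (auto simp: bnd)
  have "norm (H x - s x) \<le> \<eta>" if x: "0 < x" "x < 1" for x
  proof -
    \<comment> \<open>The intervals \<open>I k\<close> are open on the left and closed on the right,
      hence the ceiling minus one.\<close>
    define k where "k = nat (\<lceil>x * real K\<rceil> - 1)"
    have pos: "0 < x * real K" using x K by simp
    then have k: "real k = of_int \<lceil>x * real K\<rceil> - 1" unfolding k_def by simp
    have k1: "real k < x * real K" "x * real K \<le> real (Suc k)"
      unfolding of_nat_Suc k by linarith+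
    have xk: "x \<in> I k"
      unfolding I_def using k1 K by (simp add: pos_le_divide_eq pos_divide_less_eq del: of_nat_Suc)
    have "real k < real K" using k1 x K by (smt (verit) mult_left_le_one_le of_nat_0_less_iff)
    then have kK: "k < K" by simp
    have uniq: "indicat_real (I i) x = (if i = k then 1 else 0)" for i
    proof (cases "i = k")
      case False
      have "x \<notin> I i"
      proof
        assume "x \<in> I i"
        then have "real i < x * real K" "x * real K \<le> real (Suc i)"
          using K by (simp_all add: I_def pos_le_divide_eq pos_divide_less_eq del: of_nat_Suc)
        then have "real i < real (Suc k)" "real k < real (Suc i)" using k1 by linarith+
        then show False using False by simp
      qed
      then show ?thesis using False by simp
    qed (use xk in simp)
    have "s x = (\<Sum>i<K. if i = k then H (real i / real K) else 0)"
      unfolding s_def uniq by (intro sum.cong) auto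
    also have "\<dots> = H (real k / real K)" using kK by simp
    finally have "s x = H (real k / real K)" .
    moreover have "norm (H x - H (real k / real K)) \<le> \<eta>"
    proof (rule H)
      have "real (Suc k) / real K = real k / real K + 1 / real K"
        by (simp add: add_divide_distrib)
      then show "\<bar>x - real k / real K\<bar> \<le> 1 / real K"
        using xk unfolding I_def by auto
    qed (use x kK in auto)
    ultimately show ?thesis by simp
  qed
  then have "AE x in stick_measure \<theta>. norm (H x - s x) \<le> \<eta>"
    using AE_stick_measure[OF \<theta>] by (auto elim: eventually_mono)
  then have "(\<integral>x. norm (H x - s x) \<partial>stick_measure \<theta>) \<le> (\<integral>x. \<eta> \<partial>stick_measure \<theta>)"
    by (intro integral_mono_AE) (auto intro!: integrable_norm Bochner_Integration.integrable_diff intH ints)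
  then have "(\<integral>x. norm (H x - s x) \<partial>stick_measure \<theta>) \<le> \<eta>" by (simp add: prob_space)
  with integral_norm_bound have "norm (\<integral>x. H x - s x \<partial>stick_measure \<theta>) \<le> \<eta>" by (rule order_trans)
  then show ?thesis
    unfolding s[symmetric] by (simp add: intH ints)
qed

text \<open>The threshold for \<open>m\<close> depends on \<open>K\<close> and
  \<open>\<delta>\<close> but not on \<open>H\<close>, since \<open>H\<close> enters the step sums
  only through \<open>K\<close> values of norm at most \<open>1\<close>. This uniformity is needed
  later, when \<open>H\<close> varies with the remaining stick.\<close>

lemma pick_sum_tendsto_integral:
  assumes \<theta>: "\<theta> > 0" and K: "K > 0" and \<delta>: "\<delta> > 0"
  shows "\<forall>\<^sub>F m in sequentially. \<forall>\<eta> (H :: real \<Rightarrow> complex). H \<in> borel_measurable borel \<longrightarrow> (\<forall>x. norm (H x) \<le> 1) \<longrightarrow>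
    (\<forall>x\<in>{0..1}. \<forall>y\<in>{0..1}. \<bar>x - y\<bar> \<le> 1 / real K \<longrightarrow> norm (H x - H y) \<le> \<eta>) \<longrightarrow>
    norm ((\<Sum>j\<le>m. pick \<theta> m j * H (real (Suc j) / real (Suc m))) - (\<integral>x. H x \<partial>stick_measure \<theta>)) \<le> 2 * \<eta> + \<delta>"
proof -
  define T where "T m k = pick_tail \<theta> m (Suc m * k div K)" for m k
  define p where "p k = (1 - real k / real K) powr \<theta>" for k
  have "(\<lambda>m. \<Sum>k<K. \<bar>(T m k - T m (Suc k)) - (p k - p (Suc k))\<bar>) \<longlonglongrightarrow>
      (\<Sum>k<K. \<bar>(p k - p (Suc k)) - (p k - p (Suc k))\<bar>)"
    unfolding T_def p_def by (intro tendsto_intros pick_tail_tendsto \<theta> K) auto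
  then have "(\<lambda>m. \<Sum>k<K. \<bar>(T m k - T m (Suc k)) - (p k - p (Suc k))\<bar>) \<longlonglongrightarrow> 0" by simp
  then have "\<forall>\<^sub>F m in sequentially. (\<Sum>k<K. \<bar>(T m k - T m (Suc k)) - (p k - p (Suc k))\<bar>) < \<delta>"
    using \<delta> by (rule order_tendstoD(2))
  then show ?thesis
  proof eventually_elim
    case (elim m)
    show ?case
    proof (intro allI impI)
      fix \<eta> and H :: "real \<Rightarrow> complex"
      assume meas: "H \<in> borel_measurable borel" and bnd: "\<forall>x. norm (H x) \<le> 1"
        and H: "\<forall>x\<in>{0..1}. \<forall>y\<in>{0..1}. \<bar>x - y\<bar> \<le> 1 / real K \<longrightarrow> norm (H x - H y) \<le> \<eta>"
      let ?A = "\<Sum>j\<le>m. pick \<theta> m j * H (real (Suc j) / real (Suc m))"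
      let ?B = "\<Sum>k<K. (T m k - T m (Suc k)) * H (real k / real K)"
      let ?C = "\<Sum>k<K. (p k - p (Suc k)) * H (real k / real K)"
      let ?D = "\<integral>x. H x \<partial>stick_measure \<theta>"
      have AB: "norm (?A - ?B) \<le> \<eta>"
        unfolding T_def by (rule pick_step_sum[OF \<theta> K]) (use H in auto)
      have CD: "norm (?D - ?C) \<le> \<eta>"
        unfolding p_def by (rule integral_step_sum[OF \<theta> K meas]) (use H bnd in auto)
      have "norm (?B - ?C) = norm (\<Sum>k<K. ((T m k - T m (Suc k)) - (p k - p (Suc k))) * H (real k / real K))"
        by (simp add: sum_subtractf left_diff_distrib)
      also have "\<dots> \<le> (\<Sum>k<K. \<bar>(T m k - T m (Suc k)) - (p k - p (Suc k))\<bar>)"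
      proof (rule sum_norm_le)
        fix k
        have "norm (complex_of_real ((T m k - T m (Suc k)) - (p k - p (Suc k))) * H (real k / real K)) \<le>
            \<bar>(T m k - T m (Suc k)) - (p k - p (Suc k))\<bar> * 1"
          unfolding norm_mult norm_of_real using bnd by (intro mult_left_mono) auto
        then show "norm (((T m k - T m (Suc k)) - (p k - p (Suc k))) * H (real k / real K)) \<le>
            \<bar>(T m k - T m (Suc k)) - (p k - p (Suc k))\<bar>" by simp
      qed
      finally have "norm (?B - ?C) \<le> \<delta>" using elim by linarith
      moreover have "norm (?A - ?D) \<le> norm (?A - ?B) + norm (?B - ?C) + norm (?D - ?C)"
        by norm
      ultimately show "norm (?A - ?D) \<le> 2 * \<eta> + \<delta>" using AB CD by linarith
    qed
  qed
qed

section \<open>Equidistribution of the residue of the cycle length\<close>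

lemma sum_mod_shift:
  fixes g :: "nat \<Rightarrow> 'b::comm_monoid_add"
  assumes "t > 0"
  shows "(\<Sum>s<t. g ((c + s) mod t)) = (\<Sum>r<t. g r)"
proof (induction c)
  case (Suc c)
  obtain t' where t': "t = Suc t'" using assms by (cases t) auto
  have "(\<Sum>s<t. g ((Suc c + s) mod t)) = (\<Sum>s<t'. g ((c + Suc s) mod t)) + g ((c + t) mod t)"
    unfolding t' sum.lessThan_Suc by simp
  also have "g ((c + t) mod t) = g ((c + 0) mod t)" by simp
  also have "(\<Sum>s<t'. g ((c + Suc s) mod t)) + g ((c + 0) mod t) = (\<Sum>s<t. g ((c + s) mod t))"
    unfolding t' sum.lessThan_Suc_shift by (simp add: add.commute)
  finally show ?case using Suc by simp
qed simp

text \<open>\<open>D s\<close> is the sum with all residues shifted by \<open>s\<close>. Averaged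
  over \<open>s < t\<close>, each term runs through all residues, which gives the averaged sum. One
  more shift of the residue amounts to a shift of the index \<open>j\<close> and costs at most
  \<open>B\<close>: \<open>\<eta>\<close> for moving the argument by \<open>1 / Suc m\<close>, the
  total variation of \<open>pick\<close>, and two boundary terms.\<close>

lemma pick_sum_residue_average:
  fixes F :: "real \<Rightarrow> nat \<Rightarrow> complex"
  assumes \<theta>: "\<theta> > 0" and K: "K > 0" and t: "t > 0" and m: "K \<le> Suc m"
    and bnd: "\<And>x r. norm (F x r) \<le> 1"
    and F: "\<And>x y r. x \<in> {0..1} \<Longrightarrow> y \<in> {0..1} \<Longrightarrow> \<bar>x - y\<bar> \<le> 1 / real K \<Longrightarrow> norm (F x r - F y r) \<le> \<eta>"
  shows "norm ((\<Sum>j\<le>m. pick \<theta> m j * F (real (Suc j) / real (Suc m)) (Suc j mod t)) -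
    (\<Sum>j\<le>m. pick \<theta> m j * ((\<Sum>r<t. F (real (Suc j) / real (Suc m)) r) / t))) \<le>
    real t * (\<eta> + 2 * (pick \<theta> m 0 + pick \<theta> m m))"
proof -
  define x where "x j = real (Suc j) / real (Suc m)" for j
  define D where "D s = (\<Sum>j\<le>m. pick \<theta> m j * F (x j) ((Suc j + s) mod t))" for s
  define B where "B = \<eta> + 2 * (pick \<theta> m 0 + pick \<theta> m m)"
  have \<eta>: "\<eta> \<ge> 0" using F[of 0 0 0] by simp
  have B: "B \<ge> 0" unfolding B_def using \<eta> pick_nonneg[OF \<theta>] by (simp add: add_nonneg_nonneg del: pick.simps)
  have tri: "norm (z1 - z2 + z3 - z4) \<le> norm z1 + norm z2 + norm z3 + norm z4" for z1 z2 z3 z4 :: complex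
    by norm
  have step: "norm (D (Suc s) - D s) \<le> B" for s
  proof -
    define f where "f j = F (x j) ((Suc (Suc j) + s) mod t)" for j
    define f' where "f' j = F (x (Suc j)) ((Suc (Suc j) + s) mod t)" for j
    have "D (Suc s) = (\<Sum>j\<le>m. pick \<theta> m j * f j)"
      by (simp add: D_def f_def)
    also have "\<dots> = (\<Sum>j<m. pick \<theta> m j * f j) + pick \<theta> m m * f m"
      by (simp add: lessThan_Suc_atMost[symmetric])
    finally have 1: "D (Suc s) = \<dots>" .
    have 2: "D s = pick \<theta> m 0 * F (x 0) (Suc s mod t) + (\<Sum>j<m. pick \<theta> m (Suc j) * f' j)"
      unfolding D_def lessThan_Suc_atMost[symmetric] f'_def
      by (subst sum.lessThan_Suc_shift) simp
    \<comment> \<open>Summation by parts: \<open>f j\<close> and \<open>f' j\<close> carry the same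
      residue and differ only in the argument, \<open>x j\<close> against
      \<open>x (Suc j)\<close>.\<close>
    have 3: "(\<Sum>j<m. pick \<theta> m j * f j) - (\<Sum>j<m. pick \<theta> m (Suc j) * f' j) =
        (\<Sum>j<m. pick \<theta> m j * (f j - f' j)) - (\<Sum>j<m. (pick \<theta> m (Suc j) - pick \<theta> m j) * f' j)"
      by (simp add: sum_subtractf[symmetric] algebra_simps)
    have "norm (\<Sum>j<m. pick \<theta> m j * (f j - f' j)) \<le> (\<Sum>j<m. pick \<theta> m j * \<eta>)"
    proof (rule sum_norm_le)
      fix j assume j: "j \<in> {..<m}"
      have "\<bar>x j - x (Suc j)\<bar> = 1 / real (Suc m)"
        unfolding x_def by (simp flip: diff_divide_distrib)
      also have "\<dots> \<le> 1 / real K" using m K by (intro divide_left_mono) auto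
      finally have "norm (f j - f' j) \<le> \<eta>"
        unfolding f_def f'_def using j by (intro F) (auto simp: x_def)
      then show "norm (pick \<theta> m j * (f j - f' j)) \<le> pick \<theta> m j * \<eta>"
        by (simp add: norm_mult pick_nonneg[OF \<theta>] mult_left_mono)
    qed
    also have "\<dots> \<le> (\<Sum>j\<le>m. pick \<theta> m j * \<eta>)"
      using \<eta> by (intro sum_mono2) (auto simp: pick_nonneg[OF \<theta>])
    also have "\<dots> = \<eta>" by (simp add: sum_distrib_right[symmetric] sum_pick_eq_1[OF \<theta>])
    finally have 4: "norm (\<Sum>j<m. pick \<theta> m j * (f j - f' j)) \<le> \<eta>" .
    have "norm (\<Sum>j<m. (pick \<theta> m (Suc j) - pick \<theta> m j) * f' j) \<le> (\<Sum>j<m. \<bar>pick \<theta> m (Suc j) - pick \<theta> m j\<bar>)"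
    proof (rule sum_norm_le)
      fix j
      have "norm (complex_of_real (pick \<theta> m (Suc j) - pick \<theta> m j) * f' j) \<le> \<bar>pick \<theta> m (Suc j) - pick \<theta> m j\<bar> * 1"
        unfolding norm_mult norm_of_real f'_def by (intro mult_left_mono bnd) auto
      then show "norm ((pick \<theta> m (Suc j) - pick \<theta> m j) * f' j) \<le> \<bar>pick \<theta> m (Suc j) - pick \<theta> m j\<bar>"
        by simp
    qed
    also have "\<dots> \<le> pick \<theta> m 0 + pick \<theta> m m" by (rule sum_pick_variation[OF \<theta>])
    finally have 5: "norm (\<Sum>j<m. (pick \<theta> m (Suc j) - pick \<theta> m j) * f' j) \<le> pick \<theta> m 0 + pick \<theta> m m" .
    have 6: "norm (pick \<theta> m m * f m) \<le> pick \<theta> m m" "norm (pick \<theta> m 0 * F (x 0) (Suc s mod t)) \<le> pick \<theta> m 0"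
      using bnd pick_nonneg[OF \<theta>] by (auto simp: norm_mult f_def mult_left_le simp del: pick.simps)
    have 7: "D (Suc s) - D s = (\<Sum>j<m. pick \<theta> m j * (f j - f' j)) - (\<Sum>j<m. (pick \<theta> m (Suc j) - pick \<theta> m j) * f' j) +
        pick \<theta> m m * f m - pick \<theta> m 0 * F (x 0) (Suc s mod t)"
      unfolding 1 2 3[symmetric] by simp
    have 8: "B = \<eta> + (pick \<theta> m 0 + pick \<theta> m m) + pick \<theta> m m + pick \<theta> m 0"
      unfolding B_def by (simp del: pick.simps)
    show ?thesis
      unfolding 7 8 by (rule order_trans[OF tri]) (intro add_mono 4 5 6)
  qed
  have Ds: "norm (D s - D 0) \<le> real s * B" for s
  proof (induction s)
    case (Suc s)
    have "norm (D (Suc s) - D 0) \<le> norm (D (Suc s) - D s) + norm (D s - D 0)" by norm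
    then show ?case using Suc step[of s] by (simp add: algebra_simps)
  qed simp
  have "(\<Sum>s<t. D s) = (\<Sum>j\<le>m. pick \<theta> m j * (\<Sum>r<t. F (x j) r))"
    unfolding D_def by (subst sum.swap) (simp only: sum_distrib_left[symmetric] sum_mod_shift[OF t])
  then have avg: "(\<Sum>j\<le>m. pick \<theta> m j * ((\<Sum>r<t. F (x j) r) / t)) = (\<Sum>s<t. D s) / t"
    by (simp only: times_divide_eq_right sum_divide_distrib[symmetric])
  have "D 0 - (\<Sum>s<t. D s) / t = (\<Sum>s<t. D 0 - D s) / t"
    using t by (simp add: sum_subtractf field_simps)
  also have "norm \<dots> \<le> (\<Sum>s<t. real t * B) / t"
    unfolding norm_divide norm_of_nat
  proof (intro divide_right_mono sum_norm_le)
    fix s assume "s \<in> {..<t}"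
    then have "real s * B \<le> real t * B" using B by (intro mult_right_mono) auto
    then show "norm (D 0 - D s) \<le> real t * B" using Ds[of s] by (simp add: norm_minus_commute)
  qed simp
  also have "\<dots> = real t * B" using t by simp
  finally show ?thesis
    unfolding avg[symmetric] by (simp only: B_def D_def x_def add_0_right)
qed

text \<open>Averaging the residue costs \<open>t * \<eta>\<close> and discretising the integral
  \<open>2 * \<eta>\<close>, each with a further \<open>\<delta> / 2\<close>. Again the threshold
  for \<open>m\<close> does not depend on \<open>F\<close>.\<close>

lemma pick_sum_residue_tendsto:
  assumes \<theta>: "\<theta> > 0" and K: "K > 0" and \<delta>: "\<delta> > 0" and t: "t > 0"
  shows "\<forall>\<^sub>F m in sequentially. \<forall>\<eta> (F :: real \<Rightarrow> nat \<Rightarrow> complex).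
    (\<forall>r. (\<lambda>x. F x r) \<in> borel_measurable borel) \<longrightarrow> (\<forall>x r. norm (F x r) \<le> 1) \<longrightarrow>
    (\<forall>r. \<forall>x\<in>{0..1}. \<forall>y\<in>{0..1}. \<bar>x - y\<bar> \<le> 1 / real K \<longrightarrow> norm (F x r - F y r) \<le> \<eta>) \<longrightarrow>
    norm ((\<Sum>j\<le>m. pick \<theta> m j * F (real (Suc j) / real (Suc m)) (Suc j mod t)) -
      (\<integral>x. (\<Sum>r<t. F x r) / t \<partial>stick_measure \<theta>)) \<le> (real t + 2) * \<eta> + \<delta>"
proof -
  have "(\<lambda>m. real t * (2 * (pick \<theta> m 0 + pick \<theta> m m))) \<longlonglongrightarrow> real t * (2 * 0)"
    by (intro tendsto_intros pick_max_tendsto \<theta>)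
  then have "\<forall>\<^sub>F m in sequentially. real t * (2 * (pick \<theta> m 0 + pick \<theta> m m)) < \<delta> / 2"
    by (rule order_tendstoD(2)) (use \<delta> in simp)
  moreover have "\<delta> / 2 > 0" using \<delta> by simp
  note pick_sum_tendsto_integral[OF \<theta> K this]
  moreover have "\<forall>\<^sub>F m in sequentially. K \<le> m" by (rule eventually_ge_at_top)
  ultimately show ?thesis
  proof eventually_elim
    case (elim m)
    show ?case
    proof (intro allI impI)
      fix \<eta> and F :: "real \<Rightarrow> nat \<Rightarrow> complex"
      assume meas: "\<forall>r. (\<lambda>x. F x r) \<in> borel_measurable borel" and bnd: "\<forall>x r. norm (F x r) \<le> 1"
        and F: "\<forall>r. \<forall>x\<in>{0..1}. \<forall>y\<in>{0..1}. \<bar>x - y\<bar> \<le> 1 / real K \<longrightarrow> norm (F x r - F y r) \<le> \<eta>"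
      let ?A = "\<Sum>j\<le>m. pick \<theta> m j * F (real (Suc j) / real (Suc m)) (Suc j mod t)"
      let ?B = "\<Sum>j\<le>m. pick \<theta> m j * ((\<Sum>r<t. F (real (Suc j) / real (Suc m)) r) / t)"
      let ?C = "\<integral>x. (\<Sum>r<t. F x r) / t \<partial>stick_measure \<theta>"
      have "norm (?A - ?B) \<le> real t * (\<eta> + 2 * (pick \<theta> m 0 + pick \<theta> m m))"
        by (rule pick_sum_residue_average[OF \<theta> K t]) (use elim(3) bnd F in auto)
      then have 1: "norm (?A - ?B) \<le> real t * \<eta> + \<delta> / 2"
        using elim(1) by (simp add: distrib_left)
      have avg_le: "norm ((\<Sum>r<t. g r) / complex_of_nat t) \<le> b" if "\<And>r. norm (g r) \<le> b" for g :: "nat \<Rightarrow> complex" and b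
      proof -
        have "norm (\<Sum>r<t. g r) \<le> (\<Sum>r<t. b)" using that by (intro sum_norm_le) auto
        then show ?thesis using t by (simp add: norm_divide field_simps)
      qed
      have avg_diff: "(\<Sum>r<t. F x r) / complex_of_nat t - (\<Sum>r<t. F y r) / complex_of_nat t =
          (\<Sum>r<t. F x r - F y r) / complex_of_nat t" for x y
        by (simp add: sum_subtractf diff_divide_distrib)
      have meas': "(\<lambda>x. (\<Sum>r<t. F x r) / complex_of_nat t) \<in> borel_measurable borel"
        using meas by (intro borel_measurable_divide borel_measurable_sum) auto
      have 2: "norm (?B - ?C) \<le> 2 * \<eta> + \<delta> / 2"
        by (rule elim(2)[rule_format, OF meas'])
           (auto intro!: avg_le simp: avg_diff F bnd)
      have "norm (?A - ?C) \<le> norm (?A - ?B) + norm (?B - ?C)" by norm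
      then show "norm (?A - ?C) \<le> (real t + 2) * \<eta> + \<delta>"
        using 1 2 by (simp add: algebra_simps)
    qed
  qed
qed

section \<open>Convergence of multiplicative functionals\<close>

lemma eventually_uniform_modulus:
  fixes f :: "real \<Rightarrow> complex"
  assumes "continuous_on UNIV f" "\<eta> > 0"
  shows "\<forall>\<^sub>F K in sequentially. \<forall>x\<in>{0..1}. \<forall>y\<in>{0..1}. \<bar>x - y\<bar> \<le> 1 / real K \<longrightarrow> norm (f x - f y) \<le> \<eta>"
proof -
  have "uniformly_continuous_on {0..1} f"
    using assms by (intro compact_uniformly_continuous) (auto intro: continuous_on_subset)
  then obtain d where d: "d > 0" "\<And>x y. x \<in> {0..1} \<Longrightarrow> y \<in> {0..1} \<Longrightarrow> dist y x < d \<Longrightarrow> dist (f y) (f x) < \<eta>"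
    using assms(2) unfolding uniformly_continuous_on_def by metis
  have "(\<lambda>K. 1 / real K) \<longlonglongrightarrow> 0" by real_asymp
  then have "\<forall>\<^sub>F K in sequentially. 1 / real K < d" using d(1) by (rule order_tendstoD(2))
  then show ?thesis
  proof eventually_elim
    case (elim K)
    then show ?case using d(2) by (fastforce simp: dist_norm norm_minus_commute abs_minus_commute intro: less_imp_le)
  qed
qed

text \<open>\<open>G x r\<close> stands for the factor of a cycle with relative length
  \<open>x\<close> and length congruent to \<open>r\<close> modulo \<open>t\<close>. By
  \<open>small\<close>, only cycles of relative length at least \<open>\<epsilon>\<close> have a
  nontrivial factor, and there are at most \<open>1 / \<epsilon>\<close> of them.\<close>

locale cycle_functional =
  fixes \<theta> \<epsilon> :: real and t :: nat and G :: "real \<Rightarrow> nat \<Rightarrow> complex"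
  assumes theta: "\<theta> > 0" and t: "t > 0" and eps: "\<epsilon> > 0"
    and cont: "\<And>r. continuous_on UNIV (\<lambda>x. G x r)"
    and bound: "\<And>x r. norm (G x r) \<le> 1"
    and small: "\<And>x r. 0 \<le> x \<Longrightarrow> x < \<epsilon> \<Longrightarrow> G x r = 1"
begin

definition avg :: "real \<Rightarrow> complex" where
  "avg x = (\<Sum>r<t. G x r) / of_nat t"

text \<open>Here \<open>n\<close> is the fixed scale, \<open>m\<close> the number of points still
  left, and \<open>N\<close> the number of cycles that are still weighted; all later cycles get the
  factor \<open>1\<close>.\<close>

primrec trunc_mean :: "nat \<Rightarrow> nat \<Rightarrow> nat \<Rightarrow> complex" where
  "trunc_mean n 0 m = 1"
| "trunc_mean n (Suc N) m = (case m of 0 \<Rightarrow> 1 | Suc m' \<Rightarrow>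
     (\<Sum>j\<le>m'. pick \<theta> m' j * G (real (Suc j) / real n) (Suc j mod t) * trunc_mean n N (m' - j)))"

text \<open>The same recursion in the limit: a stick of length \<open>y\<close>, in place of
  \<open>m / n\<close>, is broken at the fraction \<open>x\<close>, and the residue is averaged
  out.\<close>

primrec limit_mean :: "nat \<Rightarrow> real \<Rightarrow> complex" where
  "limit_mean 0 y = 1"
| "limit_mean (Suc N) y = (\<integral>x. avg (y * x) * limit_mean N (y * (1 - x)) \<partial>stick_measure \<theta>)"

abbreviation "full_mean n \<equiv> ewens_mean \<theta> (\<lambda>j. G (real j / real n) (j mod t))"

lemma prob_stick: "prob_space (stick_measure \<theta>)"
  using theta by (rule prob_space_stick_measure)

lemma norm_avg_le: "norm (avg x) \<le> 1"
proof -
  have "norm (\<Sum>r<t. G x r) \<le> (\<Sum>r<t. 1)" by (intro sum_norm_le bound)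
  then show ?thesis using t by (simp add: avg_def norm_divide)
qed

lemma continuous_avg: "continuous_on UNIV avg"
  unfolding avg_def using t by (intro continuous_intros cont) auto

lemma avg_small: "0 \<le> x \<Longrightarrow> x < \<epsilon> \<Longrightarrow> avg x = 1"
  using t by (simp add: avg_def small)

lemma measurable_avg [measurable]: "avg \<in> borel_measurable borel"
  using continuous_avg by (rule borel_measurable_continuous_onI)

text \<open>The bound for \<open>N\<close> supplies the dominating function for continuity at
  \<open>Suc N\<close>. Continuity is what yields a modulus for \<open>limit_mean N\<close> on the
  unit interval.\<close>

lemma limit_mean_props:
  shows "continuous_on UNIV (limit_mean N)" and "norm (limit_mean N y) \<le> 1"
proof (induction N arbitrary: y)
  interpret prob_space "stick_measure \<theta>" by (rule prob_stick)
  {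
    case (Suc N)
    have meas [measurable]: "limit_mean N \<in> borel_measurable borel"
      using Suc(1) by (rule borel_measurable_continuous_onI)
    have le: "norm (avg (y * x) * limit_mean N (y * (1 - x))) \<le> 1" for x y
      unfolding norm_mult using norm_avg_le Suc(2) by (intro mult_le_one) auto
    {
      case 1
      show ?case
        unfolding continuous_on_eq_continuous_at[OF open_UNIV]
      proof (intro ballI continuous_at_sequentiallyI)
        fix a :: real and u :: "nat \<Rightarrow> real" assume u: "u \<longlonglongrightarrow> a"
        show "(\<lambda>n. limit_mean (Suc N) (u n)) \<longlonglongrightarrow> limit_mean (Suc N) a"
          unfolding limit_mean.simps
        proof (rule integral_dominated_convergence[where w = "\<lambda>_. 1"])
          have c: "isCont avg z" "isCont (limit_mean N) z" for z
            using continuous_avg Suc(1) by (auto simp: continuous_on_eq_continuous_at)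
          show "AE x in stick_measure \<theta>. (\<lambda>n. avg (u n * x) * limit_mean N (u n * (1 - x)))
              \<longlonglongrightarrow> avg (a * x) * limit_mean N (a * (1 - x))"
            by (intro AE_I2 tendsto_mult isCont_tendsto_compose[OF c(1)] isCont_tendsto_compose[OF c(2)]
                  tendsto_const u)
        qed (use le in auto)
      qed
    next
      case 2
      show ?case
        unfolding limit_mean.simps
        by (rule order_trans[OF integral_norm_bound integral_le_const])
           (auto intro!: integrable_const_bound[of _ 1] AE_I2 le)
    }
  }
qed auto

lemma measurable_limit_mean [measurable]: "limit_mean N \<in> borel_measurable borel"
  using limit_mean_props(1) by (rule borel_measurable_continuous_onI)

text \<open>Neither part of a broken stick is longer than the stick. Together with
  \<open>trunc_mean_small\<close> this settles the sizes \<open>m < \<epsilon> * n\<close> in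
  \<open>trunc_mean_tendsto\<close>, for which \<open>m\<close> need not be large.\<close>

lemma limit_mean_small: "0 \<le> y \<Longrightarrow> y < \<epsilon> \<Longrightarrow> limit_mean N y = 1"
proof (induction N arbitrary: y)
  case (Suc N)
  interpret prob_space "stick_measure \<theta>" by (rule prob_stick)
  have "limit_mean (Suc N) y = (\<integral>x. 1 \<partial>stick_measure \<theta>)"
    unfolding limit_mean.simps
  proof (rule integral_cong_AE)
    show "AE x in stick_measure \<theta>. avg (y * x) * limit_mean N (y * (1 - x)) = 1"
      using AE_stick_measure[OF theta]
    proof eventually_elim
      case (elim x)
      have "0 \<le> y * x" "y * x \<le> y" "0 \<le> y * (1 - x)" "y * (1 - x) \<le> y"
        using elim Suc.prems by (auto intro: mult_left_le)
      then show ?case using Suc by (simp add: avg_small)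
    qed
  qed auto
  then show ?case by (simp add: prob_space)
qed simp

lemma norm_pick_sum_le:
  assumes "\<And>j. j \<le> m \<Longrightarrow> norm (g j) \<le> b j"
  shows "norm (\<Sum>j\<le>m. of_real (pick \<theta> m j) * g j :: complex) \<le> (\<Sum>j\<le>m. pick \<theta> m j * b j)"
proof (rule sum_norm_le)
  fix j assume "j \<in> {..m}"
  then show "norm (of_real (pick \<theta> m j) * g j) \<le> pick \<theta> m j * b j"
    unfolding norm_mult norm_of_real abs_of_nonneg[OF pick_nonneg[OF theta]]
    using assms by (intro mult_left_mono pick_nonneg theta) auto
qed

lemma sum_pick_complex: "(\<Sum>j\<le>m. complex_of_real (pick \<theta> m j)) = 1"
  using sum_pick_eq_1[OF theta] by (simp flip: of_real_sum)

lemma norm_full_mean_le: "norm (full_mean n m) \<le> 1"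
proof (induction m rule: less_induct)
  case (less m)
  show ?case
  proof (cases m)
    case (Suc m')
    have "norm (full_mean n m) \<le> (\<Sum>j\<le>m'. pick \<theta> m' j * 1)"
      unfolding Suc ewens_mean.simps mult.assoc
      by (rule norm_pick_sum_le) (use less Suc bound in \<open>auto simp: norm_mult intro!: mult_le_one\<close>)
    then show ?thesis by (simp add: sum_pick_eq_1[OF theta])
  qed simp
qed

lemma small_index:
  assumes "n > 0" "real m < \<epsilon> * real n" "j \<le> m"
  shows "real j / real n < \<epsilon>"
proof -
  have "real j \<le> real m" using assms by simp
  also note assms(2)
  finally show ?thesis using assms(1) by (simp add: pos_divide_less_eq)
qed

lemma full_mean_small: "n > 0 \<Longrightarrow> real m < \<epsilon> * real n \<Longrightarrow> full_mean n m = 1"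
proof (induction m rule: less_induct)
  case (less m)
  show ?case
  proof (cases m)
    case (Suc m')
    have "full_mean n m = (\<Sum>j\<le>m'. complex_of_real (pick \<theta> m' j))"
      unfolding Suc ewens_mean.simps
    proof (intro sum.cong refl)
      fix j assume j: "j \<in> {..m'}"
      have "real (Suc j) / real n < \<epsilon>"
        by (rule small_index[OF less.prems]) (use j Suc in auto)
      moreover have "full_mean n (m' - j) = 1"
        using less.prems Suc by (intro less.IH) auto
      ultimately show "complex_of_real (pick \<theta> m' j) * G (real (Suc j) / real n) (Suc j mod t) *
          full_mean n (m' - j) = complex_of_real (pick \<theta> m' j)"
        by (simp add: small)
    qed
    then show ?thesis by (simp add: sum_pick_complex)
  qed simp
qed

lemma trunc_mean_small: "n > 0 \<Longrightarrow> real m < \<epsilon> * real n \<Longrightarrow> trunc_mean n N m = 1"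
proof (induction N arbitrary: m)
  case (Suc N)
  show ?case
  proof (cases m)
    case (Suc m')
    have "trunc_mean n (Suc N) m = (\<Sum>j\<le>m'. complex_of_real (pick \<theta> m' j))"
      unfolding Suc trunc_mean.simps nat.case
    proof (intro sum.cong refl)
      fix j assume j: "j \<in> {..m'}"
      have "real (Suc j) / real n < \<epsilon>"
        by (rule small_index[OF Suc.prems]) (use j Suc in auto)
      moreover have "trunc_mean n N (m' - j) = 1"
        using Suc.prems Suc by (intro Suc.IH) auto
      ultimately show "complex_of_real (pick \<theta> m' j) * G (real (Suc j) / real n) (Suc j mod t) *
          trunc_mean n N (m' - j) = complex_of_real (pick \<theta> m' j)"
        by (simp add: small)
    qed
    then show ?thesis by (simp add: sum_pick_complex)
  qed simp
qed simp

text \<open>On average, picking one cycle multiplies the number of remaining points by \<open>\<theta> / (1 + \<theta>)\<close>,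
  and nothing happens any more once fewer than \<open>\<epsilon> n\<close> points remain.\<close>

lemma trunc_mean_error:
  assumes n: "n > 0"
  shows "norm (full_mean n m - trunc_mean n N m) \<le> 2 * (\<theta> / (1 + \<theta>)) ^ N * (real m / (\<epsilon> * real n))"
proof (induction N arbitrary: m)
  case 0
  show ?case
  proof (cases "real m < \<epsilon> * real n")
    case False
    have "norm (full_mean n m - 1) \<le> norm (full_mean n m) + 1"
      using norm_triangle_ineq4[of "full_mean n m" 1] by simp
    also have "\<dots> \<le> 2" using norm_full_mean_le[of n m] by simp
    \<comment> \<open>The trivial bound \<open>2\<close> is turned into one linear in
      \<open>m\<close>, the form that \<open>sum_pick_remainder\<close> can contract.\<close>
    also have "2 \<le> 2 * (real m / (\<epsilon> * real n))"
      using False eps n by (simp add: pos_le_divide_eq)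
    finally show ?thesis by simp
  qed (use eps in \<open>simp add: full_mean_small[OF n]\<close>)
next
  case (Suc N)
  show ?case
  proof (cases m)
    case (Suc m')
    let ?c = "2 * (\<theta> / (1 + \<theta>)) ^ N / (\<epsilon> * real n)"
    have eq: "full_mean n m - trunc_mean n (Suc N) m =
        (\<Sum>j\<le>m'. pick \<theta> m' j * (G (real (Suc j) / real n) (Suc j mod t) *
          (full_mean n (m' - j) - trunc_mean n N (m' - j))))"
      unfolding Suc by (simp only: ewens_mean.simps trunc_mean.simps nat.case sum_subtractf right_diff_distrib mult.assoc)
    have "norm (full_mean n m - trunc_mean n (Suc N) m) \<le> (\<Sum>j\<le>m'. pick \<theta> m' j * (?c * real (m' - j)))"
      unfolding eq
    proof (rule norm_pick_sum_le)
      fix j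
      have "norm (G (real (Suc j) / real n) (Suc j mod t) * (full_mean n (m' - j) - trunc_mean n N (m' - j)))
          \<le> 1 * (2 * (\<theta> / (1 + \<theta>)) ^ N * (real (m' - j) / (\<epsilon> * real n)))"
        unfolding norm_mult by (intro mult_mono bound Suc.IH) auto
      then show "norm (G (real (Suc j) / real n) (Suc j mod t) * (full_mean n (m' - j) - trunc_mean n N (m' - j)))
          \<le> ?c * real (m' - j)"
        by simp
    qed
    also have "\<dots> = ?c * (\<Sum>j\<le>m'. pick \<theta> m' j * real (m' - j))"
      unfolding sum_distrib_left by (rule sum.cong[OF refl mult.left_commute])
    also have "\<dots> = ?c * (real m' * \<theta> / (1 + \<theta>))"
      by (rule arg_cong[OF sum_pick_remainder[OF theta]])
    also have "\<dots> \<le> ?c * (real m * \<theta> / (1 + \<theta>))"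
    proof (rule mult_left_mono)
      show "real m' * \<theta> / (1 + \<theta>) \<le> real m * \<theta> / (1 + \<theta>)"
        using theta Suc by (simp add: divide_right_mono)
      show "0 \<le> ?c"
        using theta eps by (intro divide_nonneg_nonneg mult_nonneg_nonneg zero_le_power) auto
    qed
    also have "\<dots> = 2 * (\<theta> / (1 + \<theta>)) ^ Suc N * (real m / (\<epsilon> * real n))"
    proof -
      have "2 * A / B * (C * \<theta> / D) = 2 * (\<theta> / D * A) * (C / B)" for A B C D :: real
        by (simp only: divide_inverse mult_ac)
      then show ?thesis unfolding power_Suc .
    qed
    finally show ?thesis .
  qed simp
qed

text \<open>Uniformity in \<open>m \<le> n\<close> makes the induction close, as the recursion calls
  smaller \<open>m\<close> at the same \<open>n\<close>. For \<open>m < \<epsilon> * n\<close> both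
  means are \<open>1\<close>; otherwise \<open>m\<close> is large, the induction hypothesis replaces
  the inner \<open>trunc_mean\<close> by \<open>limit_mean\<close>, and the asymptotics of the first
  cycle applies at the stick length \<open>y = m / n\<close>.\<close>

lemma trunc_mean_tendsto:
  "\<delta> > 0 \<Longrightarrow> \<forall>\<^sub>F n in sequentially. \<forall>m\<le>n. norm (trunc_mean n N m - limit_mean N (real m / real n)) \<le> \<delta>"
proof (induction N arbitrary: \<delta>)
  case (Suc N)
  \<comment> \<open>\<open>F\<close> below has modulus \<open>2 * \<eta>\<close>, so the error
    \<open>(t + 2) * (2 * \<eta>)\<close> of \<open>pick_sum_residue_tendsto\<close> is
    \<open>\<delta> / 4\<close>. With its additional \<open>\<delta> / 4\<close> and the
    \<open>\<delta> / 2\<close> of the induction hypothesis the total is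
    \<open>\<delta>\<close>.\<close>
  define \<eta> where "\<eta> = \<delta> / (8 * (real t + 2))"
  have \<eta>: "\<eta> > 0" using Suc.prems by (simp add: \<eta>_def)
  define modulus where "modulus K f \<longleftrightarrow>
      (\<forall>x\<in>{0..1}. \<forall>y\<in>{0..1}. \<bar>x - y\<bar> \<le> 1 / real K \<longrightarrow> norm (f x - f y) \<le> \<eta>)" for K and f :: "real \<Rightarrow> complex"
  have modulus: "\<forall>\<^sub>F K in sequentially. modulus K f" if "continuous_on UNIV f" for f
    unfolding modulus_def using that \<eta> by (rule eventually_uniform_modulus)
  have "\<forall>\<^sub>F K in sequentially. \<forall>r\<in>{..<t}. modulus K (\<lambda>x. G x r)"
    by (intro eventually_ball_finite ballI modulus cont) simp
  from eventually_conj[OF eventually_gt_at_top[of 0] eventually_conj[OF this modulus[OF limit_mean_props(1)]]]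
  have "\<exists>K. K > 0 \<and> (\<forall>r\<in>{..<t}. modulus K (\<lambda>x. G x r)) \<and> modulus K (limit_mean N)"
    by (rule eventually_happens'[OF sequentially_bot])
  then obtain K where K0: "K > 0" "\<forall>r\<in>{..<t}. modulus K (\<lambda>x. G x r)" "modulus K (limit_mean N)"
    by (elim exE conjE)
  have K: "K > 0"
      "\<And>r x y. r < t \<Longrightarrow> x \<in> {0..1} \<Longrightarrow> y \<in> {0..1} \<Longrightarrow> \<bar>x - y\<bar> \<le> 1 / real K \<Longrightarrow> norm (G x r - G y r) \<le> \<eta>"
      "\<And>x y. x \<in> {0..1} \<Longrightarrow> y \<in> {0..1} \<Longrightarrow> \<bar>x - y\<bar> \<le> 1 / real K \<Longrightarrow> norm (limit_mean N x - limit_mean N y) \<le> \<eta>"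
    using K0 unfolding modulus_def by auto
  \<comment> \<open>Reducing \<open>r\<close> modulo \<open>t\<close> leaves finitely many residues,
    which share the grid size \<open>K\<close>. As \<open>y \<le> 1\<close>, multiplying by
    \<open>y\<close> does not increase distances, so the same \<open>K\<close> serves every
    \<open>y\<close>.\<close>
  define F where "F y x r = G (y * x) (r mod t) * limit_mean N (y * (1 - x))" for y x :: real and r
  have Fle: "norm (F y x r) \<le> 1" for y x r
    unfolding F_def norm_mult using bound limit_mean_props(2) by (intro mult_le_one) auto
  have Fmeas: "(\<lambda>x. F y x r) \<in> borel_measurable borel" for y r
  proof -
    have "(\<lambda>x. G x (r mod t)) \<in> borel_measurable borel"
      using cont by (rule borel_measurable_continuous_onI)
    then have [measurable]: "(\<lambda>x. G (y * x) (r mod t)) \<in> borel_measurable borel"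
      by (rule measurable_compose[rotated]) simp
    show ?thesis unfolding F_def by measurable
  qed
  have Fmod: "norm (F y x r - F y x' r) \<le> 2 * \<eta>"
    if y: "y \<in> {0..1}" and x: "x \<in> {0..1}" "x' \<in> {0..1}" and d: "\<bar>x - x'\<bar> \<le> 1 / real K" for y x x' r
  proof -
    have in01: "y * x \<in> {0..1}" "y * x' \<in> {0..1}" "y * (1 - x) \<in> {0..1}" "y * (1 - x') \<in> {0..1}"
      using x y by (auto intro: mult_le_one)
    have "y * \<bar>x - x'\<bar> \<le> 1 * (1 / real K)" using y d by (intro mult_mono) auto
    moreover have "y * x - y * x' = y * (x - x')" "y * (1 - x) - y * (1 - x') = - (y * (x - x'))"
      by (simp_all add: algebra_simps)
    then have "\<bar>y * x - y * x'\<bar> = y * \<bar>x - x'\<bar>" "\<bar>y * (1 - x) - y * (1 - x')\<bar> = y * \<bar>x - x'\<bar>"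
      using y by (simp_all only: abs_minus_cancel) (simp_all add: abs_mult)
    ultimately have d': "\<bar>y * x - y * x'\<bar> \<le> 1 / real K" "\<bar>y * (1 - x) - y * (1 - x')\<bar> \<le> 1 / real K"
      by auto
    have eq: "F y x r - F y x' r = (G (y * x) (r mod t) - G (y * x') (r mod t)) * limit_mean N (y * (1 - x)) +
        G (y * x') (r mod t) * (limit_mean N (y * (1 - x)) - limit_mean N (y * (1 - x')))"
      by (simp add: F_def algebra_simps)
    have "norm ((G (y * x) (r mod t) - G (y * x') (r mod t)) * limit_mean N (y * (1 - x))) \<le> \<eta> * 1"
      unfolding norm_mult using \<eta> t by (intro mult_mono K(2) in01 d' limit_mean_props(2)) auto
    moreover have "norm (G (y * x') (r mod t) * (limit_mean N (y * (1 - x)) - limit_mean N (y * (1 - x')))) \<le> 1 * \<eta>"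
      unfolding norm_mult by (intro mult_mono K(3) in01 d' bound) auto
    ultimately show ?thesis
      unfolding eq by (intro norm_triangle_le) linarith
  qed
  have "\<delta> / 4 > 0" using Suc.prems by simp
  define close where "close m \<longleftrightarrow> (\<forall>\<eta> (F :: real \<Rightarrow> nat \<Rightarrow> complex).
    (\<forall>r. (\<lambda>x. F x r) \<in> borel_measurable borel) \<longrightarrow> (\<forall>x r. norm (F x r) \<le> 1) \<longrightarrow>
    (\<forall>r. \<forall>x\<in>{0..1}. \<forall>y\<in>{0..1}. \<bar>x - y\<bar> \<le> 1 / real K \<longrightarrow> norm (F x r - F y r) \<le> \<eta>) \<longrightarrow>
    norm ((\<Sum>j\<le>m. pick \<theta> m j * F (real (Suc j) / real (Suc m)) (Suc j mod t)) -
      (\<integral>x. (\<Sum>r<t. F x r) / t \<partial>stick_measure \<theta>)) \<le> (real t + 2) * \<eta> + \<delta> / 4)" for m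
  have "\<forall>\<^sub>F m in sequentially. close m"
    unfolding close_def by (rule pick_sum_residue_tendsto[OF theta K(1) \<open>\<delta> / 4 > 0\<close> t])
  then obtain M where M: "\<And>m. m \<ge> M \<Longrightarrow> close m"
    unfolding eventually_sequentially by blast
  have "\<delta> / 2 > 0" using Suc.prems by simp
  note Suc.IH[OF this]
  \<comment> \<open>The additional \<open>1\<close> ensures \<open>m' \<ge> M\<close> for
    \<open>m = Suc m'\<close> with \<open>m \<ge> \<epsilon> * n\<close>.\<close>
  moreover have "\<forall>\<^sub>F n::nat in sequentially. real M + 1 \<le> \<epsilon> * real n"
    using eps by real_asymp
  moreover have "\<forall>\<^sub>F n::nat in sequentially. n > 0" by (rule eventually_gt_at_top)
  ultimately show ?case
  proof eventually_elim
    case (elim n)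
    show ?case
    proof (intro allI impI)
      fix m assume m: "m \<le> n"
      show "norm (trunc_mean n (Suc N) m - limit_mean (Suc N) (real m / real n)) \<le> \<delta>"
      proof (cases "real m < \<epsilon> * real n")
        case True
        then have "real m / real n < \<epsilon>" using elim(3) by (simp add: pos_divide_less_eq)
        then show ?thesis using True elim(3) Suc.prems by (simp add: trunc_mean_small limit_mean_small del: trunc_mean.simps limit_mean.simps)
      next
        case False
        then have mM: "real M + 1 \<le> real m" using elim(2) by linarith
        then obtain m' where m': "m = Suc m'" by (cases m) auto
        with mM have "m' \<ge> M" by simp
        define y where "y = real m / real n"
        have y: "y \<in> {0..1}" using m elim(3) by (auto simp: y_def)
        let ?A = "\<Sum>j\<le>m'. pick \<theta> m' j * F y (real (Suc j) / real (Suc m')) (Suc j mod t)"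
        have eq: "trunc_mean n (Suc N) m - ?A = (\<Sum>j\<le>m'. pick \<theta> m' j * (G (real (Suc j) / real n) (Suc j mod t) *
            (trunc_mean n N (m' - j) - limit_mean N (real (m' - j) / real n))))"
        proof -
          have "y * (real (Suc j) / real (Suc m')) = real (Suc j) / real n" for j
            unfolding y_def m' by (simp del: of_nat_Suc)
          moreover have "y * (1 - real (Suc j) / real (Suc m')) = real (m' - j) / real n" if "j \<le> m'" for j
          proof -
            have gen: "b / c * (1 - a / b) = (b - a) / c" if "b \<noteq> 0" for a b c :: real
              using that by (simp add: right_diff_distrib diff_divide_distrib)
            show ?thesis
              unfolding y_def m' using that by (subst gen) (simp_all add: of_nat_diff)
          qed
          ultimately have "?A = (\<Sum>j\<le>m'. pick \<theta> m' j * (G (real (Suc j) / real n) (Suc j mod t) *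
              limit_mean N (real (m' - j) / real n)))"
            unfolding F_def by (intro sum.cong refl) (simp del: of_nat_Suc)
          then show ?thesis
            unfolding m' by (simp only: trunc_mean.simps nat.case sum_subtractf right_diff_distrib mult.assoc)
        qed
        have "norm (trunc_mean n (Suc N) m - ?A) \<le> (\<Sum>j\<le>m'. pick \<theta> m' j * (\<delta> / 2))"
          unfolding eq
        proof (rule norm_pick_sum_le)
          fix j
          have "norm (G (real (Suc j) / real n) (Suc j mod t) * (trunc_mean n N (m' - j) - limit_mean N (real (m' - j) / real n)))
              \<le> 1 * (\<delta> / 2)"
            unfolding norm_mult using m m' elim(1) by (intro mult_mono bound) auto
          then show "norm (G (real (Suc j) / real n) (Suc j mod t) * (trunc_mean n N (m' - j) - limit_mean N (real (m' - j) / real n)))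
              \<le> \<delta> / 2" by simp
        qed
        also have "\<dots> = \<delta> / 2"
          by (simp only: sum_distrib_right[symmetric] sum_pick_eq_1[OF theta] mult_1_left)
        finally have 1: "norm (trunc_mean n (Suc N) m - ?A) \<le> \<delta> / 2" .
        have avg: "limit_mean (Suc N) y = (\<integral>x. (\<Sum>r<t. F y x r) / t \<partial>stick_measure \<theta>)"
          unfolding limit_mean.simps avg_def F_def by (simp add: sum_distrib_right)
        have "norm (?A - limit_mean (Suc N) y) \<le> (real t + 2) * (2 * \<eta>) + \<delta> / 4"
          unfolding avg using M[OF \<open>m' \<ge> M\<close>] Fmeas Fle Fmod y unfolding close_def by blast
        also have "(real t + 2) * (2 * \<eta>) = \<delta> / 4"
          unfolding \<eta>_def by (simp add: field_simps)
        finally have 2: "norm (?A - limit_mean (Suc N) y) \<le> \<delta> / 2" by simp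
        have "norm (trunc_mean n (Suc N) m - limit_mean (Suc N) y) \<le>
            norm (trunc_mean n (Suc N) m - ?A) + norm (?A - limit_mean (Suc N) y)"
          using norm_triangle_ineq[of "trunc_mean n (Suc N) m - ?A" "?A - limit_mean (Suc N) y"] by simp
        then show ?thesis using 1 2 unfolding y_def by linarith
      qed
    qed
  qed
qed simp

text \<open>At \<open>m = n\<close> the truncation error is at most
  \<open>2 * (\<theta> / (1 + \<theta>)) ^ N / \<epsilon>\<close> for every \<open>n > 0\<close>, so
  \<open>N\<close> can be fixed before \<open>n\<close> tends to infinity.\<close>

lemma full_mean_tendsto:
  assumes lim: "(\<lambda>N. limit_mean N 1) \<longlonglongrightarrow> \<Psi>"
  shows "(\<lambda>n. full_mean n n) \<longlonglongrightarrow> \<Psi>"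
proof (rule tendstoI)
  fix e :: real assume e: "e > 0"
  have "(\<lambda>N. 2 * (\<theta> / (1 + \<theta>)) ^ N * (1 / \<epsilon>)) \<longlonglongrightarrow> 2 * 0 * (1 / \<epsilon>)"
    using theta by (intro tendsto_intros LIMSEQ_realpow_zero) auto
  then have "\<forall>\<^sub>F N in sequentially. 2 * (\<theta> / (1 + \<theta>)) ^ N * (1 / \<epsilon>) < e / 3"
    by (rule order_tendstoD(2)) (use e in simp)
  moreover have "\<forall>\<^sub>F N in sequentially. dist (limit_mean N 1) \<Psi> < e / 3"
    using lim by (rule tendstoD) (use e in simp)
  ultimately have "\<forall>\<^sub>F N in sequentially. 2 * (\<theta> / (1 + \<theta>)) ^ N * (1 / \<epsilon>) < e / 3 \<and> dist (limit_mean N 1) \<Psi> < e / 3"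
    by eventually_elim simp
  then obtain N where N: "2 * (\<theta> / (1 + \<theta>)) ^ N * (1 / \<epsilon>) < e / 3" "dist (limit_mean N 1) \<Psi> < e / 3"
    unfolding eventually_sequentially by blast
  have "e / 3 > 0" using e by simp
  from trunc_mean_tendsto[OF this, of N] eventually_gt_at_top[of 0]
  show "\<forall>\<^sub>F n in sequentially. dist (full_mean n n) \<Psi> < e"
  proof eventually_elim
    case (elim n)
    have 1: "norm (trunc_mean n N n - limit_mean N 1) \<le> e / 3"
      using elim(1)[rule_format, of n] elim(2) by simp
    have "norm (full_mean n n - trunc_mean n N n) \<le> 2 * (\<theta> / (1 + \<theta>)) ^ N * (1 / \<epsilon>)"
      using trunc_mean_error[OF elim(2), of n N] elim(2) by simp
    with N(1) have 2: "norm (full_mean n n - trunc_mean n N n) < e / 3" by linarith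
    have "dist (full_mean n n) \<Psi> \<le> norm (full_mean n n - trunc_mean n N n) +
        norm (trunc_mean n N n - limit_mean N 1) + dist (limit_mean N 1) \<Psi>"
      unfolding dist_norm by norm
    then show ?case using 1 2 N(2) by linarith
  qed
qed

end

section \<open>Cycles whose length is divisible by \<open>t\<close>\<close>

lemma ewens_mean_real_bounds:
  fixes w :: "nat \<Rightarrow> real"
  assumes \<theta>: "\<theta> > 0" and w: "\<And>j. 0 \<le> w j" "\<And>j. w j \<le> 1"
  shows "0 \<le> ewens_mean \<theta> w m \<and> ewens_mean \<theta> w m \<le> 1"
proof (induction m rule: less_induct)
  case (less m)
  show ?case
  proof (cases m)
    case (Suc m')
    have IH: "0 \<le> ewens_mean \<theta> w (m' - j)" "ewens_mean \<theta> w (m' - j) \<le> 1" for j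
      using less[of "m' - j"] Suc by auto
    have "ewens_mean \<theta> w m = (\<Sum>j\<le>m'. pick \<theta> m' j * (w (Suc j) * ewens_mean \<theta> w (m' - j)))"
      unfolding Suc by (simp add: mult.assoc)
    moreover have "\<dots> \<le> (\<Sum>j\<le>m'. pick \<theta> m' j * 1)"
      using IH w by (intro sum_mono mult_left_mono mult_le_one pick_nonneg \<theta>)
    moreover have "0 \<le> (\<Sum>j\<le>m'. pick \<theta> m' j * (w (Suc j) * ewens_mean \<theta> w (m' - j)))"
      using IH w by (intro sum_nonneg mult_nonneg_nonneg pick_nonneg \<theta>)
    ultimately show ?thesis by (simp add: sum_pick_eq_1[OF \<theta>])
  qed simp
qed

text \<open>The mean is that of \<open>2\<close> to the power of minus the number of cycles whose length is divisible
  by \<open>t\<close>.  The first cycle contributes a factor of about \<open>1 - 1 / (2 t) < 1\<close> and is unlikely to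
  exhaust the permutation, so the upper limit of the means is contracted.\<close>

lemma ewens_mean_half_tendsto_0:
  assumes \<theta>: "\<theta> > 0" and t: "t > 0"
  shows "(\<lambda>n. ewens_mean \<theta> (\<lambda>j. if t dvd j then 1 / 2 else 1 :: real) n) \<longlonglongrightarrow> 0"
proof -
  define w where "w j = (if t dvd j then 1 / 2 else 1 :: real)" for j
  define e where "e = ewens_mean \<theta> w"
  \<comment> \<open>\<open>\<beta>\<close> is the limiting mean of the first factor, which is
    \<open>1 / 2\<close> with probability \<open>1 / t\<close> and \<open>1\<close> otherwise;
    \<open>\<gamma>\<close> is the midpoint of \<open>\<beta>\<close> and \<open>1\<close>.\<close>
  define \<beta> where "\<beta> = 1 - 1 / (2 * real t)"
  define \<gamma> where "\<gamma> = 1 - 1 / (4 * real t)"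
  have \<gamma>: "0 < \<gamma>" "\<gamma> < 1" "\<beta> < \<gamma>" using t by (auto simp: \<beta>_def \<gamma>_def field_simps)
  have w: "0 \<le> w j" "w j \<le> 1" for j by (auto simp: w_def)
  have e: "0 \<le> e m" "e m \<le> 1" for m
    using ewens_mean_real_bounds[OF \<theta> w] by (auto simp: e_def)
  have first: "\<forall>\<^sub>F m in sequentially. (\<Sum>j\<le>m. pick \<theta> m j * w (Suc j)) \<le> \<beta> + \<delta>" if "\<delta> > 0" for \<delta>
  proof -
    \<comment> \<open>This \<open>F\<close> ignores \<open>x\<close>, so its modulus is
      \<open>0\<close> and the trivial grid \<open>K = 1\<close> suffices.\<close>
    define F where "F x r = complex_of_real (if r = 0 then 1 / 2 else 1)" for x :: real and r :: nat
    interpret prob_space "stick_measure \<theta>" using \<theta> by (rule prob_space_stick_measure)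
    have S: "(\<Sum>r<t. F x r) = of_real (real t - 1 / 2)" for x
    proof -
      have "(\<Sum>r<t. F x r) = F x 0 + (\<Sum>r\<in>{..<t} - {0}. F x r)"
        using t by (intro sum.remove) auto
      also have "(\<Sum>r\<in>{..<t} - {0}. F x r) = of_nat (t - 1)"
        using t by (simp add: F_def)
      finally show ?thesis using t by (simp add: F_def of_nat_diff)
    qed
    have "(\<Sum>r<t. F x r) / t = of_real \<beta>" for x
      unfolding S using t by (simp add: \<beta>_def field_simps)
    then have int: "(\<integral>x. (\<Sum>r<t. F x r) / t \<partial>stick_measure \<theta>) = of_real \<beta>"
      by (simp only: lebesgue_integral_const prob_space scaleR_one)
    have "\<forall>\<^sub>F m in sequentially. norm ((\<Sum>j\<le>m. pick \<theta> m j * F (real (Suc j) / real (Suc m)) (Suc j mod t)) - of_real \<beta>) \<le> (real t + 2) * 0 + \<delta>"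
      using pick_sum_residue_tendsto[OF \<theta> zero_less_one that t]
    proof eventually_elim
      case (elim m)
      show ?case
        unfolding int[symmetric] by (rule elim[rule_format]) (auto simp: F_def)
    qed
    then show ?thesis
    proof eventually_elim
      case (elim m)
      have "(\<Sum>j\<le>m. pick \<theta> m j * F (real (Suc j) / real (Suc m)) (Suc j mod t)) =
          of_real (\<Sum>j\<le>m. pick \<theta> m j * w (Suc j))"
        unfolding of_real_sum of_real_mult F_def w_def by (intro sum.cong refl) (simp add: dvd_eq_mod_eq_0)
      with elim have "\<bar>(\<Sum>j\<le>m. pick \<theta> m j * w (Suc j)) - \<beta>\<bar> \<le> \<delta>"
        by (simp only: of_real_diff[symmetric] norm_of_real mult_zero_right add_0_left)
      then show ?case by linarith
    qed
  qed
  have step: "\<forall>\<^sub>F m in sequentially. e m \<le> \<gamma> * b" if b: "b > 0" and ev: "\<forall>\<^sub>F m in sequentially. e m \<le> b" for b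
  proof -
    obtain M where M: "\<And>m. m \<ge> M \<Longrightarrow> e m \<le> b"
      using ev unfolding eventually_sequentially by blast
    define \<delta> where "\<delta> = (\<gamma> - \<beta>) / 2"
    have \<delta>: "\<delta> > 0" using \<gamma> by (simp add: \<delta>_def)
    have "\<forall>\<^sub>F m in sequentially. pick_tail \<theta> m (Suc m - M) < \<delta> * b"
      using pick_tail_end_tendsto[OF \<theta>] by (rule order_tendstoD(2)) (use \<delta> b in simp)
    with first[OF \<delta>] have "\<forall>\<^sub>F m in sequentially. e (Suc m) \<le> \<gamma> * b"
    proof eventually_elim
      case (elim m)
      \<comment> \<open>These \<open>j\<close> leave fewer than \<open>M\<close> points, where only
        \<open>e (m - j) \<le> 1\<close> is known; their total probability is
        \<open>pick_tail \<theta> m (Suc m - M)\<close>.\<close>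
      let ?S = "{Suc m - M..<Suc m}"
      have le: "w (Suc j) * e (m - j) \<le> w (Suc j) * b + (if j \<in> ?S then 1 else 0)" if "j \<le> m" for j
      proof (cases "m - j \<ge> M")
        case True
        then have "w (Suc j) * e (m - j) \<le> w (Suc j) * b" using M w by (intro mult_left_mono) auto
        then show ?thesis by simp
      next
        case False
        then have "j \<in> ?S" using that by auto
        moreover have "w (Suc j) * e (m - j) \<le> 1" using w e by (intro mult_le_one) auto
        moreover have "0 \<le> w (Suc j) * b" using w b by simp
        ultimately show ?thesis by simp
      qed
      have "e (Suc m) = (\<Sum>j\<le>m. pick \<theta> m j * (w (Suc j) * e (m - j)))"
        unfolding e_def by (simp add: mult.assoc)
      also have "\<dots> \<le> (\<Sum>j\<le>m. pick \<theta> m j * (w (Suc j) * b + (if j \<in> ?S then 1 else 0)))"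
        using le by (intro sum_mono mult_left_mono pick_nonneg \<theta>) auto
      also have "\<dots> = (\<Sum>j\<le>m. pick \<theta> m j * w (Suc j)) * b + (\<Sum>j\<le>m. if j \<in> ?S then pick \<theta> m j else 0)"
        unfolding sum_distrib_right sum.distrib[symmetric] by (intro sum.cong refl) (auto simp: distrib_left mult.assoc)
      also have "(\<Sum>j\<le>m. if j \<in> ?S then pick \<theta> m j else 0) = (\<Sum>j\<in>?S. pick \<theta> m j)"
      proof -
        have "{..m} \<inter> ?S = ?S" by auto
        then show ?thesis by (subst sum.inter_restrict[symmetric]) auto
      qed
      also have "\<dots> = pick_tail \<theta> m (Suc m - M)"
        by (subst sum_pick[OF \<theta>]) auto
      also have "(\<Sum>j\<le>m. pick \<theta> m j * w (Suc j)) * b + \<dots> \<le> (\<beta> + \<delta>) * b + \<delta> * b"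
        using elim b by (intro add_mono mult_right_mono) auto
      also have "\<dots> = \<gamma> * b" by (simp add: \<delta>_def field_simps)
      finally show ?case .
    qed
    then show ?thesis
      by (subst eventually_sequentially_Suc[symmetric])
  qed
  \<comment> \<open>Starting from the bound \<open>1\<close>, each application of
    \<open>step\<close> gains a factor \<open>\<gamma>\<close> at the price of a later
    threshold.\<close>
  have iter: "\<forall>\<^sub>F m in sequentially. e m \<le> \<gamma> ^ k" for k
  proof (induction k)
    case (Suc k)
    then show ?case using step[of "\<gamma> ^ k"] \<gamma> by simp
  qed (simp add: e)
  have "e \<longlonglongrightarrow> 0"
  proof (rule order_tendstoI)
    fix y :: real assume "0 < y"
    moreover have "(\<lambda>k. \<gamma> ^ k) \<longlonglongrightarrow> 0" using \<gamma> by (intro LIMSEQ_realpow_zero) auto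
    ultimately have "\<forall>\<^sub>F k in sequentially. \<gamma> ^ k < y" by (rule order_tendstoD(2)[rotated])
    then obtain k where k: "\<gamma> ^ k < y" unfolding eventually_sequentially by blast
    show "\<forall>\<^sub>F m in sequentially. e m < y"
      using iter[of k] by eventually_elim (use k in linarith)
  next
    fix y :: real assume "y < 0"
    then show "\<forall>\<^sub>F m in sequentially. y < e m"
      by (intro always_eventually allI) (use e(1) in \<open>meson less_le_trans\<close>)
  qed
  then show ?thesis unfolding e_def w_def .
qed

section \<open>Stick breaking and the Poisson--Dirichlet distribution\<close>

abbreviation stick_space :: "real \<Rightarrow> (nat \<Rightarrow> real) measure" where
  "stick_space \<theta> \<equiv> \<Pi>\<^sub>M j\<in>UNIV. stick_measure \<theta>"

lemma sets_stick_space [measurable_cong]: "sets (stick_space \<theta>) = sets (\<Pi>\<^sub>M j\<in>UNIV. borel)"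
  by (rule sets_PiM_cong) auto

lemma sequence_space_stick_measure: "\<theta> > 0 \<Longrightarrow> sequence_space (stick_measure \<theta>)"
  using prob_space_stick_measure[of \<theta>]
  by (simp add: sequence_space_def product_prob_space_def product_prob_space_axioms_def
      product_sigma_finite_def prob_space_imp_sigma_finite)

lemma prob_space_stick_space: "\<theta> > 0 \<Longrightarrow> prob_space (stick_space \<theta>)"
  by (intro prob_space_PiM prob_space_stick_measure)

text \<open>Splitting off the first coordinate leaves a copy of the whole space; this
  self-similarity matches the recursion of \<open>limit_mean\<close>.\<close>

lemma nn_integral_stick_space_iter:
  assumes \<theta>: "\<theta> > 0" and f: "f \<in> borel_measurable (\<Pi>\<^sub>M j\<in>UNIV. borel)"
  shows "(\<integral>\<^sup>+W. f W \<partial>stick_space \<theta>) = (\<integral>\<^sup>+s. (\<integral>\<^sup>+W. f (case_nat s W) \<partial>stick_space \<theta>) \<partial>stick_measure \<theta>)"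
proof -
  interpret Q: prob_space "stick_space \<theta>" using \<theta> by (rule prob_space_stick_space)
  interpret sequence_space "stick_measure \<theta>" using \<theta> by (rule sequence_space_stick_measure)
  have [measurable]: "f \<in> borel_measurable (stick_space \<theta>)"
    using f by (simp add: measurable_cong_sets[OF sets_stick_space refl])
  have "(\<integral>\<^sup>+W. f W \<partial>stick_space \<theta>) = (\<integral>\<^sup>+W. f W \<partial>distr (stick_measure \<theta> \<Otimes>\<^sub>M stick_space \<theta>) (stick_space \<theta>) (\<lambda>(s, \<omega>). case_nat s \<omega>))"
    by (simp only: PiM_iter)
  also have "\<dots> = (\<integral>\<^sup>+z. f (case_nat (fst z) (snd z)) \<partial>(stick_measure \<theta> \<Otimes>\<^sub>M stick_space \<theta>))"
    by (subst nn_integral_distr) (auto simp: split_beta')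
  also have "\<dots> = (\<integral>\<^sup>+s. (\<integral>\<^sup>+W. f (case_nat s W) \<partial>stick_space \<theta>) \<partial>stick_measure \<theta>)"
    by (subst Q.nn_integral_fst[symmetric]) auto
  finally show ?thesis .
qed

lemma integral_stick_space_iter:
  fixes f :: "(nat \<Rightarrow> real) \<Rightarrow> complex"
  assumes \<theta>: "\<theta> > 0" and f: "f \<in> borel_measurable (\<Pi>\<^sub>M j\<in>UNIV. borel)" and bnd: "\<And>W. norm (f W) \<le> 1"
  shows "(\<integral>W. f W \<partial>stick_space \<theta>) = (\<integral>s. (\<integral>W. f (case_nat s W) \<partial>stick_space \<theta>) \<partial>stick_measure \<theta>)"
proof -
  interpret Q: prob_space "stick_space \<theta>" using \<theta> by (rule prob_space_stick_space)
  interpret sequence_space "stick_measure \<theta>" using \<theta> by (rule sequence_space_stick_measure)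
  interpret R: pair_prob_space "stick_measure \<theta>" "stick_space \<theta>" ..
  have [measurable]: "f \<in> borel_measurable (stick_space \<theta>)"
    using f by (simp add: measurable_cong_sets[OF sets_stick_space refl])
  have "(\<integral>W. f W \<partial>stick_space \<theta>) = (\<integral>W. f W \<partial>distr (stick_measure \<theta> \<Otimes>\<^sub>M stick_space \<theta>) (stick_space \<theta>) (\<lambda>(s, \<omega>). case_nat s \<omega>))"
    by (simp only: PiM_iter)
  also have "\<dots> = (\<integral>z. f (case_nat (fst z) (snd z)) \<partial>(stick_measure \<theta> \<Otimes>\<^sub>M stick_space \<theta>))"
    by (subst integral_distr) (auto simp: split_beta')
  also have "\<dots> = (\<integral>s. (\<integral>W. f (case_nat s W) \<partial>stick_space \<theta>) \<partial>stick_measure \<theta>)"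
    by (subst R.integral_fst'[symmetric]) (auto intro!: R.P.integrable_const_bound[of _ 1] simp: bnd)
  finally show ?thesis .
qed

lemma AE_stick_space:
  assumes "\<theta> > 0"
  shows "AE W in stick_space \<theta>. \<forall>i. 0 < W i \<and> W i < 1"
  unfolding AE_all_countable
  using assms by (intro allI AE_PiM_component[of UNIV "\<lambda>_. stick_measure \<theta>"] prob_space_stick_measure AE_stick_measure) auto

text \<open>By independence the remaining stick has mean \<open>A ^ N\<close> with
  \<open>A < 1\<close>, so its infimum \<open>r\<close> over \<open>N\<close> has integral
  \<open>0\<close>. The products decrease almost surely, hence the infimum is their limit.\<close>

lemma AE_stick_remainder:
  assumes \<theta>: "\<theta> > 0"
  shows "AE W in stick_space \<theta>. (\<lambda>N. \<Prod>i<N. 1 - W i) \<longlonglongrightarrow> 0"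
proof -
  interpret M: prob_space "stick_measure \<theta>" using \<theta> by (rule prob_space_stick_measure)
  interpret Q: prob_space "stick_space \<theta>" using \<theta> by (rule prob_space_stick_space)
  define R where "R N W = (\<Prod>i<N. ennreal (1 - W i))" for N and W :: "nat \<Rightarrow> real"
  define A where "A = (\<integral>\<^sup>+x. ennreal (1 - x) \<partial>stick_measure \<theta>)"
  have [measurable]: "R N \<in> borel_measurable (\<Pi>\<^sub>M j\<in>UNIV. borel)" for N
    unfolding R_def by measurable
  have R: "(\<integral>\<^sup>+W. R N W \<partial>stick_space \<theta>) = A ^ N" for N
  proof (induction N)
    case 0
    then show ?case by (simp add: R_def Q.emeasure_space_1)
  next
    case (Suc N)
    have R_Suc: "R (Suc N) (case_nat s W) = ennreal (1 - s) * R N W" for s W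
      unfolding R_def prod.lessThan_Suc_shift by simp
    have "(\<integral>\<^sup>+W. R (Suc N) W \<partial>stick_space \<theta>) = (\<integral>\<^sup>+s. ennreal (1 - s) * A ^ N \<partial>stick_measure \<theta>)"
      by (subst nn_integral_stick_space_iter[OF \<theta>]) (simp_all add: R_Suc nn_integral_cmult Suc)
    also have "\<dots> = A * A ^ N"
      unfolding A_def by (rule nn_integral_multc) simp
    finally show ?case by simp
  qed
  define B where "B = (\<integral>\<^sup>+x. ennreal x \<partial>stick_measure \<theta>)"
  \<comment> \<open>With \<open>B \<noteq> 0\<close> this gives \<open>A < 1\<close> without
    computing the mean of the Beta law.\<close>
  have "A + B = (\<integral>\<^sup>+x. ennreal (1 - x) + ennreal x \<partial>stick_measure \<theta>)"
    unfolding A_def B_def by (rule nn_integral_add[symmetric]) auto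
  also have "\<dots> = (\<integral>\<^sup>+x. 1 \<partial>stick_measure \<theta>)"
  proof (rule nn_integral_cong_AE)
    show "AE x in stick_measure \<theta>. ennreal (1 - x) + ennreal x = 1"
      using AE_stick_measure[OF \<theta>]
    proof eventually_elim
      case (elim x)
      then have "ennreal (1 - x) + ennreal x = ennreal (1 - x + x)" by (intro ennreal_plus[symmetric]) auto
      then show ?case by simp
    qed
  qed
  also have "\<dots> = 1" by (simp add: M.emeasure_space_1)
  finally have AB: "A + B = 1" .
  have "B \<noteq> 0"
  proof
    assume "B = 0"
    then have "AE x in stick_measure \<theta>. ennreal x = 0"
      unfolding B_def by (subst (asm) nn_integral_0_iff_AE) auto
    with AE_stick_measure[OF \<theta>] have "AE x in stick_measure \<theta>. False"
      by eventually_elim (auto simp: ennreal_eq_0_iff)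
    then show False by simp
  qed
  have "A \<noteq> \<top>" "B \<noteq> \<top>" using AB by auto
  then obtain a b where a: "A = ennreal a" "0 \<le> a" and b: "B = ennreal b" "0 \<le> b"
    by (metis ennreal_cases)
  have "ennreal (a + b) = ennreal 1" using AB a b by simp
  then have "a + b = 1" using a b by (subst (asm) ennreal_inj) auto
  then have a1: "a < 1" using b \<open>B \<noteq> 0\<close> by (cases "b = 0") auto
  have lim: "(\<lambda>N. A ^ N) \<longlonglongrightarrow> 0"
    unfolding a(1) using a a1 tendsto_ennrealI[OF LIMSEQ_realpow_zero[of a]] by (simp add: ennreal_power)
  define r where "r W = (INF N. R N W)" for W
  have [measurable]: "r \<in> borel_measurable (\<Pi>\<^sub>M j\<in>UNIV. borel)"
    unfolding r_def by measurable
  have "(\<integral>\<^sup>+W. r W \<partial>stick_space \<theta>) \<le> A ^ N" for N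
    unfolding R[symmetric] r_def by (intro nn_integral_mono INF_lower) auto
  then have "(\<integral>\<^sup>+W. r W \<partial>stick_space \<theta>) \<le> 0"
    by (intro LIMSEQ_le_const[OF lim]) auto
  then have "AE W in stick_space \<theta>. r W = 0"
    by (subst (asm) le_zero_eq, subst (asm) nn_integral_0_iff_AE) auto
  then show ?thesis
    using AE_stick_space[OF \<theta>]
  proof eventually_elim
    case (elim W)
    have le: "0 \<le> 1 - W i" "1 - W i \<le> 1" for i using elim(2)[rule_format, of i] by auto
    have R_eq: "R N W = ennreal (\<Prod>i<N. 1 - W i)" for N
      unfolding R_def using le by (subst prod_ennreal) auto
    have "decseq (\<lambda>N. \<Prod>i<N. 1 - W i)"
      by (rule decseq_SucI) (use le in \<open>auto intro!: mult_left_le prod_nonneg\<close>)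
    then have "decseq (\<lambda>N. R N W)"
      unfolding R_eq decseq_def by (auto intro: ennreal_leI)
    then have "(\<lambda>N. R N W) \<longlonglongrightarrow> r W" unfolding r_def by (rule LIMSEQ_INF)
    then have "(\<lambda>N. ennreal (\<Prod>i<N. 1 - W i)) \<longlonglongrightarrow> ennreal 0" by (simp add: R_eq elim(1))
    then show ?case
      by (rule tendsto_ennrealD) (intro order_refl always_eventually allI prod_nonneg le(1))+
  qed
qed

text \<open>Convergence to \<open>0\<close> is spelled out with countable quantifiers only, so that
  measurability is immediate; \<open>null_lengths_iff\<close> recovers the usual form.\<close>

definition null_lengths :: "(nat \<Rightarrow> real) \<Rightarrow> bool" where
  "null_lengths l \<longleftrightarrow> (\<forall>i. 0 < l i \<and> l i \<le> 1) \<and> (\<forall>k. \<exists>n. \<forall>m\<ge>n. l m < 1 / real (Suc k))"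

lemma pred_null_lengths [measurable]: "Measurable.pred (\<Pi>\<^sub>M j\<in>UNIV. borel) null_lengths"
  unfolding null_lengths_def by measurable

lemma null_lengths_iff: "null_lengths l \<longleftrightarrow> (\<forall>i. 0 < l i \<and> l i \<le> 1) \<and> l \<longlonglongrightarrow> 0"
proof (cases "\<forall>i. 0 < l i \<and> l i \<le> 1")
  case True
  have "(\<forall>k. \<exists>n. \<forall>m\<ge>n. l m < 1 / real (Suc k)) \<longleftrightarrow> l \<longlonglongrightarrow> 0"
  proof
    assume *: "\<forall>k. \<exists>n. \<forall>m\<ge>n. l m < 1 / real (Suc k)"
    show "l \<longlonglongrightarrow> 0"
    proof (rule LIMSEQ_I)
      fix r :: real assume "0 < r"
      then obtain k where "1 / real (Suc k) < r"
        using reals_Archimedean[of r] by (auto simp: inverse_eq_divide)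
      with * True show "\<exists>no. \<forall>n\<ge>no. norm (l n - 0) < r"
        by (metis (no_types, lifting) abs_of_pos diff_zero less_trans real_norm_def)
    qed
  next
    assume "l \<longlonglongrightarrow> 0"
    then have "\<forall>\<^sub>F m in sequentially. l m < 1 / real (Suc k)" for k
      by (rule order_tendstoD(2)) simp
    then show "\<forall>k. \<exists>n. \<forall>m\<ge>n. l m < 1 / real (Suc k)"
      unfolding eventually_sequentially by blast
  qed
  then show ?thesis using True by (simp add: null_lengths_def)
qed (auto simp: null_lengths_def)

lemma AE_null_lengths_stick:
  assumes \<theta>: "\<theta> > 0"
  shows "AE W in stick_space \<theta>. null_lengths (stick_breaking W)"
  using AE_stick_space[OF \<theta>] AE_stick_remainder[OF \<theta>]
proof eventually_elim
  case (elim W)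
  have W: "0 < W i" "W i < 1" "0 < 1 - W i" for i using elim(1)[rule_format, of i] by auto
  have pos: "(\<Prod>i<j. 1 - W i) > 0" for j using W by (intro prod_pos) auto
  have le1: "(\<Prod>i<j. 1 - W i) \<le> 1" for j using W by (intro prod_le_1) (auto intro: less_imp_le)
  have "stick_breaking W j > 0" for j
    using W pos by (simp add: stick_breaking_def)
  moreover have le: "stick_breaking W j \<le> (\<Prod>i<j. 1 - W i)" for j
    unfolding stick_breaking_def using W[of j] pos[of j] by (intro mult_left_le_one_le) auto
  moreover have "stick_breaking W \<longlonglongrightarrow> 0"
    by (rule tendsto_sandwich[OF _ _ tendsto_const elim(2)])
       (use calculation in \<open>auto intro!: always_eventually less_imp_le\<close>)
  ultimately show ?case
    unfolding null_lengths_iff using le1 by (meson order_trans)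
qed

lemma null_lengths_ranked:
  assumes "null_lengths v"
  obtains \<pi> where "bij \<pi>" "ranked v = v \<circ> \<pi>" "null_lengths (ranked v)"
proof -
  have v: "\<And>j. v j > 0" "v \<longlonglongrightarrow> 0" "\<And>j. v j \<le> 1" using assms by (auto simp: null_lengths_iff)
  obtain \<pi> where \<pi>: "bij \<pi>" "ranked v = v \<circ> \<pi>" using ranked_rearrangement(2)[OF v(1,2)] by blast
  \<comment> \<open>Preimages of finite sets under a bijection are finite, so rearranging preserves
    convergence to \<open>0\<close>.\<close>
  have "filterlim \<pi> sequentially sequentially"
    unfolding filterlim_at_top
  proof
    fix Z
    have "finite (\<pi> -` {..<Z})" using \<pi>(1) by (intro finite_vimageI) (auto simp: bij_def)
    then have "\<forall>\<^sub>F m in cofinite. \<not> \<pi> m < Z" by (simp add: eventually_cofinite vimage_def)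
    then show "\<forall>\<^sub>F m in sequentially. Z \<le> \<pi> m"
      by (simp add: cofinite_eq_sequentially not_less)
  qed
  then have "(\<lambda>i. v (\<pi> i)) \<longlonglongrightarrow> 0"
    using v(2) by (rule filterlim_compose[rotated])
  then have "null_lengths (ranked v)"
    unfolding null_lengths_iff \<pi>(2) using v by (simp add: comp_def)
  with \<pi> show ?thesis by (rule that)
qed

lemma measurable_ranked_stick [measurable]:
  "(\<lambda>W. ranked (stick_breaking W)) \<in> stick_space \<theta> \<rightarrow>\<^sub>M (\<Pi>\<^sub>M j\<in>UNIV. borel)"
  by (subst measurable_cong_sets[OF sets_stick_space refl]) measurable

lemma sets_poisson_dirichlet [measurable_cong]: "sets (poisson_dirichlet \<theta>) = sets (\<Pi>\<^sub>M j\<in>UNIV. borel)"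
  by (simp add: poisson_dirichlet_def)

lemma AE_null_lengths_PD:
  assumes \<theta>: "\<theta> > 0"
  shows "AE l in poisson_dirichlet \<theta>. null_lengths l"
  unfolding poisson_dirichlet_def
proof (subst AE_distr_iff)
  show "{x \<in> space (\<Pi>\<^sub>M j\<in>UNIV. borel). null_lengths x} \<in> sets (\<Pi>\<^sub>M j\<in>UNIV. borel)"
    by measurable
  show "AE W in stick_space \<theta>. null_lengths (ranked (stick_breaking W))"
    using AE_null_lengths_stick[OF \<theta>] by eventually_elim (erule null_lengths_ranked)
qed measurable

lemma finite_null_lengths_ge: 
  assumes "null_lengths v" "\<epsilon> > 0"
  shows "finite {i. \<epsilon> \<le> v i}"
proof -
  have "v \<longlonglongrightarrow> 0" using assms by (auto simp: null_lengths_iff)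
  then have "\<forall>\<^sub>F i in sequentially. v i < \<epsilon>" using assms(2) by (rule order_tendstoD(2))
  then obtain n where "\<And>i. i \<ge> n \<Longrightarrow> v i < \<epsilon>" unfolding eventually_sequentially by blast
  then have "{i. \<epsilon> \<le> v i} \<subseteq> {..<n}" by (metis (mono_tags, lifting) leI lessThan_iff linorder_not_le mem_Collect_eq subsetI)
  then show ?thesis by (rule finite_subset) simp
qed

lemma prod_null_lengths_eventually:
  fixes g :: "nat \<Rightarrow> 'b::comm_monoid_mult"
  assumes v: "null_lengths v" and \<epsilon>: "\<epsilon> > 0" and g: "\<And>i. v i < \<epsilon> \<Longrightarrow> g i = 1"
  shows "\<forall>\<^sub>F N in sequentially. (\<Prod>i<N. g i) = (\<Prod>i | \<epsilon> \<le> v i. g i)"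
proof -
  have fin: "finite {i. \<epsilon> \<le> v i}" using v \<epsilon> by (rule finite_null_lengths_ge)
  then obtain n where n: "\<And>i. \<epsilon> \<le> v i \<Longrightarrow> i < n"
    by (metis (mono_tags, lifting) finite_nat_set_iff_bounded mem_Collect_eq)
  have "(\<Prod>i<N. g i) = (\<Prod>i | \<epsilon> \<le> v i. g i)" if "N \<ge> n" for N
    by (rule prod.mono_neutral_right) (use n that g in \<open>auto simp: not_le intro: less_le_trans\<close>)
  then show ?thesis unfolding eventually_sequentially by blast
qed

section \<open>Multiplicative functionals of stick breaking and of its ranked sequence\<close>

context cycle_functional
begin

text \<open>A limit of partial products rather than a product over
  \<open>{i. \<epsilon> \<le> v i}\<close>, which makes measurability immediate; the two agree on
  \<open>null_lengths\<close> sequences.\<close>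

definition limit_functional :: "(nat \<Rightarrow> real) \<Rightarrow> complex" where
  "limit_functional v = lim (\<lambda>N. \<Prod>i<N. avg (v i))"

lemma prod_avg_tendsto:
  assumes "null_lengths v"
  shows "(\<lambda>N. \<Prod>i<N. avg (v i)) \<longlonglongrightarrow> limit_functional v"
    and "limit_functional v = (\<Prod>i | \<epsilon> \<le> v i. avg (v i))"
proof -
  have "(\<lambda>N. \<Prod>i<N. avg (v i)) \<longlonglongrightarrow> (\<Prod>i | \<epsilon> \<le> v i. avg (v i))"
    using assms by (intro tendsto_eventually prod_null_lengths_eventually eps avg_small)
      (auto simp: null_lengths_def intro: less_imp_le)
  then show "limit_functional v = (\<Prod>i | \<epsilon> \<le> v i. avg (v i))"
    "(\<lambda>N. \<Prod>i<N. avg (v i)) \<longlonglongrightarrow> limit_functional v"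
    unfolding limit_functional_def by (auto simp: limI)
qed

lemma measurable_limit_functional [measurable]:
  "limit_functional \<in> borel_measurable (\<Pi>\<^sub>M j\<in>UNIV. borel)"
  unfolding limit_functional_def[abs_def] by measurable

lemma norm_prod_avg_le: "norm (\<Prod>i<N. avg (f i)) \<le> 1"
  unfolding prod_norm[symmetric] by (intro prod_le_1) (auto simp: norm_avg_le)

text \<open>With the marks averaged out, only a finite product over the lengths at least
  \<open>\<epsilon>\<close> remains, and the ranking merely permutes its factors.\<close>

lemma limit_functional_ranked:
  assumes "null_lengths v"
  shows "limit_functional (ranked v) = limit_functional v"
proof -
  obtain \<pi> where \<pi>: "bij \<pi>" "ranked v = v \<circ> \<pi>" "null_lengths (ranked v)"
    using assms by (rule null_lengths_ranked)
  have "bij_betw \<pi> {i. \<epsilon> \<le> v (\<pi> i)} {i. \<epsilon> \<le> v i}"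
    using \<pi>(1) by (auto simp: bij_betw_def bij_def inj_on_def image_iff)
  then have "(\<Prod>i | \<epsilon> \<le> v (\<pi> i). avg (v (\<pi> i))) = (\<Prod>i | \<epsilon> \<le> v i. avg (v i))"
    by (rule prod.reindex_bij_betw)
  then show ?thesis
    using prod_avg_tendsto(2)[OF assms] prod_avg_tendsto(2)[OF \<pi>(3)] by (simp add: \<pi>(2))
qed

text \<open>After a first piece \<open>s\<close>, the remaining pieces are \<open>1 - s\<close>
  times a stick breaking driven by the shifted sequence; this is the recursion of
  \<open>limit_mean\<close> with \<open>y\<close> replaced by \<open>y * (1 - s)\<close>.\<close>

lemma limit_mean_stick:
  "limit_mean N y = (\<integral>W. (\<Prod>i<N. avg (y * stick_breaking W i)) \<partial>stick_space \<theta>)"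
proof (induction N arbitrary: y)
  case 0
  interpret Q: prob_space "stick_space \<theta>" using theta by (rule prob_space_stick_space)
  show ?case by (simp add: Q.prob_space)
next
  case (Suc N)
  have sb: "stick_breaking (case_nat s W) 0 = s"
    "stick_breaking (case_nat s W) (Suc i) = (1 - s) * stick_breaking W i" for s W i
    unfolding stick_breaking_def prod.lessThan_Suc_shift by simp_all
  have "(\<integral>W. (\<Prod>i<Suc N. avg (y * stick_breaking W i)) \<partial>stick_space \<theta>) =
      (\<integral>s. \<integral>W. (\<Prod>i<Suc N. avg (y * stick_breaking (case_nat s W) i)) \<partial>stick_space \<theta> \<partial>stick_measure \<theta>)"
    by (rule integral_stick_space_iter[OF theta _ norm_prod_avg_le]) measurable
  also have "\<dots> = (\<integral>s. \<integral>W. avg (y * s) * (\<Prod>i<N. avg (y * (1 - s) * stick_breaking W i)) \<partial>stick_space \<theta> \<partial>stick_measure \<theta>)"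
    unfolding prod.lessThan_Suc_shift sb by (simp add: mult.assoc)
  also have "\<dots> = (\<integral>s. avg (y * s) * limit_mean N (y * (1 - s)) \<partial>stick_measure \<theta>)"
    by (simp add: Suc)
  finally show ?case by simp
qed

lemma limit_mean_tendsto:
  "(\<lambda>N. limit_mean N 1) \<longlonglongrightarrow> (\<integral>l. limit_functional l \<partial>poisson_dirichlet \<theta>)"
proof -
  interpret Q: prob_space "stick_space \<theta>" using theta by (rule prob_space_stick_space)
  have "(\<lambda>N. \<integral>W. (\<Prod>i<N. avg (stick_breaking W i)) \<partial>stick_space \<theta>) \<longlonglongrightarrow>
      (\<integral>W. limit_functional (stick_breaking W) \<partial>stick_space \<theta>)"
  proof (rule integral_dominated_convergence[where w = "\<lambda>_. 1"])
    show "AE W in stick_space \<theta>. (\<lambda>N. \<Prod>i<N. avg (stick_breaking W i)) \<longlonglongrightarrow> limit_functional (stick_breaking W)"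
      using AE_null_lengths_stick[OF theta] by eventually_elim (rule prod_avg_tendsto(1))
  qed (auto simp: norm_prod_avg_le)
  also have "(\<integral>W. limit_functional (stick_breaking W) \<partial>stick_space \<theta>) =
      (\<integral>W. limit_functional (ranked (stick_breaking W)) \<partial>stick_space \<theta>)"
  proof (rule integral_cong_AE)
    show "AE W in stick_space \<theta>. limit_functional (stick_breaking W) = limit_functional (ranked (stick_breaking W))"
      using AE_null_lengths_stick[OF theta] by eventually_elim (simp add: limit_functional_ranked)
  qed measurable
  also have "\<dots> = (\<integral>l. limit_functional l \<partial>poisson_dirichlet \<theta>)"
    unfolding poisson_dirichlet_def by (rule integral_distr[symmetric]) measurable
  finally show ?thesis by (simp add: limit_mean_stick)
qed

end

text \<open>Independence of lengths and marks makes their joint law a product, so by Fubini the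
  marks can be integrated first with the lengths frozen; independence among the marks then
  factorises the product.\<close>

lemma expectation_independent_marks:
  fixes g :: "real \<Rightarrow> real \<Rightarrow> complex" and N :: "'a measure" and L U :: "nat \<Rightarrow> 'a \<Rightarrow> real"
  assumes N: "prob_space N"
    and L: "distr N (\<Pi>\<^sub>M i\<in>UNIV. borel) (\<lambda>\<omega> i. L i \<omega>) = P"
    and U: "prob_space.indep_vars N (\<lambda>_. borel) U UNIV"
    and Ud: "\<And>i. distr N borel (U i) = distr (measure_pmf (pmf_of_set A)) borel (\<lambda>x. x)"
    and A: "finite A" "A \<noteq> {}"
    and LU: "prob_space.indep_var N (\<Pi>\<^sub>M i\<in>UNIV. borel) (\<lambda>\<omega> i. L i \<omega>) (\<Pi>\<^sub>M i\<in>UNIV. borel) (\<lambda>\<omega> i. U i \<omega>)"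
    and g: "case_prod g \<in> borel_measurable (borel \<Otimes>\<^sub>M borel)" and bnd: "\<And>x u. norm (g x u) \<le> 1"
  shows "(\<integral>\<omega>. (\<Prod>i<K. g (L i \<omega>) (U i \<omega>)) \<partial>N) = (\<integral>l. (\<Prod>i<K. (\<Sum>a\<in>A. g (l i) a) / of_nat (card A)) \<partial>P)"
proof -
  interpret prob_space N by (rule N)
  let ?B = "\<Pi>\<^sub>M i\<in>(UNIV::nat set). borel :: real measure"
  have [measurable]: "(\<lambda>\<omega> i. L i \<omega>) \<in> N \<rightarrow>\<^sub>M ?B" "(\<lambda>\<omega> i. U i \<omega>) \<in> N \<rightarrow>\<^sub>M ?B"
    using LU by (auto simp: indep_var_distribution_eq)
  have Um [measurable]: "U i \<in> borel_measurable N" for i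
    using U by (auto simp: indep_vars_def)
  note g [measurable]
  have gm [measurable]: "g x \<in> borel_measurable borel" for x
    by measurable
  define D where "D = distr N ?B (\<lambda>\<omega> i. U i \<omega>)"
  have D: "prob_space D" unfolding D_def by (rule prob_space_distr) measurable
  have P: "prob_space P" unfolding L[symmetric] by (rule prob_space_distr) measurable
  interpret D: prob_space D by (rule D)
  interpret P: prob_space P by (rule P)
  interpret PD: pair_prob_space P D ..
  have [measurable_cong]: "sets D = sets ?B" "sets P = sets ?B" unfolding D_def L[symmetric] by simp_all
  have joint: "distr N (?B \<Otimes>\<^sub>M ?B) (\<lambda>\<omega>. (\<lambda>i. L i \<omega>, \<lambda>i. U i \<omega>)) = P \<Otimes>\<^sub>M D"
    using LU unfolding indep_var_distribution_eq L D_def by simp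
  have prod_le: "norm (\<Prod>i<K. g (l i) (u i)) \<le> 1" for l u
    unfolding prod_norm[symmetric] by (intro prod_le_1) (auto simp: bnd)
  have "(\<integral>\<omega>. (\<Prod>i<K. g (L i \<omega>) (U i \<omega>)) \<partial>N) =
      (\<integral>z. (\<Prod>i<K. g (fst z i) (snd z i)) \<partial>distr N (?B \<Otimes>\<^sub>M ?B) (\<lambda>\<omega>. (\<lambda>i. L i \<omega>, \<lambda>i. U i \<omega>)))"
    by (subst integral_distr) auto
  also have "\<dots> = (\<integral>l. (\<integral>u. (\<Prod>i<K. g (l i) (u i)) \<partial>D) \<partial>P)"
    unfolding joint
    by (subst PD.integral_fst'[symmetric])
       (auto intro!: PD.P.integrable_const_bound[of _ 1] simp: prod_le)
  also have "\<dots> = (\<integral>l. (\<Prod>i<K. (\<Sum>a\<in>A. g (l i) a) / of_nat (card A)) \<partial>P)"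
  proof (intro Bochner_Integration.integral_cong refl)
    fix l
    \<comment> \<open>For fixed \<open>l\<close> the integral is pulled back to \<open>N\<close>,
      where independence of the \<open>U i\<close> is available.\<close>
    have "(\<integral>u. (\<Prod>i<K. g (l i) (u i)) \<partial>D) = (\<integral>\<omega>. (\<Prod>i<K. g (l i) (U i \<omega>)) \<partial>N)"
      unfolding D_def by (subst integral_distr) auto
    also have "\<dots> = (\<Prod>i<K. \<integral>\<omega>. g (l i) (U i \<omega>) \<partial>N)"
    proof (rule indep_vars_lebesgue_integral)
      show "indep_vars (\<lambda>_. borel) (\<lambda>i \<omega>. g (l i) (U i \<omega>)) {..<K}"
        by (rule indep_vars_compose2[OF indep_vars_subset[OF U]]) auto
      show "integrable N (\<lambda>\<omega>. g (l i) (U i \<omega>))" for i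
        by (rule integrable_const_bound[of _ 1]) (auto simp: bnd)
    qed simp
    also have "\<dots> = (\<Prod>i<K. (\<Sum>a\<in>A. g (l i) a) / of_nat (card A))"
    proof (intro prod.cong refl)
      fix i
      have "(\<integral>\<omega>. g (l i) (U i \<omega>) \<partial>N) = (\<integral>u. g (l i) u \<partial>distr N borel (U i))"
        by (subst integral_distr) auto
      also have "\<dots> = (\<integral>u. g (l i) u \<partial>measure_pmf (pmf_of_set A))"
        unfolding Ud by (subst integral_distr) auto
      also have "\<dots> = (\<Sum>a\<in>A. pmf (pmf_of_set A) a *\<^sub>R g (l i) a)"
        by (rule integral_measure_pmf) (use A in auto)
      also have "\<dots> = (\<Sum>a\<in>A. g (l i) a) / of_nat (card A)"
        using A by (simp add: scaleR_conv_of_real sum_divide_distrib)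
      finally show "(\<integral>\<omega>. g (l i) (U i \<omega>) \<partial>N) = \<dots>" .
    qed
    finally show "(\<integral>u. (\<Prod>i<K. g (l i) (u i)) \<partial>D) = \<dots>" .
  qed
  finally show ?thesis .
qed

section \<open>Expectations under the Ewens measure\<close>

lemma space_ewens: "space (ewens \<theta> n) = {\<sigma>. \<sigma> permutes {1..n}}"
  by (simp add: ewens_def space_point_measure)

lemma measurable_ewens [simp, measurable]: "f \<in> borel_measurable (ewens \<theta> n)"
  by (simp add: ewens_def measurable_point_measure_eq1)

lemma integral_ewens:
  fixes g :: "(nat \<Rightarrow> nat) \<Rightarrow> 'b::{banach, second_countable_topology}"
  assumes "\<theta> > 0"
  shows "(\<integral>\<sigma>. g \<sigma> \<partial>ewens \<theta> n) =
    (\<Sum>\<sigma> | \<sigma> permutes {1..n}. (\<theta> ^ card (perm_cycles n \<sigma>) / pochhammer \<theta> n) *\<^sub>R g \<sigma>)"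
  unfolding ewens_def using assms
  by (intro lebesgue_integral_point_measure_finite finite_permutations)
     (auto intro!: divide_nonneg_nonneg less_imp_le[OF pochhammer_pos])

lemma integral_ewens_prod:
  fixes w :: "nat \<Rightarrow> 'b::{real_normed_field, banach, second_countable_topology}"
  assumes "\<theta> > 0"
  shows "(\<integral>\<sigma>. (\<Prod>c\<in>perm_cycles n \<sigma>. w (card c)) \<partial>ewens \<theta> n) = ewens_mean \<theta> w n"
  unfolding integral_ewens[OF assms] scaleR_conv_of_real by (rule sum_ewens_cycle_prod[OF assms])

text \<open>The total mass is the mean of the weight constantly \<open>1\<close>, for which the
  recursion reduces to the probabilities \<open>pick\<close> summing to \<open>1\<close>.\<close>

lemma prob_space_ewens:
  assumes \<theta>: "\<theta> > 0"
  shows "prob_space (ewens \<theta> n)"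
proof
  have mean1: "ewens_mean \<theta> (\<lambda>_. 1 :: real) n = 1"
  proof (induction n rule: less_induct)
    case (less n)
    then show ?case
      by (cases n) (simp_all add: sum_pick_eq_1[OF \<theta>])
  qed
  have pos: "0 \<le> \<theta> ^ card (perm_cycles n \<sigma>) / pochhammer \<theta> n" for \<sigma>
    using \<theta> by (intro divide_nonneg_nonneg less_imp_le[OF pochhammer_pos]) auto
  have "emeasure (ewens \<theta> n) (space (ewens \<theta> n)) =
      (\<Sum>\<sigma> | \<sigma> permutes {1..n}. ennreal (\<theta> ^ card (perm_cycles n \<sigma>) / pochhammer \<theta> n))"
    unfolding space_ewens by (simp add: ewens_def emeasure_point_measure_finite finite_permutations)
  also have "\<dots> = ennreal (\<Sum>\<sigma> | \<sigma> permutes {1..n}. \<theta> ^ card (perm_cycles n \<sigma>) / pochhammer \<theta> n)"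
    by (rule sum_ennreal[OF pos])
  also have "(\<Sum>\<sigma> | \<sigma> permutes {1..n}. \<theta> ^ card (perm_cycles n \<sigma>) / pochhammer \<theta> n) = 1"
    using sum_ewens_cycle_prod[OF \<theta>, of n "\<lambda>_. 1 :: real"] by (simp add: mean1)
  finally show "emeasure (ewens \<theta> n) (space (ewens \<theta> n)) = 1" by simp
qed

lemma integrable_ewens:
  fixes g :: "(nat \<Rightarrow> nat) \<Rightarrow> 'b::{banach, second_countable_topology}"
  shows "\<theta> > 0 \<Longrightarrow> integrable (ewens \<theta> n) g"
  unfolding ewens_def
  by (intro integrable_point_measure_finite finite_permutations finite_atLeastAtMost)

lemma finite_perm_cycles [simp]: "finite (perm_cycles n \<sigma>)"
  by (simp add: perm_cycles_def)

lemma perm_cycles_subset: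
  assumes "\<sigma> permutes {1..n}" "c \<in> perm_cycles n \<sigma>"
  shows "c \<subseteq> {1..n}" "finite c" "card c \<in> {1..n}"
proof -
  obtain x where x: "x \<in> {1..n}" "c = orbit \<sigma> x" using assms(2) by (auto simp: perm_cycles_def)
  then show sub: "c \<subseteq> {1..n}" using permutes_orbit_subset[OF assms(1)] by simp
  from sub show fin: "finite c" by (rule finite_subset) simp
  have "c \<noteq> {}" unfolding x by (rule orbit_nonempty)
  then show "card c \<in> {1..n}"
    using fin card_mono[OF _ sub] by (auto simp: Suc_le_eq card_gt_0_iff)
qed

lemma sum_card_perm_cycles:
  assumes "\<sigma> permutes {1..n}"
  shows "(\<Sum>c\<in>perm_cycles n \<sigma>. card c) = n"
proof -
  have cyc: "cyclic_on \<sigma> (orbit \<sigma> x)" for x using assms by (rule cyclic_on_orbit) simp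
  have self: "x \<in> orbit \<sigma> x" for x
    using assms by (intro permutation_self_in_orbit) (auto simp: permutation_permutes)
  have "card (\<Union>(perm_cycles n \<sigma>)) = (\<Sum>c\<in>perm_cycles n \<sigma>. card c)"
  proof (rule card_Union_disjoint)
    show "disjoint (perm_cycles n \<sigma>)"
      unfolding disjoint_def perm_cycles_def using orbit_cyclic_eq3[OF cyc] by blast
  qed (use perm_cycles_subset(2)[OF assms] in auto)
  moreover have "\<Union>(perm_cycles n \<sigma>) = {1..n}"
    using perm_cycles_subset(1)[OF assms] self by (auto simp: perm_cycles_def)
  ultimately show ?thesis by simp
qed

lemma sum_num_cycles_of_length:
  fixes \<phi> :: "nat \<Rightarrow> real"
  assumes "\<sigma> permutes {1..n}"
  shows "(\<Sum>j\<in>{1..n}. real (num_cycles_of_length n j \<sigma>) * \<phi> j) = (\<Sum>c\<in>perm_cycles n \<sigma>. \<phi> (card c))"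
proof -
  have "(\<Sum>c\<in>perm_cycles n \<sigma>. \<phi> (card c)) = (\<Sum>j\<in>{1..n}. \<Sum>c | c \<in> perm_cycles n \<sigma> \<and> card c = j. \<phi> (card c))"
    using perm_cycles_subset(3)[OF assms] by (intro sum.group[symmetric]) auto
  also have "\<dots> = (\<Sum>j\<in>{1..n}. real (num_cycles_of_length n j \<sigma>) * \<phi> j)"
    by (intro sum.cong refl) (simp add: num_cycles_of_length_def)
  finally show ?thesis by simp
qed

section \<open>Residues of cycle lengths\<close>

text \<open>The point set \<open>{i/j - s/t | i \<in> \<int>}\<close> is \<open>{(u + q) / j | q \<in> \<int>}\<close> for the unique
  \<open>u \<in> {1/t, \<dots>, t/t}\<close> with \<open>t u \<equiv> - j s\<close> modulo \<open>t\<close>; this \<open>u\<close> is \<open>mark s t j\<close>.\<close>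

definition mark_num :: "int \<Rightarrow> nat \<Rightarrow> nat \<Rightarrow> int" where
  "mark_num s t j = (- (int j * s) - 1) mod int t + 1"

definition mark :: "int \<Rightarrow> nat \<Rightarrow> nat \<Rightarrow> real" where
  "mark s t j = real_of_int (mark_num s t j) / real t"

definition mark_grid :: "nat \<Rightarrow> real set" where
  "mark_grid t = (\<lambda>k. real k / real t) ` {1..t}"

lemma finite_mark_grid [simp]: "finite (mark_grid t)"
  by (simp add: mark_grid_def)

lemma card_mark_grid: "t > 0 \<Longrightarrow> card (mark_grid t) = t"
  unfolding mark_grid_def by (subst card_image) (auto simp: inj_on_def)

lemma mark_grid_bounds:
  assumes "t > 0" "u \<in> mark_grid t"
  shows "0 < u" "u \<le> 1"
  using assms by (auto simp: mark_grid_def)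

text \<open>\<open>u + q\<close> is an integer multiple of \<open>1 / t\<close>. This gap is the
  source of \<open>cutoff\<close>.\<close>

lemma mark_grid_dist:
  assumes "t > 0" "u \<in> mark_grid t" "u + real_of_int q \<noteq> 0"
  shows "\<bar>u + real_of_int q\<bar> \<ge> 1 / real t"
proof -
  obtain k where k: "u = real k / real t" using assms(2) by (auto simp: mark_grid_def)
  have eq: "u + real_of_int q = real_of_int (int k + q * int t) / real t"
    using assms(1) by (simp add: k field_simps)
  have "int k + q * int t \<noteq> 0"
  proof
    assume z: "int k + q * int t = 0"
    show False using assms(3) unfolding eq z by simp
  qed
  then have "1 \<le> \<bar>int k + q * int t\<bar>" by linarith
  then have "1 \<le> \<bar>real_of_int (int k + q * int t)\<bar>" by linarith
  then show ?thesis unfolding eq by (simp add: abs_divide divide_right_mono)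
qed

lemma mark_mod [simp]: "mark s t (j mod t) = mark s t j"
proof -
  have "(int (j mod t) * s) mod int t = (int j * s) mod int t"
    by (simp add: zmod_int mod_mult_left_eq)
  then have "(- (int (j mod t) * s) - 1) mod int t = (- (int j * s) - 1) mod int t"
    by (metis mod_diff_left_eq mod_minus_eq)
  then show ?thesis by (simp add: mark_def mark_num_def)
qed

lemma mark_num_bounds: "t > 0 \<Longrightarrow> 1 \<le> mark_num s t j \<and> mark_num s t j \<le> int t"
  unfolding mark_num_def using pos_mod_bound[of "int t" "- (int j * s) - 1"] by (simp add: zless_imp_add1_zle)

lemma mark_in_grid: "t > 0 \<Longrightarrow> mark s t j \<in> mark_grid t"
  unfolding mark_grid_def mark_def using mark_num_bounds[of t s j]
  by (intro image_eqI[of _ _ "nat (mark_num s t j)"]) auto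

text \<open>Because \<open>s\<close> is invertible modulo \<open>t\<close>, a uniform residue of the
  cycle length yields a uniform mark. This is the role of the reduced fraction.\<close>

lemma bij_betw_mark:
  assumes "coprime s (int t)" "t > 0"
  shows "bij_betw (mark s t) {..<t} (mark_grid t)"
proof -
  have inj: "inj_on (mark s t) {..<t}"
  proof (rule inj_onI)
    fix x y assume xy: "x \<in> {..<t}" "y \<in> {..<t}" and "mark s t x = mark s t y"
    then have "(- (int x * s) - 1) mod int t = (- (int y * s) - 1) mod int t"
      using assms(2) by (simp add: mark_def mark_num_def)
    then have "int t dvd (- (int x * s) - 1) - (- (int y * s) - 1)"
      by (rule mod_eq_dvd_iff[THEN iffD1])
    then have "int t dvd (int y - int x) * s" by (simp add: algebra_simps)
    then have "int t dvd int y - int x"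
      using assms(1) by (simp add: coprime_commute coprime_dvd_mult_left_iff)
    then have "int y mod int t = int x mod int t" by (simp add: mod_eq_dvd_iff)
    then show "x = y" using xy by simp
  qed
  have "mark s t ` {..<t} = mark_grid t"
    using mark_in_grid[OF assms(2)] by (intro card_subset_eq) (auto simp: card_image[OF inj] card_mark_grid assms(2))
  then show ?thesis using inj by (simp add: bij_betw_def)
qed

text \<open>Mark \<open>1\<close> is the one whose points \<open>(u + q) / x\<close> include
  \<open>0\<close>, at \<open>q = - 1\<close>; so the atom at \<open>0\<close> counts the cycles of
  length divisible by \<open>t\<close>.\<close>

lemma mark_eq_1_iff:
  assumes "coprime s (int t)" "t > 0"
  shows "mark s t j = 1 \<longleftrightarrow> t dvd j"
proof -
  have "mark s t j = 1 \<longleftrightarrow> mark_num s t j = int t"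
    using assms(2) of_int_eq_iff[of "mark_num s t j" "int t", where 'a = real] by (auto simp: mark_def)
  also have "\<dots> \<longleftrightarrow> int t dvd int j * s"
  proof
    assume "mark_num s t j = int t"
    then have *: "(- (int j * s) - 1) mod int t = int t - 1" by (simp add: mark_num_def)
    have "(- (int j * s)) mod int t = ((- (int j * s) - 1) mod int t + 1) mod int t"
      by (simp add: mod_add_left_eq)
    also have "\<dots> = 0" unfolding * by simp
    finally show "int t dvd int j * s" by (simp add: dvd_eq_mod_eq_0[symmetric])
  next
    assume "int t dvd int j * s"
    then obtain z where "int j * s = int t * z" by blast
    then have "- (int j * s) - 1 = - 1 + int t * (- z)" by simp
    then have "(- (int j * s) - 1) mod int t = (- 1 + int t * (- z)) mod int t" by (simp only:)
    also have "\<dots> = (- 1) mod int t" by (rule mod_mult_self2)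
    also have "\<dots> = int t - 1" using assms(2) by (simp add: zmod_minus1)
    finally show "mark_num s t j = int t" by (simp add: mark_num_def)
  qed
  also have "\<dots> \<longleftrightarrow> int t dvd int j"
    using assms(1) by (simp add: coprime_commute coprime_dvd_mult_left_iff)
  finally show ?thesis by simp
qed

text \<open>The offset between the index \<open>i\<close> of the finite process and the index
  \<open>q\<close> of the limit process for cycles of length \<open>j\<close>. The division is
  exact, since \<open>mark_num s t j\<close> is congruent to \<open>- j * s\<close> modulo
  \<open>t\<close>.\<close>

definition mark_shift :: "int \<Rightarrow> nat \<Rightarrow> nat \<Rightarrow> int" where
  "mark_shift s t j = (mark_num s t j + int j * s) div int t"

lemma scaled_point_eq_mark:
  assumes "t > 0" "j > 0" "n > 0"
  shows "real n * (real_of_int (q + mark_shift s t j) / real j - real_of_int s / real t) =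
    (mark s t j + real_of_int q) / (real j / real n)"
proof -
  have "(mark_num s t j + int j * s) mod int t = ((- (int j * s) - 1) mod int t + (1 + int j * s)) mod int t"
    by (simp add: mark_num_def algebra_simps)
  also have "\<dots> = (- (int j * s) - 1 + (1 + int j * s)) mod int t" by (rule mod_add_left_eq)
  finally have "int t dvd mark_num s t j + int j * s" by (simp add: dvd_eq_mod_eq_0)
  then have "mark_shift s t j * int t = mark_num s t j + int j * s" by (simp add: mark_shift_def)
  then have "real_of_int (mark_shift s t j) * real t = real_of_int (mark_num s t j) + real j * real_of_int s"
    by (metis of_int_add of_int_mult of_int_of_nat_eq)
  then have "real_of_int (mark_shift s t j) = mark s t j + real j * real_of_int s / real t"
    using assms(1) by (simp add: mark_def field_simps)
  then show ?thesis using assms by (simp add: field_simps)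
qed

section \<open>Integrals of test functions\<close>

lemma ext_integral_dirac_sum:
  assumes [measurable]: "f \<in> borel_measurable borel" and A: "finite A" "A \<subseteq> I"
    and w: "\<And>k. k \<in> A \<Longrightarrow> w k = of_nat (c k)"
    and 0: "\<And>k. k \<in> I - A \<Longrightarrow> f (x k) = 0"
  shows "ext_integral (dirac_sum I w x) f = ereal (\<Sum>k\<in>A. real (c k) * f (x k))"
proof -
  have *: "(\<integral>\<^sup>+y. ennreal (g y) \<partial>dirac_sum I w x) = ennreal (\<Sum>k\<in>A. real (c k) * max 0 (g (x k)))"
    if [measurable]: "g \<in> borel_measurable borel" and "\<And>k. k \<in> I - A \<Longrightarrow> g (x k) = 0" for g
  proof -
    have "(\<integral>\<^sup>+y. ennreal (g y) \<partial>dirac_sum I w x) = (\<integral>\<^sup>+k. w k * ennreal (g (x k)) \<partial>count_space I)"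
      by (rule nn_integral_dirac_sum) measurable
    also have "\<dots> = (\<Sum>k\<in>A. w k * ennreal (g (x k)))"
      using that(2) A by (intro nn_integral_count_space') auto
    also have "\<dots> = (\<Sum>k\<in>A. ennreal (real (c k) * max 0 (g (x k))))"
      by (intro sum.cong refl) (simp add: w ennreal_mult ennreal_of_nat_eq_real_of_nat ennreal_max_0)
    also have "\<dots> = ennreal (\<Sum>k\<in>A. real (c k) * max 0 (g (x k)))"
      by (rule sum_ennreal) simp
    finally show ?thesis .
  qed
  have nonneg: "0 \<le> (\<Sum>k\<in>A. real (c k) * max 0 (g k))" for g :: "_ \<Rightarrow> real"
    by (intro sum_nonneg) auto
  have "(\<integral>\<^sup>+y. ennreal (f y) \<partial>dirac_sum I w x) = ennreal (\<Sum>k\<in>A. real (c k) * max 0 (f (x k)))"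
    "(\<integral>\<^sup>+y. ennreal (- f y) \<partial>dirac_sum I w x) = ennreal (\<Sum>k\<in>A. real (c k) * max 0 (- f (x k)))"
    by (rule *; use 0 in simp)+
  then have "ext_integral (dirac_sum I w x) f =
      ereal ((\<Sum>k\<in>A. real (c k) * max 0 (f (x k))) - (\<Sum>k\<in>A. real (c k) * max 0 (- f (x k))))"
    unfolding ext_integral_def by (simp add: enn2ereal_ennreal nonneg)
  also have "(\<Sum>k\<in>A. real (c k) * max 0 (f (x k))) - (\<Sum>k\<in>A. real (c k) * max 0 (- f (x k))) =
      (\<Sum>k\<in>A. real (c k) * f (x k))"
    unfolding sum_subtractf[symmetric] by (intro sum.cong refl) (auto simp: max_def)
  finally show ?thesis .
qed

locale test_function =
  fixes f :: "real \<Rightarrow> real" and R :: real and t :: nat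
  assumes f_cont: "continuous_on UNIV f" and f_supp: "\<And>x. f x \<noteq> 0 \<Longrightarrow> \<bar>x\<bar> \<le> R"
    and R: "R > 0" and t: "t > 0"
begin

lemma measurable_f [measurable]: "f \<in> borel_measurable borel"
  using f_cont by (rule borel_measurable_continuous_onI)

text \<open>For \<open>x\<close> and \<open>u\<close> in \<open>(0, 1]\<close>, a point
  \<open>(u + q) / x\<close> in \<open>[-R, R]\<close> forces
  \<open>\<bar>u + q\<bar> \<le> R\<close>, hence \<open>\<bar>q\<bar> \<le> R + 1\<close>.\<close>

definition "window = {- (\<lceil>R\<rceil> + 1)..\<lceil>R\<rceil> + 1}"

text \<open>For relative lengths below this value, every point \<open>(u + q) / x\<close> with
  \<open>u + q \<noteq> 0\<close> lies outside \<open>[-R, R]\<close>, by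
  \<open>mark_grid_dist\<close>.\<close>

definition "cutoff = 1 / (real t * R)"

text \<open>The contribution of a cycle of relative length \<open>x\<close> and mark \<open>u\<close>, without the atom at \<open>0\<close>.
  For \<open>x \<in> {0..1}\<close> and \<open>u \<in> {0..1}\<close> only indices \<open>q\<close> in \<open>window\<close> matter.\<close>

definition contribution :: "real \<Rightarrow> real \<Rightarrow> real" where
  "contribution x u = (\<Sum>q\<in>{q\<in>window. u + real_of_int q \<noteq> 0}. f ((u + real_of_int q) / x))"

lemma finite_window [simp]: "finite window"
  by (simp add: window_def)

lemma cutoff_pos: "cutoff > 0"
  using R t by (simp add: cutoff_def)

lemma in_window:
  assumes x: "0 < x" "x \<le> 1" and u: "0 < u" "u \<le> 1" and f: "f ((u + real_of_int q) / x) \<noteq> 0"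
  shows "q \<in> window"
proof -
  have "\<bar>u + real_of_int q\<bar> / x \<le> R" using f_supp[OF f] x by (simp add: abs_divide)
  then have "\<bar>u + real_of_int q\<bar> \<le> R * x" using x by (simp add: pos_divide_le_eq)
  also have "\<dots> \<le> R * 1" using x R by (intro mult_left_mono) auto
  finally have "- R - 1 \<le> real_of_int q" "real_of_int q \<le> R + 1" using u by linarith+
  then show ?thesis unfolding window_def by (simp, linarith)
qed

text \<open>Formulated with \<open>\<bar>x\<bar>\<close> to cover a two-sided neighbourhood of
  \<open>0\<close>, as continuity of \<open>contribution\<close> on the whole line requires.\<close>

lemma f_small:
  assumes u: "u \<in> mark_grid t" "u + real_of_int q \<noteq> 0" and x: "0 < \<bar>x\<bar>" "\<bar>x\<bar> < cutoff"
  shows "f ((u + real_of_int q) / x) = 0"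
proof (rule ccontr)
  assume "f ((u + real_of_int q) / x) \<noteq> 0"
  then have "\<bar>u + real_of_int q\<bar> \<le> R * \<bar>x\<bar>" using f_supp[of "(u + real_of_int q) / x"] x
    by (simp add: abs_divide pos_divide_le_eq)
  also have "\<dots> < R * cutoff" using x R by (intro mult_strict_left_mono) auto
  also have "\<dots> = 1 / real t" using R by (simp add: cutoff_def)
  finally show False using mark_grid_dist[OF t u] by linarith
qed

lemma contribution_small:
  assumes "u \<in> mark_grid t" "0 < x" "x < cutoff"
  shows "contribution x u = 0"
  unfolding contribution_def using assms by (intro sum.neutral) (auto intro!: f_small)

lemma measurable_contribution [measurable]: "case_prod contribution \<in> borel_measurable (borel \<Otimes>\<^sub>M borel)"
proof -
  have "contribution x u = (\<Sum>q\<in>window. if u + real_of_int q \<noteq> 0 then f ((u + real_of_int q) / x) else 0)" for x u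
    unfolding contribution_def by (rule sum.inter_filter) simp
  then show ?thesis by (simp add: split_beta')
qed

text \<open>Only \<open>x = 0\<close> is critical. Each term vanishes near \<open>0\<close> by
  \<open>f_small\<close>, and at \<open>0\<close> itself division by zero gives \<open>f 0\<close>,
  which is \<open>0\<close> by assumption.\<close>

lemma continuous_contribution:
  assumes f0: "f 0 = 0" and u: "u \<in> mark_grid t"
  shows "continuous_on UNIV (\<lambda>x. contribution x u)"
  unfolding contribution_def
proof (intro continuous_intros)
  fix q assume q: "q \<in> {q \<in> window. u + real_of_int q \<noteq> 0}"
  show "continuous_on UNIV (\<lambda>x. f ((u + real_of_int q) / x))"
    unfolding continuous_on_eq_continuous_at[OF open_UNIV]
  proof
    fix a :: real
    show "isCont (\<lambda>x. f ((u + real_of_int q) / x)) a"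
    proof (cases "a = 0")
      case False
      have "isCont f ((u + real_of_int q) / a)"
        using f_cont by (simp add: continuous_on_eq_continuous_at)
      moreover have "isCont (\<lambda>x. (u + real_of_int q) / x) a"
        using False by (intro continuous_intros)
      ultimately show ?thesis by (rule isCont_o2[rotated])
    next
      case True
      have zero: "f ((u + real_of_int q) / x) = 0" if "x \<in> {- cutoff<..<cutoff}" for x
      proof (cases "x = 0")
        case True
        then show ?thesis using f0 by simp
      next
        case False
        have "\<bar>x\<bar> < cutoff" using that by auto
        with False q show ?thesis by (intro f_small u) auto
      qed
      have "isCont (\<lambda>x. 0 :: real) 0" by simp
      moreover have "\<forall>\<^sub>F x in nhds 0. (\<lambda>x. 0) x = f ((u + real_of_int q) / x)"
        using eventually_nhds_in_open[of "{- cutoff<..<cutoff}" 0] cutoff_pos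
        by (auto elim!: eventually_mono simp: zero)
      ultimately show ?thesis using isCont_cong[of "\<lambda>x. 0" "\<lambda>x. f ((u + real_of_int q) / x)" 0] True by simp
    qed
  qed
qed

text \<open>Among marks in \<open>(0, 1]\<close>, the point \<open>0\<close> is hit only by
  \<open>u = 1\<close> with \<open>q = - 1\<close>.\<close>

lemma sum_window:
  assumes u: "u \<in> mark_grid t"
  shows "(\<Sum>q\<in>window. f ((u + real_of_int q) / x)) = (if u = 1 then f 0 else 0) + contribution x u"
proof -
  have "(\<Sum>q\<in>window. f ((u + real_of_int q) / x)) =
      (\<Sum>q\<in>{q\<in>window. u + real_of_int q = 0}. f ((u + real_of_int q) / x)) + contribution x u"
    unfolding contribution_def
    by (subst sum.union_disjoint[symmetric]) (auto intro!: sum.cong)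
  also have "(\<Sum>q\<in>{q\<in>window. u + real_of_int q = 0}. f ((u + real_of_int q) / x)) = (if u = 1 then f 0 else 0)"
  proof (cases "u = 1")
    case True
    have "{q\<in>window. u + real_of_int q = 0} = {-1}"
      using True R by (auto simp: window_def)
    then show ?thesis using True by simp
  next
    case False
    have "u + real_of_int q \<noteq> 0" for q
    proof
      assume "u + real_of_int q = 0"
      then have "real_of_int (- q) = u" by simp
      moreover have "0 < u" "u < 1" using mark_grid_bounds[OF t u] False by auto
      ultimately have "0 < - q" "- q < 1" by linarith+
      then show False by linarith
    qed
    then have "{q\<in>window. u + real_of_int q = 0} = {}" by blast
    then show ?thesis using False by simp
  qed
  finally show ?thesis .
qed

lemma ext_integral_finite_process:
  assumes st: "coprime s (int t)" "\<alpha> = real_of_int s / real t" and \<sigma>: "\<sigma> permutes {1..n}"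
  shows "ext_integral (finite_process n \<alpha> \<sigma>) f = ereal (\<Sum>c\<in>perm_cycles n \<sigma>.
    (if t dvd card c then f 0 else 0) + contribution (real (card c) / real n) (mark s t (card c)))"
proof -
  define p where "p = (\<lambda>(j, i). real n * (real_of_int i / real j - \<alpha>))"
  \<comment> \<open>For each \<open>j\<close> the indices \<open>i\<close> with
    \<open>i - mark_shift s t j\<close> in \<open>window\<close> are kept; at all others
    \<open>f\<close> vanishes by \<open>in_window\<close>.\<close>
  define A where "A = (SIGMA j:{1..n}. (\<lambda>q. q + mark_shift s t j) ` window)"
  have pt: "p (j, q + mark_shift s t j) = (mark s t j + real_of_int q) / (real j / real n)" if "j \<in> {1..n}" for j q
    unfolding p_def prod.case st(2) using that by (intro scaled_point_eq_mark t) auto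
  have "ext_integral (finite_process n \<alpha> \<sigma>) f = ereal (\<Sum>k\<in>A. real (num_cycles_of_length n (fst k) \<sigma>) * f (p k))"
    unfolding finite_process_def p_def[symmetric]
  proof (rule ext_integral_dirac_sum)
    show "finite A" unfolding A_def by auto
    show "A \<subseteq> {1..n} \<times> UNIV" unfolding A_def by auto
    fix k assume k: "k \<in> {1..n} \<times> UNIV - A"
    then obtain j i where ji: "k = (j, i)" "j \<in> {1..n}" by auto
    define q where "q = i - mark_shift s t j"
    have i: "i = q + mark_shift s t j" by (simp add: q_def)
    have "q \<notin> window" using k ji i unfolding A_def by auto
    then have "f ((mark s t j + real_of_int q) / (real j / real n)) = 0"
      using in_window[of "real j / real n" "mark s t j" q] ji mark_grid_bounds[OF t mark_in_grid[OF t]] by auto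
    then show "f (p k) = 0" using pt[OF ji(2), of q] ji i by simp
  qed (auto simp: split_beta)
  also have "(\<Sum>k\<in>A. real (num_cycles_of_length n (fst k) \<sigma>) * f (p k)) =
      (\<Sum>j\<in>{1..n}. \<Sum>i\<in>(\<lambda>q. q + mark_shift s t j) ` window. real (num_cycles_of_length n j \<sigma>) * f (p (j, i)))"
    unfolding A_def by (subst sum.Sigma) (auto simp: split_beta')
  also have "\<dots> = (\<Sum>j\<in>{1..n}. real (num_cycles_of_length n j \<sigma>) *
      ((if t dvd j then f 0 else 0) + contribution (real j / real n) (mark s t j)))"
  proof (intro sum.cong refl)
    fix j assume j: "j \<in> {1..n}"
    have "(\<Sum>i\<in>(\<lambda>q. q + mark_shift s t j) ` window. real (num_cycles_of_length n j \<sigma>) * f (p (j, i))) =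
        (\<Sum>q\<in>window. real (num_cycles_of_length n j \<sigma>) * f (p (j, q + mark_shift s t j)))"
      by (subst sum.reindex) (auto simp: inj_on_def)
    also have "\<dots> = real (num_cycles_of_length n j \<sigma>) * (\<Sum>q\<in>window. f ((mark s t j + real_of_int q) / (real j / real n)))"
      unfolding sum_distrib_left by (simp add: pt[OF j])
    finally show "(\<Sum>i\<in>(\<lambda>q. q + mark_shift s t j) ` window. real (num_cycles_of_length n j \<sigma>) * f (p (j, i))) =
        real (num_cycles_of_length n j \<sigma>) *
        ((if t dvd j then f 0 else 0) + contribution (real j / real n) (mark s t j))"
      by (simp only: sum_window[OF mark_in_grid[OF t]] mark_eq_1_iff[OF st(1) t])
  qed
  also have "\<dots> = (\<Sum>c\<in>perm_cycles n \<sigma>.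
    (if t dvd card c then f 0 else 0) + contribution (real (card c) / real n) (mark s t (card c)))"
    by (rule sum_num_cycles_of_length[OF \<sigma>])
  finally show ?thesis .
qed

lemma limit_process_support:
  assumes l: "null_lengths l" and u: "\<And>i. u i \<in> mark_grid t"
    and f: "f ((u i + real_of_int q) / l i) \<noteq> 0" "u i + real_of_int q \<noteq> 0"
  shows "(i, q) \<in> {i. cutoff \<le> l i} \<times> window"
proof -
  have li: "0 < l i" "l i \<le> 1" using l by (auto simp: null_lengths_def)
  have "cutoff \<le> l i"
    using f_small[OF u[of i] f(2), of "l i"] f(1) li by (auto simp: not_le[symmetric])
  moreover have "q \<in> window"
    using in_window[OF li _ _ f(1)] mark_grid_bounds[OF t u[of i]] by auto
  ultimately show ?thesis by simp
qed

lemma ext_integral_limit_process: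
  assumes l: "null_lengths l" and u: "\<And>i. u i \<in> mark_grid t" and f0: "f 0 = 0"
  shows "ext_integral (limit_process l u) f = ereal (\<Sum>i | cutoff \<le> l i. contribution (l i) (u i))"
proof -
  define p where "p = (\<lambda>(i, q). (u i + real_of_int q) / l i)"
  have fin: "finite {i. cutoff \<le> l i}" by (rule finite_null_lengths_ge[OF l cutoff_pos])
  have "ext_integral (limit_process l u) f = ereal (\<Sum>k\<in>{i. cutoff \<le> l i} \<times> window. real 1 * f (p k))"
    unfolding limit_process_def p_def[symmetric]
  proof (rule ext_integral_dirac_sum)
    fix k assume k: "k \<in> UNIV - {i. cutoff \<le> l i} \<times> window"
    obtain i q where iq: "k = (i, q)" by (cases k)
    show "f (p k) = 0"
    proof (rule ccontr)
      assume nz: "f (p k) \<noteq> 0"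
      then have "u i + real_of_int q \<noteq> 0" using f0 by (auto simp: p_def iq)
      from limit_process_support[where u = u, OF l u _ this] nz k show False by (auto simp: p_def iq)
    qed
  qed (use fin in auto)
  also have "(\<Sum>k\<in>{i. cutoff \<le> l i} \<times> window. real 1 * f (p k)) = (\<Sum>i | cutoff \<le> l i. \<Sum>q\<in>window. f ((u i + real_of_int q) / l i))"
    by (simp add: sum.cartesian_product p_def split_beta')
  also have "\<dots> = (\<Sum>i | cutoff \<le> l i. contribution (l i) (u i))"
    unfolding sum_window[OF u] using f0 by (intro sum.cong refl) auto
  finally show ?thesis .
qed

text \<open>Each \<open>i\<close> with \<open>u i = 1\<close> puts a unit mass at \<open>0\<close>,
  so the positive part is infinite. The negative part gets nothing from \<open>0\<close>, and away
  from \<open>0\<close> only finitely many points meet the support.\<close>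

lemma limit_process_infinite:
  assumes l: "null_lengths l" and u: "\<And>i. u i \<in> mark_grid t" and inf: "infinite {i. u i = 1}" and f0: "f 0 > 0"
  shows "(\<integral>\<^sup>+x. ennreal (f x) \<partial>limit_process l u) = \<infinity>" and "(\<integral>\<^sup>+x. ennreal (- f x) \<partial>limit_process l u) \<noteq> \<infinity>"
proof -
  define p where "p = (\<lambda>(i, q). (u i + real_of_int q) / l i)"
  have int: "(\<integral>\<^sup>+x. ennreal (g x) \<partial>limit_process l u) = (\<integral>\<^sup>+k. ennreal (g (p k)) \<partial>count_space UNIV)"
    if [measurable]: "g \<in> borel_measurable borel" for g
    unfolding limit_process_def p_def[symmetric] by (subst nn_integral_dirac_sum) auto
  let ?Z = "(\<lambda>i. (i, - 1 :: int)) ` {i. u i = 1}"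
  have infZ: "infinite ?Z" using inf by (subst finite_image_iff) (auto simp: inj_on_def)
  have "ennreal (f 0) * \<infinity> = (\<integral>\<^sup>+k. ennreal (f 0) * indicator ?Z k \<partial>count_space UNIV)"
    using infZ by (simp add: nn_integral_cmult_indicator emeasure_count_space_infinite)
  also have "\<dots> \<le> (\<integral>\<^sup>+k. ennreal (f (p k)) \<partial>count_space UNIV)"
    by (rule nn_integral_mono) (auto simp: p_def split: split_indicator)
  finally show "(\<integral>\<^sup>+x. ennreal (f x) \<partial>limit_process l u) = \<infinity>"
    using f0 by (simp add: int ennreal_mult_top top_unique)
  let ?A = "{i. cutoff \<le> l i} \<times> window"
  have fin: "finite ?A" using finite_null_lengths_ge[OF l cutoff_pos] by simp
  have "(\<integral>\<^sup>+k. ennreal (- f (p k)) \<partial>count_space UNIV) = (\<Sum>k\<in>?A. ennreal (- f (p k)))"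
  proof (rule nn_integral_count_space'[OF fin])
    fix k assume k: "k \<in> (UNIV :: (nat \<times> int) set)" "k \<notin> ?A"
    obtain i q where iq: "k = (i, q)" by (cases k)
    show "ennreal (- f (p k)) = 0"
    proof (cases "u i + real_of_int q = 0")
      case True
      then show ?thesis using f0 by (simp add: p_def iq ennreal_neg)
    next
      case False
      have "f (p k) = 0"
        using limit_process_support[where u = u, OF l u _ False] k unfolding p_def iq prod.case by blast
      then show ?thesis by simp
    qed
  qed simp
  also have "\<dots> \<noteq> \<infinity>" using fin by simp
  finally show "(\<integral>\<^sup>+x. ennreal (- f x) \<partial>limit_process l u) \<noteq> \<infinity>"
    by (subst int) auto
qed

end

section \<open>Test functions vanishing at 0\<close>

context test_function
begin

definition char_factor :: "int \<Rightarrow> real \<Rightarrow> real \<Rightarrow> nat \<Rightarrow> complex" where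
  "char_factor s \<xi> x r = iexp (\<xi> * contribution x (mark s t r))"

lemma cycle_functional_char_factor:
  assumes "\<theta> > 0" "f 0 = 0"
  shows "cycle_functional \<theta> cutoff t (char_factor s \<xi>)"
proof
  show "continuous_on UNIV (\<lambda>x. char_factor s \<xi> x r)" for r
    unfolding char_factor_def
    by (intro continuous_intros continuous_contribution assms mark_in_grid t)
  show "char_factor s \<xi> x r = 1" if "0 \<le> x" "x < cutoff" for x r
  proof (cases "x = 0")
    case True
    then show ?thesis by (simp add: char_factor_def contribution_def assms)
  next
    case False
    then show ?thesis using that by (simp add: char_factor_def contribution_small mark_in_grid t)
  qed
qed (use assms t cutoff_pos in \<open>auto simp: char_factor_def simp del: of_real_mult\<close>)

text \<open>The partial products of the marked factors are eventually equal to
  \<open>iexp (\<xi> * Y \<omega>)\<close>. Their expectations are those of products of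
  \<open>avg\<close>, since averaging over the grid is averaging over residues by
  \<open>bij_betw_mark\<close>. Dominated convergence on both sides identifies the limits.\<close>

lemma char_limit:
  fixes N :: "'a measure" and L U :: "nat \<Rightarrow> 'a \<Rightarrow> real"
  assumes \<theta>: "\<theta> > 0" and s: "coprime s (int t)" and f0: "f 0 = 0"
    and N: "prob_space N"
    and L: "distr N (\<Pi>\<^sub>M i\<in>UNIV. borel) (\<lambda>\<omega> i. L i \<omega>) = poisson_dirichlet \<theta>"
    and U: "prob_space.indep_vars N (\<lambda>_. borel) U UNIV"
    and Ud: "\<And>i. distr N borel (U i) = distr (measure_pmf (pmf_of_set (mark_grid t))) borel (\<lambda>x. x)"
    and LU: "prob_space.indep_var N (\<Pi>\<^sub>M i\<in>UNIV. borel) (\<lambda>\<omega> i. L i \<omega>) (\<Pi>\<^sub>M i\<in>UNIV. borel) (\<lambda>\<omega> i. U i \<omega>)"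
    and null: "AE \<omega> in N. null_lengths (\<lambda>i. L i \<omega>) \<and> (\<forall>i. U i \<omega> \<in> mark_grid t)"
    and Y: "Y \<in> borel_measurable N"
      "AE \<omega> in N. Y \<omega> = (\<Sum>i | cutoff \<le> L i \<omega>. contribution (L i \<omega>) (U i \<omega>))"
  shows "(\<integral>\<omega>. iexp (\<xi> * Y \<omega>) \<partial>N) =
    (\<integral>l. cycle_functional.limit_functional t (char_factor s \<xi>) l \<partial>poisson_dirichlet \<theta>)"
proof -
  interpret prob_space N by (rule N)
  interpret C: cycle_functional \<theta> cutoff t "char_factor s \<xi>"
    using \<theta> f0 by (rule cycle_functional_char_factor)
  interpret P: prob_space "poisson_dirichlet \<theta>" using \<theta> by (rule prob_space_poisson_dirichlet)
  have [measurable]: "(\<lambda>\<omega> i. L i \<omega>) \<in> N \<rightarrow>\<^sub>M (\<Pi>\<^sub>M i\<in>UNIV. borel)" "(\<lambda>\<omega> i. U i \<omega>) \<in> N \<rightarrow>\<^sub>M (\<Pi>\<^sub>M i\<in>UNIV. borel)"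
    using LU by (auto simp: indep_var_distribution_eq)
  have Lm [measurable]: "L i \<in> borel_measurable N" for i
    using measurable_compose[OF \<open>(\<lambda>\<omega> i. L i \<omega>) \<in> _\<close> measurable_component_singleton[of i UNIV]] by simp
  have Um [measurable]: "U i \<in> borel_measurable N" for i
    using U by (auto simp: indep_vars_def)
  define g where "g x u = iexp (\<xi> * contribution x u)" for x u
  have g_meas: "case_prod g \<in> borel_measurable (borel \<Otimes>\<^sub>M borel)"
    unfolding g_def by measurable
  note [measurable] = g_meas Y(1)
  have avg: "(\<Sum>a\<in>mark_grid t. g x a) / of_nat (card (mark_grid t)) = C.avg x" for x
    unfolding C.avg_def char_factor_def card_mark_grid[OF t]
    using sum.reindex_bij_betw[OF bij_betw_mark[OF s t], of "g x"] by (simp add: g_def)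
  have E: "(\<integral>\<omega>. (\<Prod>i<K. g (L i \<omega>) (U i \<omega>)) \<partial>N) = (\<integral>l. (\<Prod>i<K. C.avg (l i)) \<partial>poisson_dirichlet \<theta>)" for K
  proof -
    have "mark_grid t \<noteq> {}" using t by (auto simp: mark_grid_def)
    from expectation_independent_marks[OF N L U Ud finite_mark_grid this LU g_meas]
    show ?thesis unfolding avg by (simp add: g_def)
  qed
  have "(\<lambda>K. \<integral>\<omega>. (\<Prod>i<K. g (L i \<omega>) (U i \<omega>)) \<partial>N) \<longlonglongrightarrow> (\<integral>\<omega>. iexp (\<xi> * Y \<omega>) \<partial>N)"
  proof (rule integral_dominated_convergence[where w = "\<lambda>_. 1"])
    show "AE \<omega> in N. (\<lambda>K. \<Prod>i<K. g (L i \<omega>) (U i \<omega>)) \<longlonglongrightarrow> iexp (\<xi> * Y \<omega>)"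
      using null Y(2)
    proof eventually_elim
      case (elim \<omega>)
      have fin: "finite {i. cutoff \<le> L i \<omega>}"
        using finite_null_lengths_ge[of "\<lambda>i. L i \<omega>"] elim cutoff_pos by auto
      have one: "g (L i \<omega>) (U i \<omega>) = 1" if "L i \<omega> < cutoff" for i
        using contribution_small[of "U i \<omega>" "L i \<omega>"] elim that by (auto simp: g_def null_lengths_def)
      have "(\<Prod>i | cutoff \<le> L i \<omega>. g (L i \<omega>) (U i \<omega>)) = iexp (\<xi> * Y \<omega>)"
        unfolding g_def elim(2) using fin by (simp add: exp_sum[symmetric] sum_distrib_left)
      moreover have "\<forall>\<^sub>F K in sequentially. (\<Prod>i<K. g (L i \<omega>) (U i \<omega>)) = (\<Prod>i | cutoff \<le> L i \<omega>. g (L i \<omega>) (U i \<omega>))"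
        using elim one by (intro prod_null_lengths_eventually cutoff_pos) auto
      ultimately show ?case by (intro tendsto_eventually) simp
    qed
    show "AE \<omega> in N. norm (\<Prod>i<K. g (L i \<omega>) (U i \<omega>)) \<le> 1" for K
      unfolding prod_norm[symmetric] by (intro AE_I2 prod_le_1) (simp add: g_def del: of_real_mult)
  qed auto
  moreover have "(\<lambda>K. \<integral>l. (\<Prod>i<K. C.avg (l i)) \<partial>poisson_dirichlet \<theta>) \<longlonglongrightarrow> (\<integral>l. C.limit_functional l \<partial>poisson_dirichlet \<theta>)"
  proof (rule integral_dominated_convergence[where w = "\<lambda>_. 1"])
    show "AE l in poisson_dirichlet \<theta>. (\<lambda>K. \<Prod>i<K. C.avg (l i)) \<longlonglongrightarrow> C.limit_functional l"
      using AE_null_lengths_PD[OF \<theta>] by eventually_elim (rule C.prod_avg_tendsto(1))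
  qed (auto simp: C.norm_prod_avg_le)
  ultimately show ?thesis unfolding E by (rule LIMSEQ_unique)
qed

text \<open>All integrals are almost surely finite here, so weak convergence on the reals suffices:
  \<open>g\<close> composed with \<open>ereal\<close> is bounded and continuous there.\<close>

lemma convergence_vanishing:
  fixes N :: "'a measure" and L U :: "nat \<Rightarrow> 'a \<Rightarrow> real" and g :: "ereal \<Rightarrow> real"
  assumes \<theta>: "\<theta> > 0" and s: "coprime s (int t)" "\<alpha> = real_of_int s / real t" and f0: "f 0 = 0"
    and N: "prob_space N"
    and L: "distr N (\<Pi>\<^sub>M i\<in>UNIV. borel) (\<lambda>\<omega> i. L i \<omega>) = poisson_dirichlet \<theta>"
    and U: "prob_space.indep_vars N (\<lambda>_. borel) U UNIV"
    and Ud: "\<And>i. distr N borel (U i) = distr (measure_pmf (pmf_of_set (mark_grid t))) borel (\<lambda>x. x)"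
    and LU: "prob_space.indep_var N (\<Pi>\<^sub>M i\<in>UNIV. borel) (\<lambda>\<omega> i. L i \<omega>) (\<Pi>\<^sub>M i\<in>UNIV. borel) (\<lambda>\<omega> i. U i \<omega>)"
    and null: "AE \<omega> in N. null_lengths (\<lambda>i. L i \<omega>) \<and> (\<forall>i. U i \<omega> \<in> mark_grid t)"
    and meas: "(\<lambda>\<omega>. ext_integral (limit_process (\<lambda>i. L i \<omega>) (\<lambda>i. U i \<omega>)) f) \<in> borel_measurable N"
    and g: "continuous_on UNIV g" "bounded (range g)"
  shows "(\<lambda>n. \<integral>\<sigma>. g (ext_integral (finite_process n \<alpha> \<sigma>) f) \<partial>ewens \<theta> n) \<longlonglongrightarrow>
    (\<integral>\<omega>. g (ext_integral (limit_process (\<lambda>i. L i \<omega>) (\<lambda>i. U i \<omega>)) f) \<partial>N)"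
proof -
  interpret prob_space N by (rule N)
  interpret E: prob_space "ewens \<theta> n" for n using \<theta> by (rule prob_space_ewens)
  define X where "X n \<sigma> = (\<Sum>c\<in>perm_cycles n \<sigma>. contribution (real (card c) / real n) (mark s t (card c)))" for n \<sigma>
  define Z where "Z \<omega> = ext_integral (limit_process (\<lambda>i. L i \<omega>) (\<lambda>i. U i \<omega>)) f" for \<omega>
  \<comment> \<open>Defined from the integral itself, so that it inherits measurability; the
    finite-sum formula holds only almost everywhere.\<close>
  define Y where "Y \<omega> = real_of_ereal (Z \<omega>)" for \<omega>
  have [measurable]: "Z \<in> borel_measurable N" unfolding Z_def by (rule meas)
  then have Ym [measurable]: "Y \<in> borel_measurable N" unfolding Y_def by measurable
  have Zeq: "AE \<omega> in N. Z \<omega> = ereal (\<Sum>i | cutoff \<le> L i \<omega>. contribution (L i \<omega>) (U i \<omega>))"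
    using null by eventually_elim (simp add: Z_def ext_integral_limit_process f0)
  have Yeq: "AE \<omega> in N. Y \<omega> = (\<Sum>i | cutoff \<le> L i \<omega>. contribution (L i \<omega>) (U i \<omega>))"
    using Zeq by eventually_elim (simp add: Y_def)
  have "weak_conv_m (\<lambda>n. distr (ewens \<theta> n) borel (X n)) (distr N borel Y)"
  proof (rule levy_continuity)
    show "real_distribution (distr (ewens \<theta> n) borel (X n))" for n
      by (rule E.real_distribution_distr) simp
    show "real_distribution (distr N borel Y)"
      by (rule real_distribution_distr) measurable
    fix \<xi>
    interpret C: cycle_functional \<theta> cutoff t "char_factor s \<xi>"
      using \<theta> f0 by (rule cycle_functional_char_factor)
    have "char (distr (ewens \<theta> n) borel (X n)) \<xi> = C.full_mean n n" for n
    proof -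
      have "char (distr (ewens \<theta> n) borel (X n)) \<xi> = (\<integral>\<sigma>. iexp (\<xi> * X n \<sigma>) \<partial>ewens \<theta> n)"
        unfolding char_def by (subst integral_distr) auto
      also have "\<dots> = (\<integral>\<sigma>. (\<Prod>c\<in>perm_cycles n \<sigma>. char_factor s \<xi> (real (card c) / real n) (card c mod t)) \<partial>ewens \<theta> n)"
        unfolding X_def char_factor_def mark_mod
        by (intro Bochner_Integration.integral_cong refl) (simp add: exp_sum[symmetric] sum_distrib_left)
      also have "\<dots> = C.full_mean n n"
        by (rule integral_ewens_prod[OF \<theta>])
      finally show ?thesis .
    qed
    moreover have "char (distr N borel Y) \<xi> = (\<integral>l. C.limit_functional l \<partial>poisson_dirichlet \<theta>)"
    proof -
      have "char (distr N borel Y) \<xi> = (\<integral>\<omega>. iexp (\<xi> * Y \<omega>) \<partial>N)"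
        unfolding char_def by (subst integral_distr) auto
      also have "\<dots> = (\<integral>l. C.limit_functional l \<partial>poisson_dirichlet \<theta>)"
        by (rule char_limit[OF \<theta> s(1) f0 N L U Ud LU null Ym Yeq])
      finally show ?thesis .
    qed
    ultimately show "(\<lambda>n. char (distr (ewens \<theta> n) borel (X n)) \<xi>) \<longlonglongrightarrow> char (distr N borel Y) \<xi>"
      using C.full_mean_tendsto[OF C.limit_mean_tendsto] by simp
  qed
  obtain B where B: "\<And>x. norm (g x) \<le> B" using g(2) by (auto simp: bounded_iff)
  have gc: "continuous_on UNIV (\<lambda>x. g (ereal x))"
    by (rule continuous_on_compose2[OF g(1)]) (auto intro!: continuous_intros)
  have [measurable]: "(\<lambda>x. g (ereal x)) \<in> borel_measurable borel"
    using gc by (rule borel_measurable_continuous_onI)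
  have [measurable]: "g \<in> borel_measurable borel"
    using g(1) by (rule borel_measurable_continuous_onI)
  have "(\<lambda>n. integral\<^sup>L (distr (ewens \<theta> n) borel (X n)) (\<lambda>x. g (ereal x))) \<longlonglongrightarrow> integral\<^sup>L (distr N borel Y) (\<lambda>x. g (ereal x))"
  proof (rule weak_conv_imp_integral_bdd_continuous_conv)
    show "isCont (\<lambda>x. g (ereal x)) x" for x
      using gc by (simp add: continuous_on_eq_continuous_at)
  qed (use B \<open>weak_conv_m _ _\<close> in \<open>auto intro: E.real_distribution_distr real_distribution_distr\<close>)
  moreover have "integral\<^sup>L (distr (ewens \<theta> n) borel (X n)) (\<lambda>x. g (ereal x)) =
      (\<integral>\<sigma>. g (ext_integral (finite_process n \<alpha> \<sigma>) f) \<partial>ewens \<theta> n)" for n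
  proof -
    have "integral\<^sup>L (distr (ewens \<theta> n) borel (X n)) (\<lambda>x. g (ereal x)) = (\<integral>\<sigma>. g (ereal (X n \<sigma>)) \<partial>ewens \<theta> n)"
      by (subst integral_distr) auto
    also have "\<dots> = (\<integral>\<sigma>. g (ext_integral (finite_process n \<alpha> \<sigma>) f) \<partial>ewens \<theta> n)"
    proof (rule Bochner_Integration.integral_cong[OF refl])
      fix \<sigma> assume "\<sigma> \<in> space (ewens \<theta> n)"
      then have \<sigma>: "\<sigma> permutes {1..n}" by (simp add: space_ewens)
      have "ext_integral (finite_process n \<alpha> \<sigma>) f = ereal (X n \<sigma>)"
        unfolding ext_integral_finite_process[OF s \<sigma>] X_def f0 by simp
      then show "g (ereal (X n \<sigma>)) = g (ext_integral (finite_process n \<alpha> \<sigma>) f)" by simp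
    qed
    finally show ?thesis .
  qed
  moreover have "integral\<^sup>L (distr N borel Y) (\<lambda>x. g (ereal x)) = (\<integral>\<omega>. g (Z \<omega>) \<partial>N)"
  proof -
    have "integral\<^sup>L (distr N borel Y) (\<lambda>x. g (ereal x)) = (\<integral>\<omega>. g (ereal (Y \<omega>)) \<partial>N)"
      by (subst integral_distr) auto
    also have "\<dots> = (\<integral>\<omega>. g (Z \<omega>) \<partial>N)"
    proof (rule integral_cong_AE)
      show "AE \<omega> in N. g (ereal (Y \<omega>)) = g (Z \<omega>)"
        using Zeq by eventually_elim (simp add: Y_def)
    qed measurable
    finally show ?thesis .
  qed
  ultimately show ?thesis unfolding Z_def by simp
qed

section \<open>Test functions not vanishing at 0\<close>

lemma abs_contribution_le: "\<exists>H\<ge>0. \<forall>x u. \<bar>contribution x u\<bar> \<le> H"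
proof -
  have "bounded (f ` {-R..R})"
    using f_cont by (intro compact_imp_bounded compact_continuous_image) (auto intro: continuous_on_subset)
  then obtain F where F: "\<forall>x\<in>{-R..R}. \<bar>f x\<bar> \<le> F" by (auto simp: bounded_iff)
  have F0: "F \<ge> 0" using F[rule_format, of 0] R by simp
  have Fle: "\<bar>f x\<bar> \<le> F" for x
    using f_supp[of x] F[rule_format, of x] F0 by (cases "f x = 0") (auto simp: abs_le_iff)
  have "\<bar>contribution x u\<bar> \<le> real (card window) * F" for x u
  proof -
    have "\<bar>contribution x u\<bar> \<le> (\<Sum>q\<in>{q\<in>window. u + real_of_int q \<noteq> 0}. \<bar>f ((u + real_of_int q) / x)\<bar>)"
      unfolding contribution_def by (rule sum_abs)
    also have "\<dots> \<le> (\<Sum>q\<in>window. F)"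
      using Fle F0 by (intro order_trans[OF sum_mono sum_mono2]) auto
    finally show ?thesis by simp
  qed
  then show ?thesis using F0 by (intro exI[of _ "real (card window) * F"]) auto
qed

text \<open>A cycle contributes at most \<open>H\<close>, and nothing if its relative length is
  below \<open>cutoff\<close>; so it contributes at most \<open>H\<close> times its relative length
  over \<open>cutoff\<close>. The relative lengths sum to \<open>1\<close>.\<close>

lemma abs_sum_contribution_le:
  "\<exists>B. \<forall>n \<sigma> s. \<sigma> permutes {1..n} \<longrightarrow>
    \<bar>\<Sum>c\<in>perm_cycles n \<sigma>. contribution (real (card c) / real n) (mark s t (card c))\<bar> \<le> B"
proof -
  obtain H where H: "H \<ge> 0" "\<And>x u. \<bar>contribution x u\<bar> \<le> H" using abs_contribution_le by blast
  have "\<bar>\<Sum>c\<in>perm_cycles n \<sigma>. contribution (real (card c) / real n) (mark s t (card c))\<bar> \<le> H / cutoff"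
    if \<sigma>: "\<sigma> permutes {1..n}" for n \<sigma> s
  proof (cases "n = 0")
    case True
    then show ?thesis using H cutoff_pos by (simp add: perm_cycles_def)
  next
    case False
    then have n: "real n > 0" by simp
    have "\<bar>contribution (real (card c) / real n) (mark s t (card c))\<bar> \<le> H * (real (card c) / (cutoff * real n))"
      if c: "c \<in> perm_cycles n \<sigma>" for c
    proof (cases "real (card c) / real n < cutoff")
      case True
      have "card c > 0" using perm_cycles_subset(3)[OF \<sigma> c] by simp
      then show ?thesis
        using True n H cutoff_pos by (subst contribution_small) (auto intro!: mark_in_grid t)
    next
      case False
      then have "1 \<le> real (card c) / (cutoff * real n)"
        using n cutoff_pos by (simp add: field_simps)
      then have "H * 1 \<le> H * (real (card c) / (cutoff * real n))" using H by (intro mult_left_mono) auto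
      then show ?thesis using H(2) order_trans by fastforce
    qed
    then have "\<bar>\<Sum>c\<in>perm_cycles n \<sigma>. contribution (real (card c) / real n) (mark s t (card c))\<bar> \<le>
        (\<Sum>c\<in>perm_cycles n \<sigma>. H * (real (card c) / (cutoff * real n)))"
      by (intro order_trans[OF sum_abs sum_mono]) auto
    also have "\<dots> = H * (real (\<Sum>c\<in>perm_cycles n \<sigma>. card c) / (cutoff * real n))"
      by (simp add: sum_distrib_left sum_divide_distrib)
    also have "\<dots> = H / cutoff"
      using n unfolding sum_card_perm_cycles[OF \<sigma>] by simp
    finally show ?thesis .
  qed
  then show ?thesis by blast
qed

text \<open>If more than \<open>k\<close> cycles have length divisible by \<open>t\<close>, the
  integral is so large that \<open>g\<close> is within \<open>e / 2\<close> of
  \<open>g \<infinity>\<close>. Otherwise \<open>1 \<le> 2 ^ k * W n \<sigma>\<close>, and the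
  trivial bound \<open>2 * M\<close> is paid for by the mean of \<open>W\<close>, which tends to
  \<open>0\<close>.\<close>

lemma convergence_positive:
  fixes g :: "ereal \<Rightarrow> real"
  assumes \<theta>: "\<theta> > 0" and s: "coprime s (int t)" "\<alpha> = real_of_int s / real t" and f0: "f 0 > 0"
    and g: "continuous_on UNIV g" "bounded (range g)"
  shows "(\<lambda>n. \<integral>\<sigma>. g (ext_integral (finite_process n \<alpha> \<sigma>) f) \<partial>ewens \<theta> n) \<longlonglongrightarrow> g \<infinity>"
proof (rule tendstoI)
  fix e :: real assume e: "e > 0"
  interpret E: prob_space "ewens \<theta> n" for n using \<theta> by (rule prob_space_ewens)
  obtain M where M: "\<And>x. norm (g x) \<le> M" using g(2) by (auto simp: bounded_iff)
  have M0: "M \<ge> 0" using norm_ge_zero M order_trans by blast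
  obtain B where B: "\<And>n \<sigma> s. \<sigma> permutes {1..n} \<Longrightarrow>
    \<bar>\<Sum>c\<in>perm_cycles n \<sigma>. contribution (real (card c) / real n) (mark s t (card c))\<bar> \<le> B"
    using abs_sum_contribution_le by blast
  have "((\<lambda>x. g (ereal x)) \<longlongrightarrow> g \<infinity>) at_top"
  proof -
    have "isCont g \<infinity>" using g(1) by (simp add: continuous_on_eq_continuous_at)
    moreover have "((\<lambda>x. ereal x) \<longlongrightarrow> \<infinity>) at_top" by (simp add: tendsto_PInfty eventually_gt_at_top)
    ultimately show ?thesis by (rule isCont_tendsto_compose)
  qed
  then have "\<forall>\<^sub>F x in at_top. dist (g (ereal x)) (g \<infinity>) < e / 2"
    by (rule tendstoD) (use e in simp)
  then obtain A where A: "\<And>x. x \<ge> A \<Longrightarrow> dist (g (ereal x)) (g \<infinity>) < e / 2"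
    unfolding eventually_at_top_linorder by blast
  \<comment> \<open>More than \<open>k\<close> such cycles push the integral to at least
    \<open>A\<close>, because the contributions away from \<open>0\<close> sum to at least
    \<open>- B\<close>.\<close>
  obtain k :: nat where k: "real k \<ge> (A + B) / f 0" using real_arch_simple by blast
  define w where "w j = (if t dvd j then 1 / 2 else 1 :: real)" for j
  define W where "W n \<sigma> = (\<Prod>c\<in>perm_cycles n \<sigma>. w (card c))" for n and \<sigma> :: "nat \<Rightarrow> nat"
  have W0: "W n \<sigma> \<ge> 0" for n \<sigma> unfolding W_def by (intro prod_nonneg) (auto simp: w_def)
  have bound: "dist (g (ext_integral (finite_process n \<alpha> \<sigma>) f)) (g \<infinity>) \<le> e / 2 + 2 * M * 2 ^ k * W n \<sigma>"
    if \<sigma>: "\<sigma> permutes {1..n}" for n \<sigma>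
  proof -
    define Z where "Z = card {c\<in>perm_cycles n \<sigma>. t dvd card c}"
    define x where "x = f 0 * real Z + (\<Sum>c\<in>perm_cycles n \<sigma>. contribution (real (card c) / real n) (mark s t (card c)))"
    have WZ: "W n \<sigma> = (1 / 2) ^ Z"
      unfolding W_def w_def Z_def by (simp add: prod.If_cases Int_def power_one_over)
    have X: "ext_integral (finite_process n \<alpha> \<sigma>) f = ereal x"
      unfolding ext_integral_finite_process[OF s \<sigma>] x_def Z_def sum.distrib
      by (simp add: sum.If_cases Int_def)
    show ?thesis
    proof (cases "Z \<le> k")
      case True
      have "(2::real) ^ Z \<le> 2 ^ k" using True by simp
      then have "1 \<le> 2 ^ k * W n \<sigma>" unfolding WZ by (simp add: field_simps power_one_over)
      then have "2 * M * 1 \<le> 2 * M * (2 ^ k * W n \<sigma>)" using M0 by (intro mult_left_mono) auto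
      moreover have "dist (g (ereal x)) (g \<infinity>) \<le> norm (g (ereal x)) + norm (g \<infinity>)"
        unfolding dist_norm by (rule norm_triangle_ineq4)
      ultimately show ?thesis unfolding X using M[of "ereal x"] M[of \<infinity>] e by (simp add: mult.assoc)
    next
      case False
      then have "(A + B) / f 0 \<le> real Z" using k by linarith
      then have "A + B \<le> f 0 * real Z" using f0 by (simp add: pos_divide_le_eq mult.commute)
      then have "x \<ge> A" unfolding x_def using B[OF \<sigma>, of s] by linarith
      then have "dist (g (ereal x)) (g \<infinity>) \<le> e / 2" using A by (intro less_imp_le)
      moreover have "0 \<le> 2 * M * 2 ^ k * W n \<sigma>" using M0 W0 by simp
      ultimately show ?thesis unfolding X by linarith
    qed
  qed
  have "(\<lambda>n. 2 * M * 2 ^ k * ewens_mean \<theta> w n) \<longlonglongrightarrow> 2 * M * 2 ^ k * 0"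
    unfolding w_def by (intro tendsto_intros ewens_mean_half_tendsto_0 \<theta> t)
  then have "\<forall>\<^sub>F n in sequentially. 2 * M * 2 ^ k * ewens_mean \<theta> w n < e / 2"
    by (rule order_tendstoD(2)) (use e in simp)
  then show "\<forall>\<^sub>F n in sequentially. dist (\<integral>\<sigma>. g (ext_integral (finite_process n \<alpha> \<sigma>) f) \<partial>ewens \<theta> n) (g \<infinity>) < e"
  proof eventually_elim
    case (elim n)
    let ?X = "\<lambda>\<sigma>. g (ext_integral (finite_process n \<alpha> \<sigma>) f)"
    have "(\<integral>\<sigma>. ?X \<sigma> \<partial>ewens \<theta> n) - g \<infinity> = (\<integral>\<sigma>. ?X \<sigma> - g \<infinity> \<partial>ewens \<theta> n)"
      by (subst Bochner_Integration.integral_diff) (simp_all add: integrable_ewens \<theta> E.prob_space)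
    then have "dist (\<integral>\<sigma>. ?X \<sigma> \<partial>ewens \<theta> n) (g \<infinity>) \<le> (\<integral>\<sigma>. norm (?X \<sigma> - g \<infinity>) \<partial>ewens \<theta> n)"
      unfolding dist_norm by (metis integral_norm_bound)
    also have "\<dots> \<le> (\<integral>\<sigma>. e / 2 + 2 * M * 2 ^ k * W n \<sigma> \<partial>ewens \<theta> n)"
      using bound by (intro integral_mono integrable_ewens \<theta>) (auto simp: space_ewens dist_norm)
    also have "\<dots> = e / 2 + 2 * M * 2 ^ k * ewens_mean \<theta> w n"
      using integral_ewens_prod[OF \<theta>, of n w]
      by (simp add: integrable_ewens \<theta> E.prob_space W_def)
    finally show ?case using elim by linarith
  qed
qed

end

section \<open>Measurability of the limit integral and recurrence of the mark
  \<open>1\<close>\<close>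

lemma measurable_ext_integral_limit_process:
  fixes N :: "'a measure" and L U :: "nat \<Rightarrow> 'a \<Rightarrow> real"
  assumes [measurable]: "f \<in> borel_measurable borel" "\<And>i. L i \<in> borel_measurable N" "\<And>i. U i \<in> borel_measurable N"
  shows "(\<lambda>\<omega>. ext_integral (limit_process (\<lambda>i. L i \<omega>) (\<lambda>i. U i \<omega>)) f) \<in> borel_measurable N"
proof -
  have *: "(\<lambda>\<omega>. \<integral>\<^sup>+x. ennreal (h x) \<partial>limit_process (\<lambda>i. L i \<omega>) (\<lambda>i. U i \<omega>)) \<in> borel_measurable N"
    if [measurable]: "h \<in> borel_measurable borel" for h :: "real \<Rightarrow> real"
  proof -
    define F where "F \<omega> k = ennreal (h ((U (fst k) \<omega> + real_of_int (snd k)) / L (fst k) \<omega>))" for \<omega> and k :: "nat \<times> int"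
    have [measurable]: "(\<lambda>\<omega>. F \<omega> k) \<in> borel_measurable N" for k
      unfolding F_def by measurable
    have "(\<integral>\<^sup>+x. ennreal (h x) \<partial>limit_process (\<lambda>i. L i \<omega>) (\<lambda>i. U i \<omega>)) = (\<integral>\<^sup>+k. F \<omega> k \<partial>count_space UNIV)" for \<omega>
      unfolding limit_process_def F_def by (subst nn_integral_dirac_sum) (auto simp: split_beta)
    moreover have "(\<lambda>\<omega>. \<integral>\<^sup>+k. F \<omega> k \<partial>count_space UNIV) \<in> borel_measurable N"
    proof (rule sigma_finite_measure.borel_measurable_nn_integral)
      show "sigma_finite_measure (count_space (UNIV :: (nat \<times> int) set))"
        by (rule sigma_finite_measure_count_space)
      have "(\<lambda>z. F (fst z) (snd z)) \<in> borel_measurable (N \<Otimes>\<^sub>M count_space UNIV)"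
        by (rule measurable_compose_countable[where g = snd]) measurable
      then show "case_prod F \<in> borel_measurable (N \<Otimes>\<^sub>M count_space UNIV)"
        by (simp add: split_beta')
    qed
    ultimately show ?thesis by simp
  qed
  have "(\<lambda>x. - f x) \<in> borel_measurable borel" by measurable
  from *[OF assms(1)] *[OF this] show ?thesis unfolding ext_integral_def by measurable
qed

text \<open>A direct second Borel-Cantelli argument: \<open>n\<close> consecutive marks all differ
  from \<open>1\<close> with probability \<open>(1 - 1 / t) ^ n\<close>, so missing \<open>1\<close>
  from index \<open>k\<close> on is a null event for each \<open>k\<close>.\<close>

lemma AE_infinitely_many_marks:
  fixes U :: "nat \<Rightarrow> 'a \<Rightarrow> real"
  assumes N: "prob_space N" and U: "prob_space.indep_vars N (\<lambda>_. borel) U UNIV" and t: "t > 0"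
    and Ud: "\<And>i. distr N borel (U i) = distr (measure_pmf (pmf_of_set (mark_grid t))) borel (\<lambda>x. x)"
  shows "AE \<omega> in N. infinite {i. U i \<omega> = 1}"
proof -
  interpret prob_space N by (rule N)
  have [measurable]: "U i \<in> borel_measurable N" for i using U by (auto simp: indep_vars_def)
  have ne: "mark_grid t \<noteq> {}" and one: "1 \<in> mark_grid t" using t by (auto simp: mark_grid_def image_iff intro!: bexI[of _ t])
  define q where "q = 1 - 1 / real t"
  have q: "0 \<le> q" "q < 1" using t by (auto simp: q_def)
  have prob1: "prob (U i -` (- {1}) \<inter> space N) = q" for i
  proof -
    have "prob (U i -` (- {1}) \<inter> space N) = measure (distr N borel (U i)) (- {1})"
      by (subst measure_distr) auto
    also have "\<dots> = measure (measure_pmf (pmf_of_set (mark_grid t))) (- {1})"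
      unfolding Ud by (subst measure_distr) auto
    also have "\<dots> = card (mark_grid t \<inter> - {1}) / card (mark_grid t)"
      using ne by (intro measure_pmf_of_set) auto
    also have "mark_grid t \<inter> - {1} = mark_grid t - {1}" by auto
    also have "card (mark_grid t - {1}) = t - 1"
      using one by (simp add: card_mark_grid t)
    also have "real (t - 1) / real (card (mark_grid t)) = q"
      using t by (simp add: card_mark_grid q_def of_nat_diff field_simps)
    finally show ?thesis .
  qed
  have "AE \<omega> in N. \<exists>i\<ge>k. U i \<omega> = 1" for k
  proof -
    define A where "A = {\<omega>\<in>space N. \<forall>i\<ge>k. U i \<omega> \<noteq> 1}"
    have [measurable]: "A \<in> sets N" unfolding A_def by measurable
    have "prob A \<le> q ^ n" for n
    proof (cases "n = 0")
      case False
      have "prob A \<le> prob (\<Inter>i\<in>{k..<k+n}. U i -` (- {1}) \<inter> space N)"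
        using False by (intro finite_measure_mono sets.finite_INT) (auto simp: A_def)
      also have "\<dots> = (\<Prod>i\<in>{k..<k+n}. prob (U i -` (- {1}) \<inter> space N))"
        using False by (intro indep_varsD[OF U]) auto
      also have "\<dots> = q ^ n" by (simp add: prob1)
      finally show ?thesis .
    qed simp
    moreover have "(\<lambda>n. q ^ n) \<longlonglongrightarrow> 0" using q by (intro LIMSEQ_realpow_zero) auto
    ultimately have "prob A \<le> 0" by (intro LIMSEQ_le_const) auto
    then have "prob A = 0" by (simp add: measure_le_0_iff)
    then have "AE \<omega> in N. \<omega> \<notin> A" by (simp add: prob_eq_0)
    then show ?thesis using AE_space by eventually_elim (auto simp: A_def)
  qed
  then have "AE \<omega> in N. \<forall>k. \<exists>i\<ge>k. U i \<omega> = 1" by (simp add: AE_all_countable)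
  then show ?thesis by eventually_elim (simp add: infinite_nat_iff_unbounded_le)
qed

section \<open>The convergence theorem\<close>

theorem theorem4p1:
  fixes \<theta> \<alpha> :: real and s :: int and t :: nat
    and N :: "'a measure" and L U :: "nat \<Rightarrow> 'a \<Rightarrow> real"
  assumes "\<theta> > 0"
    and "t \<ge> 1" and "coprime s (int t)" and "\<alpha> = real_of_int s / real t"
    and "prob_space N"
    and "distr N (\<Pi>\<^sub>M i\<in>UNIV. borel) (\<lambda>\<omega> i. L i \<omega>) = poisson_dirichlet \<theta>"
    and "prob_space.indep_vars N (\<lambda>_. borel) U UNIV"
    and "\<forall>i. distr N borel (U i) =
           distr (measure_pmf (pmf_of_set ((\<lambda>k. real k / real t) ` {1..t}))) borel (\<lambda>x. x)"
    and "prob_space.indep_var N (\<Pi>\<^sub>M i\<in>UNIV. borel) (\<lambda>\<omega> i. L i \<omega>) (\<Pi>\<^sub>M i\<in>UNIV. borel) (\<lambda>\<omega> i. U i \<omega>)"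
  shows "\<forall>f :: real \<Rightarrow> real. continuous_on UNIV f \<and> compact (closure {x. f x \<noteq> 0}) \<longrightarrow>
    converges_in_distribution
      (ewens \<theta>) (\<lambda>n \<sigma>. ext_integral (finite_process n \<alpha> \<sigma>) f)
      N (\<lambda>\<omega>. ext_integral (limit_process (\<lambda>i. L i \<omega>) (\<lambda>i. U i \<omega>)) f)"
proof (intro allI impI)
  fix f :: "real \<Rightarrow> real"
  assume f: "continuous_on UNIV f \<and> compact (closure {x. f x \<noteq> 0})"
  interpret prob_space N by fact
  have t: "t > 0" using assms(2) by simp
  have Ud: "distr N borel (U i) = distr (measure_pmf (pmf_of_set (mark_grid t))) borel (\<lambda>x. x)" for i
    using assms(8) by (simp add: mark_grid_def)
  have Lm: "(\<lambda>\<omega> i. L i \<omega>) \<in> N \<rightarrow>\<^sub>M (\<Pi>\<^sub>M i\<in>UNIV. borel)"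
    using assms(9) by (auto simp: indep_var_distribution_eq)
  have Lim: "L i \<in> borel_measurable N" for i
    using measurable_compose[OF Lm measurable_component_singleton[of i UNIV]] by simp
  have Um: "U i \<in> borel_measurable N" for i
    using assms(7) by (auto simp: indep_vars_def)
  have "AE l in distr N (\<Pi>\<^sub>M i\<in>UNIV. borel) (\<lambda>\<omega> i. L i \<omega>). null_lengths l"
    unfolding assms(6) by (rule AE_null_lengths_PD[OF assms(1)])
  then have nullL: "AE \<omega> in N. null_lengths (\<lambda>i. L i \<omega>)"
    by (rule AE_distrD[OF Lm, of null_lengths])
  have "AE \<omega> in N. U i \<omega> \<in> mark_grid t" for i
  proof -
    have "mark_grid t \<noteq> {}" using t by (auto simp: mark_grid_def)
    then have "AE x in measure_pmf (pmf_of_set (mark_grid t)). x \<in> mark_grid t"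
      by (simp add: AE_measure_pmf_iff)
    moreover have "mark_grid t \<in> sets borel"
      by (intro borel_closed finite_imp_closed finite_mark_grid)
    ultimately have "AE x in distr N borel (U i). x \<in> mark_grid t"
      unfolding Ud by (subst AE_distr_iff) auto
    then show ?thesis by (rule AE_distrD[OF Um, of "\<lambda>x. x \<in> mark_grid t"])
  qed
  then have "AE \<omega> in N. \<forall>i. U i \<omega> \<in> mark_grid t" by (simp add: AE_all_countable)
  with nullL have null: "AE \<omega> in N. null_lengths (\<lambda>i. L i \<omega>) \<and> (\<forall>i. U i \<omega> \<in> mark_grid t)"
    by eventually_elim simp
  have inf: "AE \<omega> in N. infinite {i. U i \<omega> = 1}"
    by (rule AE_infinitely_many_marks[OF assms(5,7) t Ud])
  have fm: "f \<in> borel_measurable borel"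
    using f by (intro borel_measurable_continuous_onI) simp
  have meas: "(\<lambda>\<omega>. ext_integral (limit_process (\<lambda>i. L i \<omega>) (\<lambda>i. U i \<omega>)) f) \<in> borel_measurable N"
    by (rule measurable_ext_integral_limit_process[OF fm Lim Um])
  have "bounded {x. f x \<noteq> 0}"
    using f by (intro bounded_subset[OF compact_imp_bounded closure_subset]) simp
  then obtain R where R: "R > 0" "\<forall>x\<in>{x. f x \<noteq> 0}. norm x \<le> R" by (auto simp: bounded_pos)
  interpret F: test_function f R t
    by standard (use f R t in auto)
  \<comment> \<open>The case \<open>f 0 < 0\<close> is reduced to the positive one by passing to
    \<open>- f\<close> and testing with \<open>g (- x)\<close>.\<close>
  interpret F': test_function "\<lambda>x. - f x" R t
    by standard (use f R t in \<open>auto intro!: continuous_intros\<close>)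
  show "converges_in_distribution
      (ewens \<theta>) (\<lambda>n \<sigma>. ext_integral (finite_process n \<alpha> \<sigma>) f)
      N (\<lambda>\<omega>. ext_integral (limit_process (\<lambda>i. L i \<omega>) (\<lambda>i. U i \<omega>)) f)"
    unfolding converges_in_distribution_def
  proof (intro conjI allI impI)
    fix g :: "ereal \<Rightarrow> real"
    assume g: "continuous_on UNIV g" "bounded (range g)"
    have [measurable]: "g \<in> borel_measurable borel"
      using g(1) by (rule borel_measurable_continuous_onI)
    have const: "(\<integral>\<omega>. g (ext_integral (limit_process (\<lambda>i. L i \<omega>) (\<lambda>i. U i \<omega>)) f) \<partial>N) = g y"
      if "AE \<omega> in N. ext_integral (limit_process (\<lambda>i. L i \<omega>) (\<lambda>i. U i \<omega>)) f = y" for y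
    proof -
      have "(\<integral>\<omega>. g (ext_integral (limit_process (\<lambda>i. L i \<omega>) (\<lambda>i. U i \<omega>)) f) \<partial>N) = (\<integral>\<omega>. g y \<partial>N)"
      proof (rule integral_cong_AE)
        show "AE \<omega> in N. g (ext_integral (limit_process (\<lambda>i. L i \<omega>) (\<lambda>i. U i \<omega>)) f) = g y"
          using that by eventually_elim simp
      qed (use meas in measurable)
      then show ?thesis by (simp add: prob_space)
    qed
    consider "f 0 = 0" | "f 0 > 0" | "f 0 < 0" by linarith
    then show "(\<lambda>n. \<integral>\<sigma>. g (ext_integral (finite_process n \<alpha> \<sigma>) f) \<partial>ewens \<theta> n) \<longlonglongrightarrow>
        (\<integral>\<omega>. g (ext_integral (limit_process (\<lambda>i. L i \<omega>) (\<lambda>i. U i \<omega>)) f) \<partial>N)"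
    proof cases
      case 1
      show ?thesis
        by (rule F.convergence_vanishing[OF assms(1,3,4) 1 assms(5,6,7) Ud assms(9) null meas g])
    next
      case 2
      have "AE \<omega> in N. ext_integral (limit_process (\<lambda>i. L i \<omega>) (\<lambda>i. U i \<omega>)) f = \<infinity>"
        using null inf
      proof eventually_elim
        case (elim \<omega>)
        then show ?case
          using F.limit_process_infinite[of "\<lambda>i. L i \<omega>" "\<lambda>i. U i \<omega>"] 2
          by (simp add: ext_integral_def enn2ereal_eq_top_iff)
      qed
      from const[OF this] F.convergence_positive[OF assms(1,3,4) 2 g] show ?thesis by simp
    next
      case 3
      have "AE \<omega> in N. ext_integral (limit_process (\<lambda>i. L i \<omega>) (\<lambda>i. U i \<omega>)) f = - \<infinity>"
        using null inf
      proof eventually_elim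
        case (elim \<omega>)
        have "a - \<infinity> = - \<infinity>" if "a \<noteq> \<infinity>" for a :: ereal
          using that by (cases a) auto
        then show ?case using elim
          using F'.limit_process_infinite[of "\<lambda>i. L i \<omega>" "\<lambda>i. U i \<omega>"] 3
          by (simp add: ext_integral_def enn2ereal_eq_top_iff)
      qed
      note lim = const[OF this]
      have "continuous_on UNIV (\<lambda>x. g (- x))"
        by (rule continuous_on_compose2[OF g(1)]) (auto intro!: continuous_intros)
      moreover have "bounded (range (\<lambda>x. g (- x)))"
        using g(2) by (rule bounded_subset) auto
      \<comment> \<open>The sign is changed only for the finite processes, whose integrals are real
        numbers. \<open>ext_integral\<close> is not odd when both parts are infinite, so the limit
        side was computed from its two parts.\<close>
      ultimately have "(\<lambda>n. \<integral>\<sigma>. g (- ext_integral (finite_process n \<alpha> \<sigma>) (\<lambda>x. - f x)) \<partial>ewens \<theta> n) \<longlonglongrightarrow> g (- \<infinity>)"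
        using F'.convergence_positive[OF assms(1,3,4), of "\<lambda>x. g (- x)"] 3 by simp
      moreover have "(\<integral>\<sigma>. g (- ext_integral (finite_process n \<alpha> \<sigma>) (\<lambda>x. - f x)) \<partial>ewens \<theta> n) =
          (\<integral>\<sigma>. g (ext_integral (finite_process n \<alpha> \<sigma>) f) \<partial>ewens \<theta> n)" for n
      proof (rule Bochner_Integration.integral_cong[OF refl])
        fix \<sigma> assume "\<sigma> \<in> space (ewens \<theta> n)"
        then have \<sigma>: "\<sigma> permutes {1..n}" by (simp add: space_ewens)
        have "F'.contribution x u = - F.contribution x u" for x u
          unfolding F'.contribution_def F.contribution_def F'.window_def F.window_def by (simp add: sum_negf)
        then show "g (- ext_integral (finite_process n \<alpha> \<sigma>) (\<lambda>x. - f x)) = g (ext_integral (finite_process n \<alpha> \<sigma>) f)"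
          unfolding F.ext_integral_finite_process[OF assms(3,4) \<sigma>] F'.ext_integral_finite_process[OF assms(3,4) \<sigma>]
            uminus_ereal.simps sum_negf[symmetric]
          by (intro arg_cong[of _ _ g] arg_cong[of _ _ ereal] sum.cong refl) simp
      qed
      ultimately show ?thesis unfolding lim by simp
    qed
  qed (use meas in auto)
qed

end
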